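(* Let $M$ be an $n_1\times n_2$ matrix of rank $r$ obeying assumptions A0 and A1 (with parameters $\mu_0>0$ and $\mu_1\ge 1$), and put $n=\max(n_1,n_2)$. Suppose we observe the $m$ entries of $M$ indexed by a set $\Omega$ of cardinality $m$ sampled uniformly at random. Then there exist numerical constants $C,c$ such that if $$m\ge C\max\big(\mu_1^2,\ \mu_0^{1/2}\mu_1,\ \mu_0 n^{1/4}\big)\,n\,r\,(\beta\log n)$$ for some $\beta>2$, then the minimizer of $$\text{minimize } \|X\|_* \quad\text{subject to } X_{ij}=M_{ij},\ (i,j)\in\Omega$$ is unique and equal to $M$ with probability at least $1-c\,n^{-\beta}$. For $r\le \mu_0^{-1}n^{1/5}$, the same conclusion holds, with the same probability, under the condition $$m\ge C\,\mu_0\,n^{6/5}\,r\,(\beta\log n).$$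
   Context: $\|X\|_*$ is the nuclear norm. Let $M=\sum_{k=1}^r\sigma_ku_kv_k^*$ be the SVD of $M$ ($\sigma_k>0$, $\{u_k\}$ orthonormal in $\mathbb{R}^{n_1}$, $\{v_k\}$ orthonormal in $\mathbb{R}^{n_2}$), and let $U=\mathrm{span}(u_1,\dots,u_r)$, $V=\mathrm{span}(v_1,\dots,v_r)$ be the column and row spaces. Coherence: for a subspace $W\subseteq\mathbb{R}^d$ of dimension $r$ with orthogonal projection $P_W$, $\mu(W)=\frac{d}{r}\max_{1\le i\le d}\|P_We_i\|^2$, where $(e_i)$ is the standard basis of $\mathbb{R}^d$. Assumption A0: $\max(\mu(U),\mu(V))\le\mu_0$. Assumption A1: every entry of the $n_1\times n_2$ matrix $\sum_{k=1}^ru_kv_k^*$ is bounded in absolute value by $\mu_1\sqrt{r/(n_1n_2)}$. *)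

theory Defs
  imports Complex_Main
begin

text \<open>Matrices of size n1 x n2 are functions nat => nat => real; only entries
  i < n1, j < n2 matter. A family of r vectors in R^d is u :: nat => nat => real,
  with u k i the i-th coordinate of the k-th vector (k < r, i < d).\<close>

definition orthonormal_family :: "nat \<Rightarrow> nat \<Rightarrow> (nat \<Rightarrow> nat \<Rightarrow> real) \<Rightarrow> bool" where
  "orthonormal_family d r u \<longleftrightarrow>
     (\<forall>k<r. \<forall>l<r. (\<Sum>i<d. u k i * u l i) = (if k = l then 1 else 0))"

definition is_svd ::
  "nat \<Rightarrow> nat \<Rightarrow> (nat \<Rightarrow> nat \<Rightarrow> real) \<Rightarrow> nat \<Rightarrow> (nat \<Rightarrow> real)
   \<Rightarrow> (nat \<Rightarrow> nat \<Rightarrow> real) \<Rightarrow> (nat \<Rightarrow> nat \<Rightarrow> real) \<Rightarrow> bool" where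
  "is_svd n1 n2 X r \<sigma> u v \<longleftrightarrow>
     (\<forall>k<r. \<sigma> k > 0) \<and> orthonormal_family n1 r u \<and> orthonormal_family n2 r v \<and>
     (\<forall>i<n1. \<forall>j<n2. X i j = (\<Sum>k<r. \<sigma> k * u k i * v k j))"

definition nuclear_norm :: "nat \<Rightarrow> nat \<Rightarrow> (nat \<Rightarrow> nat \<Rightarrow> real) \<Rightarrow> real" where
  "nuclear_norm n1 n2 X =
     (THE s. \<exists>r \<sigma> u v. is_svd n1 n2 X r \<sigma> u v \<and> s = (\<Sum>k<r. \<sigma> k))"

text \<open>Coherence of W = span(u_0,...,u_{r-1}) (u orthonormal) in R^d:
  (d/r) max_i ||P_W e_i||^2, where ||P_W e_i||^2 = sum_k (u_k i)^2.\<close>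
definition coherence :: "nat \<Rightarrow> nat \<Rightarrow> (nat \<Rightarrow> nat \<Rightarrow> real) \<Rightarrow> real" where
  "coherence d r u = real d / real r * Max ((\<lambda>i. \<Sum>k<r. (u k i)\<^sup>2) ` {..<d})"

definition mat_agree_on :: "(nat \<times> nat) set \<Rightarrow> (nat \<Rightarrow> nat \<Rightarrow> real) \<Rightarrow> (nat \<Rightarrow> nat \<Rightarrow> real) \<Rightarrow> bool" where
  "mat_agree_on \<Omega> X Y \<longleftrightarrow> (\<forall>(i,j)\<in>\<Omega>. X i j = Y i j)"

definition unique_nuclear_minimizer ::
  "nat \<Rightarrow> nat \<Rightarrow> (nat \<times> nat) set \<Rightarrow> (nat \<Rightarrow> nat \<Rightarrow> real) \<Rightarrow> bool" where
  "unique_nuclear_minimizer n1 n2 \<Omega> M \<longleftrightarrow>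
     (\<forall>X. mat_agree_on \<Omega> X M \<longrightarrow>
        (\<forall>i<n1. \<forall>j<n2. X i j = M i j) \<or> nuclear_norm n1 n2 X > nuclear_norm n1 n2 M)"

definition samples :: "nat \<Rightarrow> nat \<Rightarrow> nat \<Rightarrow> (nat \<times> nat) set set" where
  "samples n1 n2 m = {\<Omega>. \<Omega> \<subseteq> {..<n1} \<times> {..<n2} \<and> card \<Omega> = m}"

definition recovery_prob :: "nat \<Rightarrow> nat \<Rightarrow> nat \<Rightarrow> (nat \<Rightarrow> nat \<Rightarrow> real) \<Rightarrow> real" where
  "recovery_prob n1 n2 m M =
     real (card {\<Omega>\<in>samples n1 n2 m. unique_nuclear_minimizer n1 n2 \<Omega> M})
     / real (card (samples n1 n2 m))"

end

(*
  Recovery from a set of samples is implied by recovery from any of its subsets. It is therefore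
  enough that about nu n^(6/5) samples (nu = mu0 r) drawn independently with replacement succeed with
  some absolute probability theta > 0: the m samples contain of the order of beta log n / theta
  independent batches of this size, and all of them fail with probability O(n^-beta).  A uniformly
  random m-subset does at least as well as m independent draws.  The factor n^(1/5) between the batch
  size and the natural scale nu n leaves so much room that moments of fixed order replace exponential
  matrix concentration.

  One batch succeeds by a golfing argument.  Let T be the tangent space at M, P its orthogonal projection
  and R the rescaled sampling operator of a group of samples.  Each application of the operator P - P R P with
  fresh samples shrinks a fixed matrix in mean square by the factor 2 n nu / N, hence a product of ten of them is a
  contraction in Hilbert-Schmidt norm; this gives injectivity on T.  Starting from the sign matrix U V^T, further steps
  W -> W - P R W shrink all rows, columns and entries of W by a factor n^(-1/20) / 4, while R W - W has
  small spectral norm, so that the sum of the matrices R W is an approximate dual certificate.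

  The spectral norm is controlled through the trace of a power 2p of a symmetric random matrix
  X = sum_i (G_i - E G).  Replacing one summand by an independent copy turns
  E tr X^(2p) into E tr (X - X') (X^(2p-1) - X'^(2p-1)), and log-convexity of
  tr (H X^k H X'^(2s-k)) in k bounds this by second moments of the summands.
*)

theory Submission
  imports Defs "HOL-Analysis.Analysis"
begin

text \<open>For a group of N samples only the ratio \<epsilon> = n \<nu> / N matters. It is of order
  n^(-1/5), and every exponent is chosen against it. One golfing step has to meet O(n^2) bounds at
  once: all rows, columns and entries of the new residual, and one trace. Markov's inequality at
  order p lets this fail with probability about n^2 (\<epsilon> / \<delta>^2)^p. With a shrinking
  factor \<delta> of order n^(-1/20) this is n^2 n^(-p/10), so p = 20 suffices, and success with
  probability 1/2 is all that is asked of a step. The contraction needs \<epsilon>^L to beat the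
  dimension n^2, hence ten groups. Injectivity on T then follows deterministically, but at the cost
  of a factor of order n^20. The golfing residual starts with norm at most sqrt \<nu> \<le> n and
  gains n^(1/20) per step, hence 420 steps and a success probability of at least 2^(-421) for a
  batch. Rows, columns and entries are carried along together because the row and column norms of a
  residual supply the variances of the next sum, and its entries the size of the largest
  summand.\<close>

section \<open>Averages over independent uniform samples\<close>

text \<open>Expectation over n independent uniform draws from \<open>I\<close>, with the sample as a
  list: fresh groups of samples are consecutive segments, and their independence is the Fubini
  identity \<open>iid_avg_append\<close>.\<close>

primrec iid_avg :: "'a set \<Rightarrow> nat \<Rightarrow> ('a list \<Rightarrow> real) \<Rightarrow> real" where
  "iid_avg I 0 F = F []"
| "iid_avg I (Suc n) F = (\<Sum>x\<in>I. iid_avg I n (\<lambda>xs. F (x # xs))) / real (card I)"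

lemma iid_avg_mono:
  assumes "\<And>xs. set xs \<subseteq> I \<Longrightarrow> length xs = n \<Longrightarrow> F xs \<le> G xs"
  shows "iid_avg I n F \<le> iid_avg I n G"
  using assms
proof (induction n arbitrary: F G)
  case (Suc n)
  have "iid_avg I n (\<lambda>xs. F (x # xs)) \<le> iid_avg I n (\<lambda>xs. G (x # xs))" if "x \<in> I" for x
    by (rule Suc.IH) (use Suc.prems that in auto)
  then show ?case by (auto intro!: divide_right_mono sum_mono)
qed auto

lemma iid_avg_cong:
  assumes "\<And>xs. set xs \<subseteq> I \<Longrightarrow> length xs = n \<Longrightarrow> F xs = G xs"
  shows "iid_avg I n F = iid_avg I n G"
  by (rule antisym; rule iid_avg_mono) (use assms in auto)

lemma iid_avg_add: "iid_avg I n (\<lambda>xs. F xs + G xs) = iid_avg I n F + iid_avg I n G"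
  by (induction n arbitrary: F G) (auto simp: sum.distrib add_divide_distrib)

lemma iid_avg_cmult: "iid_avg I n (\<lambda>xs. c * F xs) = c * iid_avg I n F"
  by (induction n arbitrary: F) (auto simp: sum_distrib_left[symmetric])

lemma iid_avg_divide: "iid_avg I n (\<lambda>xs. F xs / c) = iid_avg I n F / c"
  using iid_avg_cmult[of I n "1/c" F] by simp

lemma iid_avg_const:
  assumes "finite I" "I \<noteq> {}"
  shows "iid_avg I n (\<lambda>xs. c) = c"
  by (induction n) (use assms in auto)

lemma iid_avg_sum: "iid_avg I n (\<lambda>xs. \<Sum>a\<in>A. F a xs) = (\<Sum>a\<in>A. iid_avg I n (F a))"
proof -
  have zero: "iid_avg I n (\<lambda>xs. 0) = 0"
    using iid_avg_cmult[of I n 0] by simp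
  show ?thesis
    by (induction A rule: infinite_finite_induct) (auto simp: zero iid_avg_add)
qed

lemma iid_avg_append:
  "iid_avg I (n + k) F = iid_avg I n (\<lambda>xs. iid_avg I k (\<lambda>ys. F (xs @ ys)))"
  by (induction n arbitrary: F) auto

lemma iid_avg_nonneg:
  assumes "\<And>xs. set xs \<subseteq> I \<Longrightarrow> length xs = n \<Longrightarrow> 0 \<le> F xs"
  shows "0 \<le> iid_avg I n F"
proof -
  have "iid_avg I n (\<lambda>xs. 0) \<le> iid_avg I n F"
    by (rule iid_avg_mono) (use assms in auto)
  then show ?thesis using iid_avg_cmult[of I n 0] by simp
qed

text \<open>Resampling one draw makes (\<open>xs\<close>, \<open>xs[i:=y]\<close>) an exchangeable
  pair: for the first position the two sums over that draw are interchanged, and later positions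
  follow by induction.\<close>

lemma iid_avg_swap:
  assumes "i < n"
  shows "iid_avg I n (\<lambda>xs. \<Sum>y\<in>I. F xs (xs[i:=y])) = iid_avg I n (\<lambda>xs. \<Sum>y\<in>I. F (xs[i:=y]) xs)"
  using assms
proof (induction n arbitrary: i F)
  case (Suc n)
  show ?case
  proof (cases i)
    case 0
    have "(\<Sum>x\<in>I. iid_avg I n (\<lambda>xs. \<Sum>y\<in>I. F (x # xs) (y # xs)))
        = (\<Sum>x\<in>I. iid_avg I n (\<lambda>xs. \<Sum>y\<in>I. F (y # xs) (x # xs)))"
      unfolding iid_avg_sum by (rule sum.swap)
    then show ?thesis using 0 by simp
  next
    case (Suc j)
    have "iid_avg I n (\<lambda>xs. \<Sum>y\<in>I. F (x # xs) (x # xs[j:=y]))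
        = iid_avg I n (\<lambda>xs. \<Sum>y\<in>I. F (x # xs[j:=y]) (x # xs))" for x
      using Suc.IH[of j "\<lambda>a b. F (x # a) (x # b)"] Suc Suc.prems by simp
    then show ?thesis using Suc by simp
  qed
qed auto

text \<open>Markov's inequality in the form used for all events: \<open>F\<close> is a nonnegative
  test quantity, and \<open>F xs < 1\<close> forces the event.\<close>

lemma iid_avg_markov:
  assumes I: "finite I" "I \<noteq> {}"
    and F: "\<And>xs. set xs \<subseteq> I \<Longrightarrow> length xs = n \<Longrightarrow> 0 \<le> F xs"
    and E: "\<And>xs. set xs \<subseteq> I \<Longrightarrow> length xs = n \<Longrightarrow> F xs < 1 \<Longrightarrow> E xs"
    and le: "iid_avg I n F \<le> q"
  shows "iid_avg I n (\<lambda>xs. of_bool (E xs)) \<ge> 1 - q"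
proof -
  have "iid_avg I n (\<lambda>xs. 1 + (-1) * F xs) \<le> iid_avg I n (\<lambda>xs. of_bool (E xs))"
  proof (rule iid_avg_mono)
    fix xs assume xs: "set xs \<subseteq> I" "length xs = n"
    show "1 + (-1) * F xs \<le> of_bool (E xs)"
      using F[OF xs] E[OF xs] by (cases "E xs") force+
  qed
  then show ?thesis
    using le unfolding iid_avg_add iid_avg_cmult iid_avg_const[OF I] by linarith
qed

text \<open>A moment bound of Rosenthal type for nonnegative summands. Keeping the base A at least
  \<open>p * B\<close> makes a new summand x at most a p-th of it, so that (A + x)^p exceeds A^p by
  at most e p x A^(p-1). This is linear in x and can be averaged.\<close>

lemma iid_moment_scalar:
  fixes w :: "'a \<Rightarrow> real"
  assumes I: "finite I" "I \<noteq> {}"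
    and w: "\<And>x. x \<in> I \<Longrightarrow> 0 \<le> w x" "\<And>x. x \<in> I \<Longrightarrow> w x \<le> B"
    and mean: "(\<Sum>x\<in>I. w x) / real (card I) \<le> mb"
    and c: "c \<ge> 0" and p: "p \<ge> 1"
  shows "iid_avg I N (\<lambda>xs. (c + sum_list (map w xs)) ^ p) \<le> (c + 3 * real N * mb + real p * B) ^ p"
proof -
  obtain x0 where "x0 \<in> I" using I by auto
  then have B: "B \<ge> 0" using w[of x0] by linarith
  have mb: "mb \<ge> 0" using mean sum_nonneg[of I w] w by (smt (verit) divide_nonneg_nonneg of_nat_0_le_iff)
  have one: "(A + x) ^ p \<le> A ^ p + x * (3 * real p * A ^ (p - 1))"
    if A: "A \<ge> real p * B" and x: "0 \<le> x" "x \<le> B" for A x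
  proof -
    have A0: "A \<ge> 0" using A B by (meson mult_nonneg_nonneg of_nat_0_le_iff order_trans)
    obtain q where q: "p = Suc q" using p by (cases p) auto
    have "(A + x) ^ Suc q - A ^ Suc q = x * (\<Sum>k<Suc q. A ^ (q - k) * (A + x) ^ k)"
      using power_diff_sumr2[of "A + x" "Suc q" A] by (simp add: mult.commute)
    moreover have "(\<Sum>k<Suc q. A ^ (q - k) * (A + x) ^ k) \<le> (\<Sum>k<Suc q. (A + x) ^ q)"
    proof (rule sum_mono)
      fix k assume "k \<in> {..<Suc q}"
      then have "A ^ (q - k) * (A + x) ^ k \<le> (A + x) ^ (q - k) * (A + x) ^ k"
        using A0 x by (intro mult_right_mono power_mono) auto
      also have "\<dots> = (A + x) ^ q" using \<open>k \<in> _\<close> by (simp flip: power_add)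
      finally show "A ^ (q - k) * (A + x) ^ k \<le> (A + x) ^ q" .
    qed
    moreover have "(A + x) ^ q \<le> 3 * A ^ q"
    proof -
      have "real p * x \<le> real p * B" using x p by (intro mult_left_mono) auto
      then have "real p * x \<le> A" using A by linarith
      then have "x \<le> A / real p" using p by (simp add: field_simps)
      then have "A + x \<le> A * (1 + 1 / real p)" by (simp add: field_simps)
      then have "(A + x) ^ q \<le> A ^ q * (1 + 1 / real p) ^ q"
        using A0 x by (subst power_mult_distrib[symmetric]) (intro power_mono, auto)
      moreover have "(1 + 1 / real p) ^ q \<le> (1 + 1 / real p) ^ p"
        by (rule power_increasing) (auto simp: q)
      \<comment> \<open>The bound e \<le> 3 is the origin of the constant 3.\<close>
      moreover have "(1 + 1 / real p) ^ p \<le> 3"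
        using exp_ge_one_plus_x_over_n_power_n[of p 1] p exp_le by auto
      ultimately show ?thesis using A0 mult_left_mono[of "(1 + 1 / real p) ^ q" 3 "A ^ q"] by simp
    qed
    ultimately have "(A + x) ^ Suc q - A ^ Suc q \<le> x * (\<Sum>k<Suc q. 3 * A ^ q)"
      using x by (smt (verit, best) mult_left_mono sum_mono)
    then show ?thesis by (simp add: q algebra_simps)
  qed
  show ?thesis using c
  \<comment> \<open>\<open>c\<close> is generalised because the first draw is absorbed into
    it.\<close>
  proof (induction N arbitrary: c)
    case 0
    then show ?case using B by (auto intro!: power_mono)
  next
    case (Suc N)
    let ?A = "c + 3 * real N * mb + real p * B"
    have A0: "?A \<ge> 0" using Suc.prems mb B by simp
    have "iid_avg I (Suc N) (\<lambda>xs. (c + sum_list (map w xs)) ^ p)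
       = (\<Sum>x\<in>I. iid_avg I N (\<lambda>xs. ((c + w x) + sum_list (map w xs)) ^ p)) / real (card I)"
      by (simp add: add.assoc)
    also have "\<dots> \<le> (\<Sum>x\<in>I. (?A + w x) ^ p) / real (card I)"
    proof (intro divide_right_mono sum_mono)
      fix x assume "x \<in> I"
      then show "iid_avg I N (\<lambda>xs. ((c + w x) + sum_list (map w xs)) ^ p) \<le> (?A + w x) ^ p"
        using Suc.IH[of "c + w x"] w(1)[of x] Suc.prems by (simp add: algebra_simps)
    qed auto
    also have "\<dots> \<le> (\<Sum>x\<in>I. ?A ^ p + w x * (3 * real p * ?A ^ (p - 1))) / real (card I)"
      by (intro divide_right_mono sum_mono one) (use w Suc.prems mb in auto)
    also have "\<dots> = ?A ^ p + ((\<Sum>x\<in>I. w x) / real (card I)) * (3 * real p * ?A ^ (p - 1))"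
      using I by (simp add: sum.distrib sum_distrib_right[symmetric] add_divide_distrib)
    also have "\<dots> \<le> ?A ^ p + mb * (3 * real p * ?A ^ (p - 1))"
      by (intro add_left_mono mult_right_mono mean) (use A0 in auto)
    \<comment> \<open>Bernoulli's inequality turns the linear term back into a p-th power: each draw
      enlarges the base by \<open>3 * mb\<close>.\<close>
    also have "\<dots> \<le> (?A + 3 * mb) ^ p"
    proof (cases p)
      case (Suc q)
      have "(?A + 3 * mb) ^ Suc q - ?A ^ Suc q = 3 * mb * (\<Sum>k<Suc q. ?A ^ (q - k) * (?A + 3 * mb) ^ k)"
        using power_diff_sumr2[of "?A + 3 * mb" "Suc q" ?A] by (simp add: mult.commute)
      moreover have "(\<Sum>k<Suc q. ?A ^ q) \<le> (\<Sum>k<Suc q. ?A ^ (q - k) * (?A + 3 * mb) ^ k)"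
      proof (rule sum_mono)
        fix k assume "k \<in> {..<Suc q}"
        then have "?A ^ q = ?A ^ (q - k) * ?A ^ k" by (simp flip: power_add)
        also have "\<dots> \<le> ?A ^ (q - k) * (?A + 3 * mb) ^ k"
          using A0 mb by (intro mult_left_mono power_mono) auto
        finally show "?A ^ q \<le> ?A ^ (q - k) * (?A + 3 * mb) ^ k" .
      qed
      ultimately have "3 * mb * (\<Sum>k<Suc q. ?A ^ q) \<le> (?A + 3 * mb) ^ Suc q - ?A ^ Suc q"
        using mb by (simp add: mult_left_mono)
      then show ?thesis using Suc by (simp add: algebra_simps)
    qed (use p in auto)
    also have "?A + 3 * mb = c + 3 * real (Suc N) * mb + real p * B" by (simp add: algebra_simps)
    finally show ?case .
  qed
qed

section \<open>Moments of sums of independent random matrices\<close>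

definition mmul :: "'d set \<Rightarrow> ('d \<Rightarrow> 'd \<Rightarrow> real) \<Rightarrow> ('d \<Rightarrow> 'd \<Rightarrow> real) \<Rightarrow> 'd \<Rightarrow> 'd \<Rightarrow> real" where
  "mmul D A B = (\<lambda>i j. \<Sum>k\<in>D. A i k * B k j)"

definition mip :: "'d set \<Rightarrow> ('d \<Rightarrow> 'd \<Rightarrow> real) \<Rightarrow> ('d \<Rightarrow> 'd \<Rightarrow> real) \<Rightarrow> real" where
  "mip D A B = (\<Sum>i\<in>D. \<Sum>j\<in>D. A i j * B i j)"

definition mid :: "'d \<Rightarrow> 'd \<Rightarrow> real" where
  "mid i j = of_bool (i = j)"

text \<open>\<open>lpow D X k A\<close> is X^k A, and \<open>rpow D X k A\<close> below is A X^k.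
  Iterated multiplication does without an identity matrix, since \<open>mid\<close> acts as one only
  at indices from \<open>D\<close>.\<close>

abbreviation lpow :: "'d set \<Rightarrow> ('d \<Rightarrow> 'd \<Rightarrow> real) \<Rightarrow> nat \<Rightarrow> ('d \<Rightarrow> 'd \<Rightarrow> real) \<Rightarrow> 'd \<Rightarrow> 'd \<Rightarrow> real" where
  "lpow D X k \<equiv> (mmul D X ^^ k)"

definition rmul :: "'d set \<Rightarrow> ('d \<Rightarrow> 'd \<Rightarrow> real) \<Rightarrow> ('d \<Rightarrow> 'd \<Rightarrow> real) \<Rightarrow> 'd \<Rightarrow> 'd \<Rightarrow> real" where
  "rmul D X A = mmul D A X"

abbreviation rpow :: "'d set \<Rightarrow> ('d \<Rightarrow> 'd \<Rightarrow> real) \<Rightarrow> nat \<Rightarrow> ('d \<Rightarrow> 'd \<Rightarrow> real) \<Rightarrow> 'd \<Rightarrow> 'd \<Rightarrow> real" where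
  "rpow D X k \<equiv> (rmul D X ^^ k)"

definition msym :: "('d \<Rightarrow> 'd \<Rightarrow> real) \<Rightarrow> bool" where
  "msym X \<longleftrightarrow> (\<forall>i j. X i j = X j i)"

lemma mmul_assoc: "mmul D (mmul D A B) C = mmul D A (mmul D B C)"
  unfolding mmul_def
  by (intro ext, simp add: sum_distrib_left sum_distrib_right, subst sum.swap, simp add: mult.assoc)

lemma mmul_diff_left: "mmul D (\<lambda>i j. A i j - B i j) C = (\<lambda>i j. mmul D A C i j - mmul D B C i j)"
  by (simp add: mmul_def left_diff_distrib sum_subtractf)

lemma mmul_diff_right: "mmul D C (\<lambda>i j. A i j - B i j) = (\<lambda>i j. mmul D C A i j - mmul D C B i j)"
  by (simp add: mmul_def right_diff_distrib sum_subtractf)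

lemma lpow_rpow_commute: "lpow D X k (mmul D A Y) = mmul D (lpow D X k A) Y"
  by (induction k) (auto simp: mmul_assoc)

lemma mip_diff_left: "mip D (\<lambda>i j. A i j - B i j) C = mip D A C - mip D B C"
  by (simp add: mip_def left_diff_distrib sum_subtractf)

lemma mip_diff_right: "mip D C (\<lambda>i j. A i j - B i j) = mip D C A - mip D C B"
  by (simp add: mip_def right_diff_distrib sum_subtractf)

lemma mip_cong:
  assumes "\<And>i j. i \<in> D \<Longrightarrow> j \<in> D \<Longrightarrow> A i j = A' i j" "\<And>i j. i \<in> D \<Longrightarrow> j \<in> D \<Longrightarrow> B i j = B' i j"
  shows "mip D A B = mip D A' B'"
  using assms by (simp add: mip_def)

lemma mip_nonneg: "0 \<le> mip D A A"
  by (simp add: mip_def sum_nonneg)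

lemma mip_Cauchy_Schwarz: "(mip D A B)\<^sup>2 \<le> mip D A A * mip D B B"
  using Cauchy_Schwarz_ineq_sum[of "\<lambda>(i,j). A i j" "\<lambda>(i,j). B i j" "D \<times> D"]
  by (simp add: mip_def sum.cartesian_product case_prod_beta power2_eq_square)

lemma mip_left:
  assumes "msym X"
  shows "mip D (mmul D X A) B = mip D A (mmul D X B)"
proof -
  have "mip D (mmul D X A) B = (\<Sum>i\<in>D. \<Sum>k\<in>D. \<Sum>j\<in>D. X i k * A k j * B i j)"
    unfolding mip_def mmul_def sum_distrib_right by (intro sum.cong refl sum.swap)
  also have "\<dots> = (\<Sum>k\<in>D. \<Sum>i\<in>D. \<Sum>j\<in>D. X i k * A k j * B i j)" by (rule sum.swap)
  also have "\<dots> = (\<Sum>k\<in>D. \<Sum>j\<in>D. \<Sum>i\<in>D. X i k * A k j * B i j)" by (intro sum.cong refl sum.swap)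
  also have "\<dots> = mip D A (mmul D X B)"
    using assms unfolding mip_def mmul_def sum_distrib_left msym_def
    by (intro sum.cong refl) (simp add: mult_ac)
  finally show ?thesis .
qed

lemma mip_right:
  assumes "msym X"
  shows "mip D (mmul D A X) B = mip D A (mmul D B X)"
proof -
  have "mip D (mmul D A X) B = (\<Sum>i\<in>D. \<Sum>k\<in>D. \<Sum>j\<in>D. A i k * X k j * B i j)"
    unfolding mip_def mmul_def sum_distrib_right by (intro sum.cong refl sum.swap)
  also have "\<dots> = mip D A (mmul D B X)"
    using assms unfolding mip_def mmul_def sum_distrib_left msym_def
    by (intro sum.cong refl) (simp add: mult_ac)
  finally show ?thesis .
qed

lemma mip_lpow: "msym X \<Longrightarrow> mip D (lpow D X k A) B = mip D A (lpow D X k B)"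
  by (induction k arbitrary: B) (simp, simp add: mip_left, simp add: funpow_swap1)

lemma mip_rpow: "msym X \<Longrightarrow> mip D (rpow D X k A) B = mip D A (rpow D X k B)"
  by (induction k arbitrary: B) (simp, simp add: mip_right rmul_def, simp add: funpow_swap1 flip: rmul_def)

text \<open>Symmetric factors move across the inner product, so only the total exponents on the left
  and on the right of \<open>H\<close> matter.\<close>

lemma mip_lrpow:
  assumes "msym X" "msym Y"
  shows "mip D (lpow D X i (rpow D Y j H)) (lpow D X i' (rpow D Y j' H))
    = mip D H (lpow D X (i + i') (rpow D Y (j + j') H))"
proof -
  have comm: "lpow D X k (rpow D Y l A) = rpow D Y l (lpow D X k A)" for k l A
    by (induction l) (simp_all add: lpow_rpow_commute rmul_def)
  show ?thesis
    using assms by (simp add: mip_lpow mip_rpow comm funpow_add)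
qed

text \<open>The least index attaining the maximum cannot be interior, because its left neighbour
  would be strictly smaller.\<close>

lemma midpoint_convex_le_ends:
  fixes g :: "nat \<Rightarrow> real"
  assumes "\<And>i. Suc i < s \<Longrightarrow> 2 * g (Suc i) \<le> g i + g (Suc (Suc i))" "i \<le> s"
  shows "g i \<le> max (g 0) (g s)"
proof -
  define m where "m = Max (g ` {..s})"
  have le: "g j \<le> m" if "j \<le> s" for j using that by (auto simp: m_def)
  have "m \<in> g ` {..s}" unfolding m_def by (rule Max_in) auto
  then have ex: "\<exists>j. j \<le> s \<and> g j = m" by auto
  define k where "k = (LEAST j. j \<le> s \<and> g j = m)"
  have k: "k \<le> s" "g k = m" using LeastI_ex[OF ex] by (auto simp: k_def)
  have "k = 0 \<or> k = s"
  proof (rule ccontr)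
    assume "\<not> (k = 0 \<or> k = s)"
    then obtain l where l: "k = Suc l" "Suc l < s" using k by (cases k) auto
    have "\<not> (l \<le> s \<and> g l = m)" using not_less_Least[of l "\<lambda>j. j \<le> s \<and> g j = m"] l by (simp add: k_def)
    then have "g l < m" using le[of l] l by auto
    moreover have "g (Suc (Suc l)) \<le> m" using l by (intro le) auto
    ultimately show False using assms(1)[of l] k l by auto
  qed
  then show ?thesis using le[OF assms(2)] k by auto
qed

text \<open>Let g i be the squared norm of X^i H Y^(s-i). Cauchy-Schwarz gives 2 <H, X^(i+j) H
  Y^(2s-i-j)> \<le> g i + g j. The case j = i + 2 says that g is midpoint convex, hence bounded by
  its end values g 0 and g s, whose sum is the right side.\<close>

lemma mip_sandwich_le:
  assumes "msym X" "msym Y" "k \<le> 2 * s"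
  shows "mip D H (lpow D X k (rpow D Y (2 * s - k) H))
    \<le> mip D (lpow D X s H) (lpow D X s H) + mip D (rpow D Y s H) (rpow D Y s H)"
proof -
  define g where "g i = mip D (lpow D X i (rpow D Y (s - i) H)) (lpow D X i (rpow D Y (s - i) H))" for i
  have nonneg: "g i \<ge> 0" for i by (simp add: g_def mip_nonneg)
  have cs: "2 * mip D H (lpow D X (i + j) (rpow D Y (2 * s - (i + j)) H)) \<le> g i + g j" if "i \<le> s" "j \<le> s" for i j
  proof -
    let ?z = "mip D H (lpow D X (i + j) (rpow D Y (2 * s - (i + j)) H))"
    have e: "s - i + (s - j) = 2 * s - (i + j)" using that by auto
    have "?z = mip D (lpow D X i (rpow D Y (s - i) H)) (lpow D X j (rpow D Y (s - j) H))"
      by (simp only: mip_lrpow[OF assms(1,2)] e)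
    then have "?z\<^sup>2 \<le> g i * g j" using mip_Cauchy_Schwarz by (simp add: g_def)
    moreover have "4 * (g i * g j) \<le> (g i + g j)\<^sup>2"
      using zero_le_power2[of "g i - g j"] by (simp add: power2_eq_square algebra_simps)
    ultimately have "(2 * ?z)\<^sup>2 \<le> (g i + g j)\<^sup>2" by (simp add: power_mult_distrib)
    then show ?thesis
      by (rule power2_le_imp_le) (use nonneg[of i] nonneg[of j] in linarith)
  qed
  have diag: "mip D H (lpow D X (2 * i) (rpow D Y (2 * s - 2 * i) H)) = g i" if "i \<le> s" for i
  proof -
    have e: "s - i + (s - i) = 2 * s - 2 * i" "i + i = 2 * i" using that by auto
    show ?thesis by (simp only: g_def mip_lrpow[OF assms(1,2)] e)
  qed
  have "2 * g (Suc i) \<le> g i + g (Suc (Suc i))" if "Suc i < s" for i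
  proof -
    have e: "i + Suc (Suc i) = 2 * Suc i" by simp
    show ?thesis using cs[of i "Suc (Suc i)", unfolded e] diag[of "Suc i"] that by linarith
  qed
  then have "g i \<le> max (g 0) (g s)" if "i \<le> s" for i
    using that by (rule midpoint_convex_le_ends)
  then have *: "g i \<le> g 0 + g s" if "i \<le> s" for i
    using that nonneg[of 0] nonneg[of s] by (smt (verit))
  define i where "i = k div 2"
  define j where "j = k - i"
  have ij: "i \<le> s" "j \<le> s" "i + j = k" using assms by (auto simp: i_def j_def)
  have "mip D H (lpow D X k (rpow D Y (2 * s - k) H)) \<le> g 0 + g s"
    using cs[OF ij(1,2), unfolded ij(3)] *[OF ij(1)] *[OF ij(2)] by linarith
  then show ?thesis by (simp add: g_def)
qed

lemma lpow_cong:
  assumes "\<And>i j. i \<in> D \<Longrightarrow> j \<in> D \<Longrightarrow> A i j = B i j" "i \<in> D" "j \<in> D"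
  shows "lpow D X k A i j = lpow D X k B i j"
  using assms(2,3)
proof (induction k arbitrary: i j)
  case (Suc k)
  then show ?case by (auto simp: mmul_def intro!: sum.cong)
qed (use assms in auto)

lemma mmul_mid_right:
  assumes "finite D" "j \<in> D"
  shows "mmul D A mid i j = A i j"
proof -
  have "mmul D A mid i j = (\<Sum>k\<in>D. if k = j then A i k else 0)"
    unfolding mmul_def mid_def by (intro sum.cong) auto
  then show ?thesis using assms by simp
qed

lemma mmul_mid_left:
  assumes "finite D" "i \<in> D"
  shows "mmul D mid A i j = A i j"
proof -
  have "mmul D mid A i j = (\<Sum>k\<in>D. if i = k then A k j else 0)"
    unfolding mmul_def mid_def by (intro sum.cong) auto
  then show ?thesis using assms by simp
qed

lemma lpow_mid_mmul:
  assumes "finite D" "i \<in> D"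
  shows "mmul D (lpow D X k mid) H i j = lpow D X k H i j"
  using assms(2)
proof (induction k arbitrary: i)
  case 0
  then show ?case using assms by (simp add: mmul_mid_left)
next
  case (Suc k)
  have "mmul D (lpow D X (Suc k) mid) H i j = mmul D X (mmul D (lpow D X k mid) H) i j"
    by (simp add: mmul_assoc)
  also have "\<dots> = (\<Sum>l\<in>D. X i l * mmul D (lpow D X k mid) H l j)" by (simp add: mmul_def)
  also have "\<dots> = (\<Sum>l\<in>D. X i l * lpow D X k H l j)" using Suc by (intro sum.cong) auto
  finally show ?case by (simp add: mmul_def[of D X "lpow D X k H"])
qed

lemma mmul_lpow_mid:
  assumes "finite D" "j \<in> D"
  shows "mmul D H (lpow D X k mid) i j = rpow D X k H i j"
  using assms(2)
proof (induction k arbitrary: H)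
  case 0
  then show ?case using assms by (simp add: mmul_mid_right)
next
  case (Suc k)
  have "mmul D H (lpow D X (Suc k) mid) i j = mmul D (mmul D H X) (lpow D X k mid) i j"
    by (simp add: mmul_assoc)
  also have "\<dots> = rpow D X k (mmul D H X) i j" using Suc by blast
  also have "\<dots> = rpow D X (Suc k) H i j" by (simp add: funpow_swap1 flip: rmul_def)
  finally show ?case .
qed

lemma lpow_transpose:
  assumes "msym X"
  shows "rpow D X k A i j = lpow D X k (\<lambda>i j. A j i) j i"
proof (induction k arbitrary: i j)
  case (Suc k)
  then show ?case using assms by (auto simp: rmul_def mmul_def msym_def mult.commute intro!: sum.cong)
qed auto

lemma mip_rpow_eq_lpow:
  assumes "msym X" "msym H"
  shows "mip D (rpow D X k H) (rpow D X k H) = mip D (lpow D X k H) (lpow D X k H)"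
proof -
  have "(\<lambda>i j. H j i) = H" using assms by (auto simp: msym_def)
  then show ?thesis
    unfolding mip_def lpow_transpose[OF assms(1)] by (subst sum.swap) simp
qed

lemma lpow_diff:
  "lpow D X (Suc n) A i j - lpow D Y (Suc n) A i j
    = (\<Sum>k\<le>n. lpow D X k (mmul D (\<lambda>i j. X i j - Y i j) (lpow D Y (n - k) A)) i j)"
proof (induction n arbitrary: i j)
  case 0
  then show ?case by (simp add: mmul_diff_left)
next
  case (Suc n)
  have "lpow D X (Suc (Suc n)) A i j - lpow D Y (Suc (Suc n)) A i j
     = mmul D X (\<lambda>i j. lpow D X (Suc n) A i j - lpow D Y (Suc n) A i j) i j
       + mmul D (\<lambda>i j. X i j - Y i j) (lpow D Y (Suc n) A) i j"
    by (simp add: mmul_diff_left mmul_diff_right)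
  also have "mmul D X (\<lambda>i j. lpow D X (Suc n) A i j - lpow D Y (Suc n) A i j) i j
     = mmul D X (\<lambda>i j. \<Sum>k\<le>n. lpow D X k (mmul D (\<lambda>i j. X i j - Y i j) (lpow D Y (n - k) A)) i j) i j"
    by (subst Suc) (rule refl)
  also have "\<dots> = (\<Sum>k\<le>n. lpow D X (Suc k) (mmul D (\<lambda>i j. X i j - Y i j) (lpow D Y (n - k) A)) i j)"
    unfolding mmul_def funpow.simps comp_def sum_distrib_left by (rule sum.swap)
  finally show ?case unfolding sum.atMost_Suc_shift by simp
qed

text \<open>The difference of powers telescopes into 2s + 1 terms X^k H Y^(2s-k), to each of which
  \<open>mip_sandwich_le\<close> applies.\<close>

lemma mip_power_diff_le:
  assumes D: "finite D" and X: "msym X" and Y: "msym Y"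
  defines "H \<equiv> (\<lambda>i j. X i j - Y i j)"
  shows "mip D H (lpow D X (2 * s + 1) mid) - mip D H (lpow D Y (2 * s + 1) mid)
    \<le> real (2 * s + 1) * (mip D (lpow D X s H) (lpow D X s H) + mip D (lpow D Y s H) (lpow D Y s H))"
proof -
  have symH: "msym H" using X Y by (simp add: H_def msym_def)
  have "mip D H (lpow D X (2 * s + 1) mid) - mip D H (lpow D Y (2 * s + 1) mid)
     = mip D H (\<lambda>i j. \<Sum>k\<le>2 * s. lpow D X k (mmul D H (lpow D Y (2 * s - k) mid)) i j)"
    unfolding mip_diff_right[symmetric] H_def Suc_eq_plus1[symmetric] by (subst lpow_diff) (rule refl)
  also have "\<dots> = (\<Sum>k\<le>2 * s. mip D H (lpow D X k (mmul D H (lpow D Y (2 * s - k) mid))))"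
  proof -
    have "mip D H (\<lambda>i j. \<Sum>k\<le>t. F k i j) = (\<Sum>k\<le>t. mip D H (F k))" for F and t :: nat
    proof -
      have "mip D H (\<lambda>i j. \<Sum>k\<le>t. F k i j) = (\<Sum>i\<in>D. \<Sum>k\<le>t. \<Sum>j\<in>D. H i j * F k i j)"
        unfolding mip_def sum_distrib_left by (intro sum.cong refl sum.swap)
      also have "\<dots> = (\<Sum>k\<le>t. mip D H (F k))" unfolding mip_def by (rule sum.swap)
      finally show ?thesis .
    qed
    then show ?thesis .
  qed
  also have "\<dots> = (\<Sum>k\<le>2 * s. mip D H (lpow D X k (rpow D Y (2 * s - k) H)))"
  proof (rule sum.cong[OF refl], rule mip_cong[OF refl])
    fix k i j assume "i \<in> D" "j \<in> D"
    then show "lpow D X k (mmul D H (lpow D Y (2 * s - k) mid)) i j = lpow D X k (rpow D Y (2 * s - k) H) i j"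
      by (rule lpow_cong[rotated]) (rule mmul_lpow_mid[OF D])
  qed
  also have "\<dots> \<le> (\<Sum>k\<le>2 * s. mip D (lpow D X s H) (lpow D X s H) + mip D (rpow D Y s H) (rpow D Y s H))"
    by (intro sum_mono mip_sandwich_le X Y) auto
  finally show ?thesis using mip_rpow_eq_lpow[OF Y symH] by (simp add: algebra_simps)
qed

section \<open>Log-convexity of the norms of X^k v\<close>

definition mv :: "'d set \<Rightarrow> ('d \<Rightarrow> 'd \<Rightarrow> real) \<Rightarrow> ('d \<Rightarrow> real) \<Rightarrow> 'd \<Rightarrow> real" where
  "mv D X v = (\<lambda>i. \<Sum>j\<in>D. X i j * v j)"

text \<open>For symmetric \<open>X\<close> this is <v, X^(2k) v>, the moment of order 2k of the
  spectral measure of \<open>X\<close> at \<open>v\<close>; hence it is log-convex in k.\<close>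

definition vpow :: "'d set \<Rightarrow> ('d \<Rightarrow> 'd \<Rightarrow> real) \<Rightarrow> nat \<Rightarrow> ('d \<Rightarrow> real) \<Rightarrow> real" where
  "vpow D X k v = (\<Sum>b\<in>D. ((mv D X ^^ k) v b)\<^sup>2)"

lemma lpow_column: "lpow D X k A i j = (mv D X ^^ k) (\<lambda>i. A i j) i"
  by (induction k arbitrary: i) (auto simp: mmul_def mv_def)

lemma vpow_nonneg: "0 \<le> vpow D X k v"
  by (simp add: vpow_def sum_nonneg)

lemma mv_adjoint:
  assumes "msym X"
  shows "(\<Sum>b\<in>D. mv D X u b * v b) = (\<Sum>b\<in>D. u b * mv D X v b)"
proof -
  have "(\<Sum>b\<in>D. mv D X u b * v b) = (\<Sum>j\<in>D. \<Sum>b\<in>D. X b j * u j * v b)"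
    unfolding mv_def sum_distrib_right by (rule sum.swap)
  also have "\<dots> = (\<Sum>b\<in>D. u b * mv D X v b)"
    using assms unfolding mv_def sum_distrib_left msym_def by (intro sum.cong refl) (simp add: mult_ac)
  finally show ?thesis .
qed

lemma vpow_log_convex:
  assumes "msym X"
  shows "(vpow D X (Suc k) v)\<^sup>2 \<le> vpow D X k v * vpow D X (Suc (Suc k)) v"
proof -
  let ?u = "(mv D X ^^ k) v"
  have "vpow D X (Suc k) v = (\<Sum>b\<in>D. ?u b * mv D X (mv D X ?u) b)"
    using mv_adjoint[OF assms, of D ?u "mv D X ?u"] by (simp add: vpow_def power2_eq_square)
  then show ?thesis
    using Cauchy_Schwarz_ineq_sum[of ?u "mv D X (mv D X ?u)" D] by (simp add: vpow_def)
qed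

text \<open>log t is convex and vanishes at 0, so log (t k) / k is nondecreasing. The formulation
  with powers also covers zero values.\<close>

lemma log_convex_power_le:
  fixes t :: "nat \<Rightarrow> real"
  assumes nonneg: "\<And>k. t k \<ge> 0" and lc: "\<And>k. (t (Suc k))\<^sup>2 \<le> t k * t (Suc (Suc k))"
    and t0: "t 0 = 1"
  shows "t k ^ Suc k \<le> t (Suc k) ^ k"
proof (induction k)
  case 0
  then show ?case using t0 by simp
next
  case (Suc k)
  show ?case
  proof (cases "t (Suc k) = 0")
    case False
    then have pos: "t (Suc k) > 0" using nonneg[of "Suc k"] by simp
    have "t (Suc k) ^ k * t (Suc k) ^ Suc (Suc k) = ((t (Suc k))\<^sup>2) ^ Suc k"
      by (simp add: power_add[symmetric] power_mult[symmetric] mult_2 del: power_Suc)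
    also have "\<dots> \<le> (t k * t (Suc (Suc k))) ^ Suc k"
      by (intro power_mono lc) auto
    also have "\<dots> = t k ^ Suc k * t (Suc (Suc k)) ^ Suc k" by (rule power_mult_distrib)
    also have "\<dots> \<le> t (Suc k) ^ k * t (Suc (Suc k)) ^ Suc k"
      by (intro mult_right_mono Suc zero_le_power nonneg)
    finally show ?thesis using pos by (simp del: power_Suc)
  qed (use nonneg in auto)
qed

text \<open>Convexity of log t again, now against its slope at 0: each increment is at least the
  first one, that is t 1 * t k \<le> t (k + 1).\<close>

lemma log_convex_power_le':
  fixes t :: "nat \<Rightarrow> real"
  assumes nonneg: "\<And>k. t k \<ge> 0" and lc: "\<And>k. (t (Suc k))\<^sup>2 \<le> t k * t (Suc (Suc k))"
    and t0: "t 0 = 1"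
  shows "t 1 ^ k \<le> t k"
proof -
  have step: "t 1 * t k \<le> t (Suc k)" for k
  proof (induction k)
    case (Suc k)
    show ?case
    proof (cases "t k = 0")
      case True
      then show ?thesis using lc[of k] nonneg[of "Suc (Suc k)"] by simp
    next
      case False
      then have pos: "t k > 0" using nonneg[of k] by simp
      have "t k * (t 1 * t (Suc k)) \<le> (t (Suc k))\<^sup>2"
        using mult_right_mono[OF Suc nonneg[of "Suc k"]] by (simp add: power2_eq_square mult_ac)
      also have "\<dots> \<le> t k * t (Suc (Suc k))" by (rule lc)
      finally show ?thesis using pos by simp
    qed
  qed (use t0 in auto)
  show ?thesis
  proof (induction k)
    case (Suc k)
    have "t 1 ^ Suc k \<le> t 1 * t k" using Suc nonneg[of 1] by (simp add: mult_left_mono)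
    then show ?case using step[of k] by linarith
  qed (use t0 in auto)
qed

text \<open>Young's inequality in the form that absorbs a lower moment y into a higher one y'. If 2
  K y exceeds y', the hypothesis yields y^(s+1) \<le> (2 K y)^s, which bounds y itself by (2
  K)^s.\<close>

lemma young_power_bound:
  fixes K y y' :: real
  assumes "0 \<le> K" "0 \<le> y" "0 \<le> y'" "y ^ Suc s \<le> y' ^ s"
  shows "2 * (K * y) \<le> y' + (2 * K) ^ Suc s"
proof (cases "2 * (K * y) \<le> y'")
  case True
  then show ?thesis using assms by (smt (verit) zero_le_power mult_nonneg_nonneg)
next
  case False
  then have pos: "K > 0" "y > 0" using assms by (auto simp: less_le)
  have "y * y ^ s \<le> y' ^ s" using assms by simp
  also have "\<dots> \<le> (2 * (K * y)) ^ s" using False assms by (intro power_mono) auto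
  also have "\<dots> = (2 * K) ^ s * y ^ s" by (simp add: power_mult_distrib mult_ac)
  finally have "y \<le> (2 * K) ^ s" using pos by simp
  then have "2 * K * y \<le> (2 * K) ^ Suc s" using pos by (simp add: mult_left_mono)
  then show ?thesis using assms by simp
qed

lemma mip_sum_columns: "mip D A A = (\<Sum>a\<in>D. \<Sum>b\<in>D. (A b a)\<^sup>2)"
  unfolding mip_def by (subst sum.swap) (simp add: power2_eq_square)

lemma mip_lpow_mid_eq_vpow:
  "mip D (lpow D X k mid) (lpow D X k mid) = (\<Sum>a\<in>D. vpow D X k (\<lambda>i. mid i a))"
  by (simp add: mip_sum_columns vpow_def lpow_column)

lemma mip_diff_sq_le: "mip D (\<lambda>i j. A i j - B i j) (\<lambda>i j. A i j - B i j) \<le> 2 * mip D A A + 2 * mip D B B"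
proof -
  have *: "(x - y)\<^sup>2 \<le> 2 * x\<^sup>2 + 2 * y\<^sup>2" for x y :: real
    using zero_le_power2[of "x + y"] by (simp add: power2_eq_square algebra_simps)
  show ?thesis
    unfolding mip_def power2_eq_square[symmetric] sum_distrib_left sum.distrib[symmetric]
    by (intro sum_mono *)
qed

section \<open>Centred sums and the moment inequality for symmetric matrices\<close>

definition cdev :: "'a set \<Rightarrow> ('a \<Rightarrow> real) \<Rightarrow> 'a list \<Rightarrow> real" where
  "cdev I g xs = sum_list (map g xs) - real (length xs) * ((\<Sum>x\<in>I. g x) / real (card I))"

lemma cdev_update:
  assumes "i < length xs"
  shows "cdev I g xs - cdev I g (xs[i := y]) = g (xs ! i) - g y"
proof -
  have "sum_list (map g xs) = sum_list (map g (take i xs)) + g (xs ! i) + sum_list (map g (drop (Suc i) xs))"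
    using assms by (subst id_take_nth_drop[OF assms]) simp
  then show ?thesis
    using assms by (simp add: cdev_def upd_conv_take_nth_drop)
qed

text \<open>Averaging over the replacement y leaves \<open>g (xs ! i)\<close> minus the mean. This
  writes the centred sum through the exchangeable pairs (\<open>xs\<close>,
  \<open>xs[i:=y]\<close>).\<close>

lemma cdev_sum_differences:
  assumes "finite I" "I \<noteq> {}"
  shows "cdev I g xs = (\<Sum>i<length xs. \<Sum>y\<in>I. g (xs ! i) - g y) / real (card I)"
proof -
  have "(\<Sum>i<length xs. g (xs ! i)) = sum_list (map g xs)"
    by (simp add: sum_list_sum_nth atLeast0LessThan)
  then show ?thesis
    using assms by (simp add: cdev_def sum_subtractf diff_divide_distrib sum_divide_distrib[symmetric]
        sum_distrib_left[symmetric])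
qed

text \<open>\<open>dom\<close> says that the square of \<open>G x\<close> is at most the diagonal
  matrix with entries \<open>w x a\<close> in the positive semidefinite order, so the second moments
  split into one scalar sum for each index a. With T = tr X^(2p) the exchangeable pair gives E T
  \<le> E T / 2 plus moments of these sums, which \<open>iid_moment_scalar\<close> bounds.\<close>

lemma iid_moment_matrix:
  fixes G :: "'a \<Rightarrow> 'd \<Rightarrow> 'd \<Rightarrow> real"
  assumes I: "finite I" "I \<noteq> {}" and D: "finite D"
    and sym: "\<And>x. msym (G x)"
    and dom: "\<And>x A. x \<in> I \<Longrightarrow> mip D (mmul D A (G x)) (mmul D A (G x)) \<le> (\<Sum>a\<in>D. w x a * (\<Sum>b\<in>D. (A b a)\<^sup>2))"
    and w: "\<And>x a. x \<in> I \<Longrightarrow> a \<in> D \<Longrightarrow> 0 \<le> w x a" "\<And>x a. x \<in> I \<Longrightarrow> a \<in> D \<Longrightarrow> w x a \<le> B"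
    and mean: "\<And>a. a \<in> D \<Longrightarrow> (\<Sum>x\<in>I. w x a) / real (card I) \<le> mb"
    and p: "p = Suc s"
  defines "X \<equiv> (\<lambda>xs i j. cdev I (\<lambda>x. G x i j) xs)"
  shows "iid_avg I N (\<lambda>xs. mip D (lpow D (X xs) p mid) (lpow D (X xs) p mid))
    \<le> real (card D) * (8 * real p * (4 * real N * mb + real p * B)) ^ p"
proof -
  let ?T = "\<lambda>xs. mip D (lpow D (X xs) p mid) (lpow D (X xs) p mid)"
  let ?c = "real (card I)"
  have c: "?c > 0" using I by (simp add: card_gt_0_iff)
  have symX: "msym (X xs)" for xs using sym by (simp add: X_def msym_def)
  define H where "H xs ys = (\<lambda>i j. X xs i j - X ys i j)" for xs ys
  define F where "F xs ys = mip D (H xs ys) (lpow D (X xs) (2 * s + 1) mid)" for xs ys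
  define U where "U xs ys = real (2 * s + 1) * mip D (lpow D (X xs) s (H xs ys)) (lpow D (X xs) s (H xs ys))" for xs ys
  \<comment> \<open>Squared norms of the columns of X^s, and with \<open>t'\<close> those of X^p;
    the latter sum to T.\<close>
  define t where "t xs a = vpow D (X xs) s (\<lambda>i. mid i a)" for xs a
  define t' where "t' xs a = vpow D (X xs) p (\<lambda>i. mid i a)" for xs a
  \<comment> \<open>One factor X of the trace is expressed through the exchangeable pairs, the other
    2p - 1 = 2s + 1 factors stay.\<close>
  have T_eq: "?T xs = (\<Sum>i<N. \<Sum>y\<in>I. F xs (xs[i := y])) / ?c" if "length xs = N" for xs
  proof -
    let ?P = "lpow D (X xs) (2 * s + 1) mid"
    have "?T xs = mip D mid (lpow D (X xs) (p + p) mid)"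
      using symX by (simp add: mip_lpow funpow_add)
    also have "p + p = Suc (2 * s + 1)" using p by simp
    also have "mip D mid (lpow D (X xs) (Suc (2 * s + 1)) mid) = mip D (mmul D (X xs) mid) ?P"
      using mip_left[OF symX, of D xs mid] by (simp only: funpow.simps comp_apply)
    also have "\<dots> = mip D (X xs) ?P"
      by (intro mip_cong) (use D in \<open>auto simp: mmul_mid_right\<close>)
    also have "\<dots> = mip D (\<lambda>k l. (\<Sum>i<N. \<Sum>y\<in>I. H xs (xs[i := y]) k l) / ?c) ?P"
    proof (rule mip_cong[OF _ refl])
      fix k l
      have "H xs (xs[i := y]) k l = G (xs ! i) k l - G y k l" if "i < length xs" for i y
        using cdev_update[OF that] by (simp add: H_def X_def)
      then show "X xs k l = (\<Sum>i<N. \<Sum>y\<in>I. H xs (xs[i := y]) k l) / ?c"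
        using \<open>length xs = N\<close> by (simp add: X_def cdev_sum_differences[OF I])
    qed
    also have "\<dots> = (\<Sum>i<N. \<Sum>y\<in>I. F xs (xs[i := y])) / ?c"
    proof -
      have "mip D (\<lambda>k l. (\<Sum>z\<in>Z. h z k l) / ?c) ?P = (\<Sum>z\<in>Z. mip D (h z) ?P) / ?c"
        for Z :: "(nat \<times> 'a) set" and h
      proof -
        have "mip D (\<lambda>k l. (\<Sum>z\<in>Z. h z k l) / ?c) ?P = (\<Sum>k\<in>D. \<Sum>l\<in>D. \<Sum>z\<in>Z. h z k l * ?P k l) / ?c"
          unfolding mip_def by (simp add: sum_distrib_right sum_divide_distrib)
        also have "(\<Sum>k\<in>D. \<Sum>l\<in>D. \<Sum>z\<in>Z. h z k l * ?P k l) = (\<Sum>k\<in>D. \<Sum>z\<in>Z. \<Sum>l\<in>D. h z k l * ?P k l)"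
          by (intro sum.cong refl sum.swap)
        also have "\<dots> = (\<Sum>z\<in>Z. mip D (h z) ?P)" unfolding mip_def by (rule sum.swap)
        finally show ?thesis .
      qed
      from this[where Z = "{..<N} \<times> I" and h = "\<lambda>z. H xs (xs[fst z := snd z])"]
      show ?thesis by (simp add: F_def sum.cartesian_product case_prod_beta)
    qed
    finally show ?thesis .
  qed
  \<comment> \<open>Swapping the pair only changes the sign of \<open>H\<close>, so the symmetrised
    \<open>F\<close> is \<open>H\<close> paired with a difference of odd powers.\<close>
  have FU: "F xs ys + F ys xs \<le> U xs ys + U ys xs" for xs ys
  proof -
    have Hneg: "H ys xs = (\<lambda>i j. 0 - H xs ys i j)" by (simp add: H_def)
    have zero: "lpow D Y k (\<lambda>i j. 0) = (\<lambda>i j. 0)" for Y k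
      by (induction k) (auto simp: mmul_def)
    have "lpow D Y k (\<lambda>i j. 0 - A i j) = (\<lambda>i j. 0 - lpow D Y k A i j)" for Y k and A
      by (induction k) (auto simp: mmul_def sum_negf)
    then have "mip D (lpow D (X ys) s (H ys xs)) (lpow D (X ys) s (H ys xs))
      = mip D (lpow D (X ys) s (H xs ys)) (lpow D (X ys) s (H xs ys))"
      unfolding Hneg by (simp add: mip_def)
    moreover have "F xs ys + F ys xs = mip D (H xs ys) (lpow D (X xs) (2 * s + 1) mid)
       - mip D (H xs ys) (lpow D (X ys) (2 * s + 1) mid)"
      unfolding F_def Hneg mip_diff_left by (simp add: mip_def)
    ultimately show ?thesis
      using mip_power_diff_le[OF D symX symX, of xs ys s] by (simp add: U_def H_def[symmetric] distrib_left)
  qed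
  have "iid_avg I N ?T = (\<Sum>i<N. iid_avg I N (\<lambda>xs. \<Sum>y\<in>I. F xs (xs[i := y]))) / ?c"
    unfolding iid_avg_sum[symmetric] iid_avg_divide[symmetric] by (rule iid_avg_cong) (rule T_eq)
  \<comment> \<open>By exchangeability \<open>F\<close> and its swapped version have the same
    average, and so do both versions of \<open>U\<close>; the averaged \<open>FU\<close> is
    therefore twice the wanted inequality.\<close>
  also have "\<dots> \<le> (\<Sum>i<N. iid_avg I N (\<lambda>xs. \<Sum>y\<in>I. U xs (xs[i := y]))) / ?c"
  proof (intro divide_right_mono sum_mono)
    fix i assume "i \<in> {..<N}"
    then have "i < N" by simp
    have "2 * iid_avg I N (\<lambda>xs. \<Sum>y\<in>I. F xs (xs[i := y]))
       = iid_avg I N (\<lambda>xs. (\<Sum>y\<in>I. F xs (xs[i := y])) + (\<Sum>y\<in>I. F (xs[i := y]) xs))"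
      unfolding iid_avg_add iid_avg_swap[OF \<open>i < N\<close>, of I F] by simp
    also have "\<dots> \<le> iid_avg I N (\<lambda>xs. (\<Sum>y\<in>I. U xs (xs[i := y])) + (\<Sum>y\<in>I. U (xs[i := y]) xs))"
      unfolding sum.distrib[symmetric] by (intro iid_avg_mono sum_mono FU)
    also have "\<dots> = 2 * iid_avg I N (\<lambda>xs. \<Sum>y\<in>I. U xs (xs[i := y]))"
      unfolding iid_avg_add iid_avg_swap[OF \<open>i < N\<close>, of I U] by simp
    finally show "iid_avg I N (\<lambda>xs. \<Sum>y\<in>I. F xs (xs[i := y])) \<le> iid_avg I N (\<lambda>xs. \<Sum>y\<in>I. U xs (xs[i := y]))"
      by simp
  qed auto
  also have "\<dots> = iid_avg I N (\<lambda>xs. (\<Sum>i<N. \<Sum>y\<in>I. U xs (xs[i := y])) / ?c)"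
    unfolding iid_avg_sum[symmetric] iid_avg_divide[symmetric] ..
  also have "\<dots> \<le> iid_avg I N (\<lambda>xs. ?T xs / 2 + (\<Sum>a\<in>D. (8 * real p) ^ p * (real N * mb + sum_list (map (\<lambda>x. w x a) xs)) ^ p) / 2)"
  proof (rule iid_avg_mono)
    fix xs assume xs: "set xs \<subseteq> I" "length xs = N"
    have tnn: "t xs a \<ge> 0" for a by (simp add: t_def vpow_nonneg)
    have Ub: "U xs (xs[i := y]) \<le> (4 * real p) * (\<Sum>a\<in>D. (w (xs ! i) a + w y a) * t xs a)" if "i < N" "y \<in> I" for i y
    proof -
      have xi: "xs ! i \<in> I" using xs that nth_mem by blast
      let ?A = "lpow D (X xs) s mid"
      have Heq: "H xs (xs[i := y]) = (\<lambda>k l. G (xs ! i) k l - G y k l)"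
        using cdev_update[of i xs I] that xs by (simp add: H_def X_def)
      have "mip D (lpow D (X xs) s (H xs (xs[i := y]))) (lpow D (X xs) s (H xs (xs[i := y])))
         = mip D (mmul D ?A (H xs (xs[i := y]))) (mmul D ?A (H xs (xs[i := y])))"
        using D by (intro mip_cong) (auto simp: lpow_mid_mmul)
      also have "\<dots> \<le> 2 * mip D (mmul D ?A (G (xs ! i))) (mmul D ?A (G (xs ! i))) + 2 * mip D (mmul D ?A (G y)) (mmul D ?A (G y))"
        unfolding Heq mmul_diff_right by (rule mip_diff_sq_le)
      also have "\<dots> \<le> 2 * (\<Sum>a\<in>D. w (xs ! i) a * (\<Sum>b\<in>D. (?A b a)\<^sup>2)) + 2 * (\<Sum>a\<in>D. w y a * (\<Sum>b\<in>D. (?A b a)\<^sup>2))"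
        using dom[OF xi, of ?A] dom[OF \<open>y \<in> I\<close>, of ?A] by simp
      also have "\<dots> = 2 * (\<Sum>a\<in>D. (w (xs ! i) a + w y a) * t xs a)"
        by (simp add: t_def vpow_def lpow_column distrib_right sum.distrib)
      finally have "U xs (xs[i := y]) \<le> real (2 * s + 1) * (2 * (\<Sum>a\<in>D. (w (xs ! i) a + w y a) * t xs a))"
        unfolding U_def by (rule mult_left_mono) auto
      also have "\<dots> \<le> (2 * real p) * (2 * (\<Sum>a\<in>D. (w (xs ! i) a + w y a) * t xs a))"
        by (rule mult_right_mono) (use p w xi that tnn in \<open>auto intro!: sum_nonneg mult_nonneg_nonneg add_nonneg_nonneg\<close>)
      finally show ?thesis by simp
    qed
    have "(\<Sum>i<N. \<Sum>y\<in>I. U xs (xs[i := y])) \<le> (\<Sum>i<N. \<Sum>y\<in>I. (4 * real p) * (\<Sum>a\<in>D. (w (xs ! i) a + w y a) * t xs a))"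
      by (intro sum_mono Ub) auto
    also have "\<dots> = (4 * real p) * (\<Sum>a\<in>D. (\<Sum>i<N. \<Sum>y\<in>I. w (xs ! i) a + w y a) * t xs a)"
    proof -
      have "(\<Sum>i<N. \<Sum>y\<in>I. \<Sum>a\<in>D. (w (xs ! i) a + w y a) * t xs a)
         = (\<Sum>i<N. \<Sum>a\<in>D. \<Sum>y\<in>I. (w (xs ! i) a + w y a) * t xs a)"
        by (intro sum.cong refl sum.swap)
      also have "\<dots> = (\<Sum>a\<in>D. \<Sum>i<N. \<Sum>y\<in>I. (w (xs ! i) a + w y a) * t xs a)" by (rule sum.swap)
      finally show ?thesis by (simp add: sum_distrib_left[symmetric] sum_distrib_right[symmetric])
    qed
    finally have "(\<Sum>i<N. \<Sum>y\<in>I. U xs (xs[i := y])) / ?c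
       \<le> (4 * real p) * (\<Sum>a\<in>D. (\<Sum>i<N. \<Sum>y\<in>I. w (xs ! i) a + w y a) * t xs a) / ?c"
      by (rule divide_right_mono) simp
    also have "\<dots> = (4 * real p) * (\<Sum>a\<in>D. (sum_list (map (\<lambda>x. w x a) xs) + real N * ((\<Sum>x\<in>I. w x a) / ?c)) * t xs a)"
    proof -
      have "(\<Sum>i<N. w (xs ! i) a) = sum_list (map (\<lambda>x. w x a) xs)" for a
        using xs by (simp add: sum_list_sum_nth atLeast0LessThan)
      then have eq: "(\<Sum>i<N. \<Sum>y\<in>I. w (xs ! i) a + w y a)
          = ?c * (sum_list (map (\<lambda>x. w x a) xs) + real N * ((\<Sum>x\<in>I. w x a) / ?c))" for a
        using c by (simp add: sum.distrib distrib_left sum_distrib_left[symmetric])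
      show ?thesis
        unfolding eq mult.assoc sum_distrib_left[symmetric] using c by simp
    qed
    also have "\<dots> \<le> (4 * real p) * (\<Sum>a\<in>D. (real N * mb + sum_list (map (\<lambda>x. w x a) xs)) * t xs a)"
    proof (intro mult_left_mono sum_mono mult_right_mono)
      fix a assume "a \<in> D"
      then have "real N * ((\<Sum>x\<in>I. w x a) / ?c) \<le> real N * mb"
        by (intro mult_left_mono mean) auto
      then show "sum_list (map (\<lambda>x. w x a) xs) + real N * ((\<Sum>x\<in>I. w x a) / ?c)
          \<le> real N * mb + sum_list (map (\<lambda>x. w x a) xs)" by linarith
    qed (auto simp: tnn)
    also have "\<dots> = (\<Sum>a\<in>D. 4 * real p * (real N * mb + sum_list (map (\<lambda>x. w x a) xs)) * t xs a)"
      by (simp add: sum_distrib_left mult.assoc)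
    \<comment> \<open>\<open>young_power_bound\<close> with K = 4 p V: the halves of
      \<open>t'\<close> add up to T / 2 and will be moved to the left side.\<close>
    also have "\<dots> \<le> (\<Sum>a\<in>D. t' xs a / 2 + (8 * real p) ^ p * (real N * mb + sum_list (map (\<lambda>x. w x a) xs)) ^ p / 2)"
    proof (rule sum_mono)
      fix a assume a: "a \<in> D"
      let ?V = "real N * mb + sum_list (map (\<lambda>x. w x a) xs)"
      have "mb \<ge> 0" using mean[OF a] w a by (smt (verit, best) divide_nonneg_nonneg of_nat_0_le_iff sum_nonneg)
      moreover have "0 \<le> w x a" if "x \<in> set xs" for x using w(1)[of x a] xs(1) a that by auto
      ultimately have V: "?V \<ge> 0" by (auto intro!: add_nonneg_nonneg sum_list_nonneg)
      have "vpow D (X xs) 0 (\<lambda>i. mid i a) = 1"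
        using a D by (simp add: vpow_def mid_def of_bool_def if_distrib[of "\<lambda>x. x ^ 2"] cong: if_cong)
      then have "t xs a ^ Suc s \<le> t' xs a ^ s"
        unfolding t_def t'_def p
        by (intro log_convex_power_le) (auto simp: vpow_nonneg vpow_log_convex symX)
      then have "2 * ((4 * real p * ?V) * t xs a) \<le> t' xs a + (2 * (4 * real p * ?V)) ^ Suc s"
        using V tnn by (intro young_power_bound) (auto simp: t'_def vpow_nonneg)
      also have "(2 * (4 * real p * ?V)) ^ Suc s = (8 * real p) ^ p * ?V ^ p"
        unfolding p[symmetric] power_mult_distrib[symmetric] by (simp add: mult.assoc)
      finally show "4 * real p * ?V * t xs a \<le> t' xs a / 2 + (8 * real p) ^ p * ?V ^ p / 2" by simp
    qed
    also have "\<dots> = ?T xs / 2 + (\<Sum>a\<in>D. (8 * real p) ^ p * (real N * mb + sum_list (map (\<lambda>x. w x a) xs)) ^ p) / 2"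
      by (simp add: sum.distrib mip_lpow_mid_eq_vpow t'_def sum_divide_distrib)
    finally show "(\<Sum>i<N. \<Sum>y\<in>I. U xs (xs[i := y])) / ?c
       \<le> ?T xs / 2 + (\<Sum>a\<in>D. (8 * real p) ^ p * (real N * mb + sum_list (map (\<lambda>x. w x a) xs)) ^ p) / 2" .
  qed
  also have "\<dots> = iid_avg I N ?T / 2 + (\<Sum>a\<in>D. (8 * real p) ^ p * iid_avg I N (\<lambda>xs. (real N * mb + sum_list (map (\<lambda>x. w x a) xs)) ^ p)) / 2"
    by (simp add: iid_avg_add iid_avg_divide iid_avg_sum iid_avg_cmult)
  finally have "iid_avg I N ?T \<le> (\<Sum>a\<in>D. (8 * real p) ^ p * iid_avg I N (\<lambda>xs. (real N * mb + sum_list (map (\<lambda>x. w x a) xs)) ^ p))"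
    by linarith
  also have "\<dots> \<le> (\<Sum>a\<in>D. (8 * real p) ^ p * (4 * real N * mb + real p * B) ^ p)"
  proof (intro sum_mono mult_left_mono)
    fix a assume a: "a \<in> D"
    have "mb \<ge> 0" using mean[OF a] w a by (smt (verit, best) divide_nonneg_nonneg of_nat_0_le_iff sum_nonneg)
    then have "iid_avg I N (\<lambda>xs. (real N * mb + sum_list (map (\<lambda>x. w x a) xs)) ^ p) \<le> (real N * mb + 3 * real N * mb + real p * B) ^ p"
      using a w mean p by (intro iid_moment_scalar[OF I]) auto
    then show "iid_avg I N (\<lambda>xs. (real N * mb + sum_list (map (\<lambda>x. w x a) xs)) ^ p) \<le> (4 * real N * mb + real p * B) ^ p"
      by (simp add: algebra_simps)
  qed auto
  also have "\<dots> = real (card D) * (8 * real p * (4 * real N * mb + real p * B)) ^ p"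
    by (simp only: power_mult_distrib sum_constant)
  finally show ?thesis .
qed

section \<open>Vectors and rectangular matrices through symmetric dilations\<close>

lemma cdev_zero [simp]: "cdev I (\<lambda>x. 0) xs = 0"
  by (simp add: cdev_def)

lemma mip_mmul_le: "mip D (mmul D A G) (mmul D A G) \<le> mip D A A * mip D G G"
proof -
  have "mip D (mmul D A G) (mmul D A G) \<le> (\<Sum>i\<in>D. \<Sum>j\<in>D. (\<Sum>k\<in>D. (A i k)\<^sup>2) * (\<Sum>k\<in>D. (G k j)\<^sup>2))"
    unfolding mip_def power2_eq_square[symmetric] mmul_def by (intro sum_mono Cauchy_Schwarz_ineq_sum)
  also have "\<dots> = (\<Sum>i\<in>D. \<Sum>k\<in>D. (A i k)\<^sup>2) * (\<Sum>j\<in>D. \<Sum>k\<in>D. (G k j)\<^sup>2)"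
    by (simp add: sum_product)
  also have "\<dots> = mip D A A * mip D G G"
    by (simp add: mip_sum_columns[of D G]) (simp add: mip_def power2_eq_square)
  finally show ?thesis .
qed

text \<open>The vector becomes the border of a symmetric matrix: \<open>None\<close> is a new index
  whose row and column carry it. The sum over \<open>S\<close> is then |X e|^2 for the unit vector e
  at \<open>None\<close>; by log-convexity its p-th power is at most |X^p e|^2, hence at most the
  trace. Each entry occurs twice in the matrix, which doubles 8 to 16.\<close>

lemma iid_moment_vector:
  fixes f :: "'a \<Rightarrow> 'b \<Rightarrow> real"
  assumes I: "finite I" "I \<noteq> {}" and S: "finite S"
    and B: "\<And>x. x \<in> I \<Longrightarrow> (\<Sum>b\<in>S. (f x b)\<^sup>2) \<le> B"
    and mean: "(\<Sum>x\<in>I. \<Sum>b\<in>S. (f x b)\<^sup>2) / real (card I) \<le> mb"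
    and p: "p = Suc s"
  shows "iid_avg I N (\<lambda>xs. (\<Sum>b\<in>S. (cdev I (\<lambda>x. f x b) xs)\<^sup>2) ^ p)
    \<le> (real (card S) + 1) * (16 * real p * (4 * real N * mb + real p * B)) ^ p"
proof -
  define D where "D = insert None (Some ` S)"
  define G where "G x i j = (case (i, j) of (None, Some b) \<Rightarrow> f x b | (Some b, None) \<Rightarrow> f x b | _ \<Rightarrow> 0)"
    for x i j
  define X where "X = (\<lambda>xs i j. cdev I (\<lambda>x. G x i j) xs)"
  have D: "finite D" using S by (simp add: D_def)
  have sumD: "(\<Sum>a\<in>D. h a) = h None + (\<Sum>b\<in>S. h (Some b))" for h :: "'b option \<Rightarrow> real"
    unfolding D_def using S by (subst sum.insert) (auto simp: sum.reindex)
  have symG: "msym (G x)" for x by (auto simp: msym_def G_def split: option.splits)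
  have "card D = card S + 1" unfolding D_def using S by (subst card_insert_disjoint) (auto simp: card_image)
  have normG: "mip D (G x) (G x) = 2 * (\<Sum>b\<in>S. (f x b)\<^sup>2)" for x
    unfolding mip_def sumD by (simp add: G_def power2_eq_square)
  have "iid_avg I N (\<lambda>xs. (\<Sum>b\<in>S. (cdev I (\<lambda>x. f x b) xs)\<^sup>2) ^ p)
      \<le> iid_avg I N (\<lambda>xs. mip D (lpow D (X xs) p mid) (lpow D (X xs) p mid))"
  proof (rule iid_avg_mono)
    fix xs
    let ?e = "\<lambda>i. mid i (None :: 'b option)"
    have sX: "msym (X xs)" using symG by (simp add: X_def msym_def)
    have "mv D (X xs) ?e i = X xs i None" for i
      unfolding mv_def sumD by (simp add: mid_def)
    then have "vpow D (X xs) 1 ?e = (\<Sum>b\<in>S. (cdev I (\<lambda>x. f x b) xs)\<^sup>2)"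
      by (simp add: vpow_def sumD) (simp add: X_def G_def)
    moreover have "vpow D (X xs) 0 ?e = 1"
      by (simp add: vpow_def sumD) (simp add: mid_def)
    ultimately have "(\<Sum>b\<in>S. (cdev I (\<lambda>x. f x b) xs)\<^sup>2) ^ p \<le> vpow D (X xs) p ?e"
      using log_convex_power_le'[of "\<lambda>k. vpow D (X xs) k ?e" p] vpow_log_convex[OF sX] vpow_nonneg by metis
    also have "\<dots> \<le> mip D (lpow D (X xs) p mid) (lpow D (X xs) p mid)"
      unfolding mip_lpow_mid_eq_vpow
      by (rule member_le_sum[of None D "\<lambda>a. vpow D (X xs) p (\<lambda>i. mid i a)"]) (auto simp: D vpow_nonneg, simp add: D_def)
    finally show "(\<Sum>b\<in>S. (cdev I (\<lambda>x. f x b) xs)\<^sup>2) ^ p \<le> mip D (lpow D (X xs) p mid) (lpow D (X xs) p mid)" .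
  qed
  also have "\<dots> \<le> real (card D) * (8 * real p * (4 * real N * (2 * mb) + real p * (2 * B))) ^ p"
    unfolding X_def
  proof (rule iid_moment_matrix[OF I D, where w = "\<lambda>x a. mip D (G x) (G x)"])
    show "mip D (mmul D A (G x)) (mmul D A (G x)) \<le> (\<Sum>a\<in>D. mip D (G x) (G x) * (\<Sum>b\<in>D. (A b a)\<^sup>2))" for x A
      using mip_mmul_le[of D A "G x"] by (simp add: mip_sum_columns[of D A] sum_distrib_left mult.commute)
    show "(\<Sum>x\<in>I. mip D (G x) (G x)) / real (card I) \<le> 2 * mb"
      using mean by (simp add: normG sum_distrib_left[symmetric])
    show "0 \<le> mip D (G x) (G x)" for x by (rule mip_nonneg)
  qed (use symG p B normG in auto)
  also have "\<dots> = (real (card S) + 1) * (16 * real p * (4 * real N * mb + real p * B)) ^ p"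
    using \<open>card D = card S + 1\<close> by (simp add: algebra_simps)
  finally show ?thesis .
qed

lemma mv_pow_eq:
  assumes "finite D" "i \<in> D"
  shows "(mv D X ^^ k) v i = mv D (lpow D X k mid) v i"
  using assms(2)
proof (induction k arbitrary: i)
  case 0
  have "mv D mid v i = (\<Sum>j\<in>D. if i = j then v j else 0)"
    unfolding mv_def mid_def by (intro sum.cong) auto
  then show ?case using assms 0 by simp
next
  case (Suc k)
  have "(mv D X ^^ Suc k) v i = (\<Sum>j\<in>D. X i j * mv D (lpow D X k mid) v j)"
    using Suc.IH by (simp add: mv_def[of D X "(mv D X ^^ k) v"])
  also have "\<dots> = mv D (lpow D X (Suc k) mid) v i"
    unfolding mv_def funpow.simps comp_def mmul_def sum_distrib_left sum_distrib_right mult.assoc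
    by (rule sum.swap)
  finally show ?case .
qed

text \<open>Hermitian dilation on \<open>R <+> S\<close>. The square of a dilated single entry is
  diagonal, so \<open>dom\<close> holds with equality and the mean involves only row and column sums
  of squares. \<open>T\<close> is tr X^(2p); it bounds the p-th power of |X y|^2 / |y|^2 for all y
  at once and thereby replaces the spectral norm.\<close>

lemma iid_moment_spectral:
  fixes c :: "'a \<times> 'b \<Rightarrow> real"
  assumes R: "finite R" "R \<noteq> {}" and S: "finite S" "S \<noteq> {}"
    and B: "\<And>x. x \<in> R \<times> S \<Longrightarrow> (c x)\<^sup>2 \<le> B"
    and rows: "\<And>i. i \<in> R \<Longrightarrow> (\<Sum>j\<in>S. (c (i, j))\<^sup>2) / real (card (R \<times> S)) \<le> mb"
    and cols: "\<And>j. j \<in> S \<Longrightarrow> (\<Sum>i\<in>R. (c (i, j))\<^sup>2) / real (card (R \<times> S)) \<le> mb"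
    and p: "p = Suc s"
  obtains T where "\<And>xs. 0 \<le> T xs"
    "iid_avg (R \<times> S) N T \<le> real (card R + card S) * (8 * real p * (4 * real N * mb + real p * B)) ^ p"
    "\<And>xs y. (\<Sum>i\<in>R. (\<Sum>j\<in>S. cdev (R \<times> S) (\<lambda>x. c x * of_bool (x = (i, j))) xs * y j)\<^sup>2) ^ p
        \<le> T xs * (\<Sum>j\<in>S. (y j)\<^sup>2) ^ p"
proof -
  let ?I = "R \<times> S"
  have I: "finite ?I" "?I \<noteq> {}" using R S by auto
  define D where "D = R <+> S"
  define G where "G x i j = (case (i, j) of (Inl a, Inr b) \<Rightarrow> c x * of_bool (x = (a, b))
     | (Inr b, Inl a) \<Rightarrow> c x * of_bool (x = (a, b)) | _ \<Rightarrow> 0)" for x i j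
  define X where "X = (\<lambda>xs i j. cdev ?I (\<lambda>x. G x i j) xs)"
  define T where "T xs = mip D (lpow D (X xs) p mid) (lpow D (X xs) p mid)" for xs
  define w where "w x a = (c x)\<^sup>2 * of_bool (a = Inl (fst x) \<or> a = Inr (snd x))" for x a
  have D: "finite D" using R S by (simp add: D_def)
  have sumD: "(\<Sum>a\<in>D. h a) = (\<Sum>a\<in>R. h (Inl a)) + (\<Sum>b\<in>S. h (Inr b))" for h :: "'a + 'b \<Rightarrow> real"
    unfolding D_def using R S by (simp add: sum.Plus)
  have symG: "msym (G x)" for x by (auto simp: msym_def G_def split: sum.splits)
  have sX: "msym (X xs)" for xs using symG by (simp add: X_def msym_def)
  have avg: "iid_avg ?I N T \<le> real (card D) * (8 * real p * (4 * real N * mb + real p * B)) ^ p"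
    unfolding T_def X_def
  proof (rule iid_moment_matrix[OF I D])
    fix x :: "'a \<times> 'b" and A assume x: "x \<in> ?I"
    obtain i0 j0 where x0: "x = (i0, j0)" "i0 \<in> R" "j0 \<in> S" using x by auto
    have s1: "(\<Sum>i\<in>R. h i * of_bool (i = i0)) = h i0" for h :: "'a \<Rightarrow> real"
      using R x0 by (simp add: of_bool_def if_distrib[of "\<lambda>z. _ * z"] cong: if_cong)
    have s2: "(\<Sum>j\<in>S. h j * of_bool (j = j0)) = h j0" for h :: "'b \<Rightarrow> real"
      using S x0 by (simp add: of_bool_def if_distrib[of "\<lambda>z. _ * z"] cong: if_cong)
    have G0: "G x (Inl i) (Inl k) = 0" "G x (Inr j) (Inr l) = 0"
        "G x (Inr j) (Inl i) = (c x * of_bool (i = i0)) * of_bool (j = j0)"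
        "G x (Inl i) (Inr j) = (c x * of_bool (j = j0)) * of_bool (i = i0)" for i k j l
      by (auto simp: G_def x0)
    have e1: "mmul D A (G x) a (Inl i) = A a (Inr j0) * c x * of_bool (i = i0)" for a i
    proof -
      have "mmul D A (G x) a (Inl i) = (\<Sum>j\<in>S. (A a (Inr j) * (c x * of_bool (i = i0))) * of_bool (j = j0))"
        unfolding mmul_def sumD G0 by (simp only: mult.assoc mult_zero_right sum.neutral_const add_0_left)
      then show ?thesis unfolding s2 by (simp only: mult.assoc)
    qed
    have e2: "mmul D A (G x) a (Inr j) = A a (Inl i0) * c x * of_bool (j = j0)" for a j
    proof -
      have "mmul D A (G x) a (Inr j) = (\<Sum>i\<in>R. (A a (Inl i) * (c x * of_bool (j = j0))) * of_bool (i = i0))"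
        unfolding mmul_def sumD G0 by (simp only: mult.assoc mult_zero_right sum.neutral_const add_0_right)
      then show ?thesis unfolding s1 by (simp only: mult.assoc)
    qed
    have "mip D (mmul D A (G x)) (mmul D A (G x))
       = (\<Sum>i\<in>R. (\<Sum>b\<in>D. (A b (Inr j0) * c x)\<^sup>2) * of_bool (i = i0))
         + (\<Sum>j\<in>S. (\<Sum>b\<in>D. (A b (Inl i0) * c x)\<^sup>2) * of_bool (j = j0))"
      unfolding mip_sum_columns sumD[of "\<lambda>a. \<Sum>b\<in>D. (mmul D A (G x) b a)\<^sup>2"] e1 e2
      by (simp add: power_mult_distrib sum_distrib_right of_bool_def if_distrib[of "\<lambda>x. x ^ 2"] cong: if_cong)
    also have "\<dots> = (\<Sum>b\<in>D. (A b (Inr j0) * c x)\<^sup>2) + (\<Sum>b\<in>D. (A b (Inl i0) * c x)\<^sup>2)"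
      unfolding s1 s2 ..
    also have "\<dots> = (\<Sum>a\<in>D. w x a * (\<Sum>b\<in>D. (A b a)\<^sup>2))"
    proof -
      have "(\<Sum>a\<in>D. w x a * (\<Sum>b\<in>D. (A b a)\<^sup>2))
         = (\<Sum>i\<in>R. ((c x)\<^sup>2 * (\<Sum>b\<in>D. (A b (Inl i))\<^sup>2)) * of_bool (i = i0))
          + (\<Sum>j\<in>S. ((c x)\<^sup>2 * (\<Sum>b\<in>D. (A b (Inr j))\<^sup>2)) * of_bool (j = j0))"
        unfolding sumD[of "\<lambda>a. w x a * (\<Sum>b\<in>D. (A b a)\<^sup>2)"] by (simp add: w_def x0 mult_ac)
      then show ?thesis unfolding s1 s2 by (simp add: power_mult_distrib sum_distrib_left mult_ac)
    qed
    finally show "mip D (mmul D A (G x)) (mmul D A (G x)) \<le> (\<Sum>a\<in>D. w x a * (\<Sum>b\<in>D. (A b a)\<^sup>2))" by simp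
  next
    fix x :: "'a \<times> 'b" and a assume x: "x \<in> ?I"
    show "0 \<le> w x a" by (simp add: w_def)
    show "w x a \<le> B" using B[OF x] by (auto simp: w_def intro: order_trans[OF zero_le_power2])
  next
    fix a assume a: "a \<in> D"
    show "(\<Sum>x\<in>?I. w x a) / real (card ?I) \<le> mb"
    proof (cases a)
      case (Inl i)
      have "(\<Sum>x\<in>?I. w x a) = (\<Sum>k\<in>R. \<Sum>j\<in>S. w (k, j) a)" by (simp add: sum.cartesian_product)
      also have "\<dots> = (\<Sum>k\<in>R. if k = i then \<Sum>j\<in>S. (c (k, j))\<^sup>2 else 0)"
        by (intro sum.cong) (auto simp: w_def Inl)
      finally show ?thesis using a R rows[of i] by (auto simp: Inl D_def)
    next
      case (Inr j)
      have "(\<Sum>x\<in>?I. w x a) = (\<Sum>k\<in>R. \<Sum>l\<in>S. w (k, l) a)" by (simp add: sum.cartesian_product)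
      also have "\<dots> = (\<Sum>l\<in>S. \<Sum>k\<in>R. w (k, l) a)" by (rule sum.swap)
      also have "\<dots> = (\<Sum>l\<in>S. if l = j then \<Sum>k\<in>R. (c (k, l))\<^sup>2 else 0)"
        by (intro sum.cong) (auto simp: w_def Inr)
      finally show ?thesis using a S cols[of j] by (auto simp: Inr D_def)
    qed
  qed (use symG p in auto)
  have T: "T xs \<ge> 0" for xs by (simp add: T_def mip_nonneg)
  have "(\<Sum>i\<in>R. (\<Sum>j\<in>S. cdev ?I (\<lambda>x. c x * of_bool (x = (i, j))) xs * y j)\<^sup>2) ^ p
        \<le> T xs * (\<Sum>j\<in>S. (y j)\<^sup>2) ^ p" for xs y
  proof -
    \<comment> \<open>\<open>y\<close> is placed on the column indices, so one application of the
      dilation lands on the row indices.\<close>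
    define v where "v a = (case a of Inl i \<Rightarrow> 0 | Inr j \<Rightarrow> y j)" for a :: "'a + 'b"
    let ?t = "\<lambda>k. vpow D (X xs) k v"
    have t0: "?t 0 = (\<Sum>j\<in>S. (y j)\<^sup>2)" by (simp add: vpow_def sumD) (simp add: v_def)
    have X0: "X xs (Inr i) (Inr j) = 0" for i j by (simp add: X_def G_def)
    have t1: "?t 1 = (\<Sum>i\<in>R. (\<Sum>j\<in>S. cdev ?I (\<lambda>x. c x * of_bool (x = (i, j))) xs * y j)\<^sup>2)"
      by (simp add: vpow_def sumD mv_def v_def X0) (simp add: X_def G_def)
    have tp: "?t p \<le> T xs * ?t 0"
    proof -
      have "?t p = (\<Sum>b\<in>D. (\<Sum>a\<in>D. lpow D (X xs) p mid b a * v a)\<^sup>2)"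
        unfolding vpow_def by (intro sum.cong refl) (simp add: mv_pow_eq[OF D] mv_def[of D "lpow D (X xs) p mid"])
      also have "\<dots> \<le> (\<Sum>b\<in>D. (\<Sum>a\<in>D. (lpow D (X xs) p mid b a)\<^sup>2) * (\<Sum>a\<in>D. (v a)\<^sup>2))"
        by (intro sum_mono Cauchy_Schwarz_ineq_sum)
      also have "\<dots> = T xs * ?t 0"
        by (simp add: T_def mip_def vpow_def sum_distrib_right[symmetric] power2_eq_square)
      finally show ?thesis .
    qed
    show ?thesis
    proof (cases "?t 0 = 0")
      case True
      have "(?t 1)\<^sup>2 \<le> 0" using vpow_log_convex[OF sX, of D xs 0 v] True by simp
      then have "?t 1 = 0" by simp
      then show ?thesis using T[of xs] t0 t1 p True by (simp add: sum_nonneg)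
    next
      case False
      then have pos: "?t 0 > 0" using vpow_nonneg[of D "X xs" 0 v] by simp
      \<comment> \<open>Dividing by |v|^2 gives the value 1 at k = 0 that
        \<open>log_convex_power_le'\<close> requires.\<close>
      have "(?t 1 / ?t 0) ^ p \<le> ?t p / ?t 0"
      proof (rule log_convex_power_le'[of "\<lambda>k. ?t k / ?t 0"])
        show "(?t (Suc k) / ?t 0)\<^sup>2 \<le> ?t k / ?t 0 * (?t (Suc (Suc k)) / ?t 0)" for k
          using vpow_log_convex[OF sX, of D xs k v] pos
          by (simp add: power_divide power2_eq_square divide_right_mono)
        show "0 \<le> ?t k / ?t 0" for k by (intro divide_nonneg_nonneg vpow_nonneg)
      qed (use pos in auto)
      also have "\<dots> \<le> T xs" using tp pos by (simp add: field_simps)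
      finally have "(?t 1) ^ p \<le> T xs * (?t 0) ^ p" using pos by (simp add: power_divide field_simps)
      then show ?thesis by (simp only: t0 t1)
    qed
  qed
  moreover have "card D = card R + card S" using R S by (simp add: D_def card_Plus)
  ultimately show ?thesis using that[of T] T avg by (simp only:)
qed

section \<open>Singular values and the nuclear norm\<close>

definition bform :: "nat \<Rightarrow> nat \<Rightarrow> (nat \<Rightarrow> real) \<Rightarrow> (nat \<Rightarrow> nat \<Rightarrow> real) \<Rightarrow> (nat \<Rightarrow> real) \<Rightarrow> real" where
  "bform n1 n2 x A y = (\<Sum>i<n1. \<Sum>j<n2. x i * A i j * y j)"

lemma orthonormal_combination_norm:
  assumes "orthonormal_family d r u"
  shows "(\<Sum>i<d. (\<Sum>k<r. c k * u k i)\<^sup>2) = (\<Sum>k<r. (c k)\<^sup>2)"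
proof -
  have "(\<Sum>i<d. (\<Sum>k<r. c k * u k i)\<^sup>2) = (\<Sum>i<d. \<Sum>k<r. \<Sum>l<r. (c k * u k i) * (c l * u l i))"
    by (simp add: power2_eq_square sum_product)
  also have "\<dots> = (\<Sum>k<r. \<Sum>i<d. \<Sum>l<r. (c k * u k i) * (c l * u l i))" by (rule sum.swap)
  also have "\<dots> = (\<Sum>k<r. \<Sum>l<r. \<Sum>i<d. (c k * u k i) * (c l * u l i))"
    by (intro sum.cong refl sum.swap)
  also have "\<dots> = (\<Sum>k<r. \<Sum>l<r. c k * c l * (\<Sum>i<d. u k i * u l i))"
    by (simp add: sum_distrib_left mult_ac)
  also have "\<dots> = (\<Sum>k<r. \<Sum>l<r. if l = k then c k * c l else 0)"
    using assms by (intro sum.cong refl) (auto simp: orthonormal_family_def)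
  finally show ?thesis by (simp add: power2_eq_square)
qed

lemma bessel_identity:
  assumes "orthonormal_family d r u"
  shows "(\<Sum>i<d. (x i - (\<Sum>k<r. (\<Sum>i<d. u k i * x i) * u k i))\<^sup>2)
    = (\<Sum>i<d. (x i)\<^sup>2) - (\<Sum>k<r. (\<Sum>i<d. u k i * x i)\<^sup>2)"
proof -
  define c where "c k = (\<Sum>i<d. u k i * x i)" for k
  have "(\<Sum>i<d. x i * (\<Sum>k<r. c k * u k i)) = (\<Sum>k<r. \<Sum>i<d. c k * (u k i * x i))"
    unfolding sum_distrib_left by (subst sum.swap) (simp add: mult_ac)
  then have 1: "(\<Sum>i<d. x i * (\<Sum>k<r. c k * u k i)) = (\<Sum>k<r. (c k)\<^sup>2)"
    by (simp add: sum_distrib_left[symmetric] c_def[symmetric] power2_eq_square)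
  have "(\<Sum>i<d. (x i - (\<Sum>k<r. c k * u k i))\<^sup>2)
    = (\<Sum>i<d. (x i)\<^sup>2) - 2 * (\<Sum>i<d. x i * (\<Sum>k<r. c k * u k i)) + (\<Sum>i<d. (\<Sum>k<r. c k * u k i)\<^sup>2)"
    by (simp add: power2_diff sum.distrib sum_subtractf sum_distrib_left mult.assoc)
  then show ?thesis using 1 orthonormal_combination_norm[OF assms, of c] by (simp add: c_def)
qed

lemma bessel:
  assumes "orthonormal_family d r u"
  shows "(\<Sum>k<r. (\<Sum>i<d. u k i * x i)\<^sup>2) \<le> (\<Sum>i<d. (x i)\<^sup>2)"
proof -
  have "0 \<le> (\<Sum>i<d. (x i - (\<Sum>k<r. (\<Sum>i<d. u k i * x i) * u k i))\<^sup>2)" by (simp add: sum_nonneg)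
  then show ?thesis unfolding bessel_identity[OF assms] by simp
qed

lemma orthonormal_coordinate_sq_sum_le:
  assumes "orthonormal_family d r u" "i < d"
  shows "(\<Sum>k<r. (u k i)\<^sup>2) \<le> 1"
proof -
  have "(\<Sum>j<d. u k j * (if j = i then 1 else 0)) = u k i" for k
    using assms by (simp add: if_distrib[of "\<lambda>x. _ * x"] cong: if_cong)
  moreover have "(\<Sum>j<d. (if j = i then 1 else 0 :: real)\<^sup>2) = 1"
    using assms by (simp add: if_distrib[of "\<lambda>x. x ^ 2"] cong: if_cong)
  ultimately show ?thesis using bessel[OF assms(1), of "\<lambda>j. if j = i then 1 else 0"] by simp
qed

lemma orthonormal_norm:
  assumes "orthonormal_family d r u" "k < r"
  shows "(\<Sum>i<d. (u k i)\<^sup>2) = 1"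
  using assms by (auto simp: orthonormal_family_def power2_eq_square)

lemma orthonormal_card_le:
  assumes "orthonormal_family d r u"
  shows "r \<le> d"
proof -
  have "real r = (\<Sum>k<r. \<Sum>i<d. (u k i)\<^sup>2)"
    using orthonormal_norm[OF assms] by simp
  also have "\<dots> = (\<Sum>i<d. \<Sum>k<r. (u k i)\<^sup>2)" by (rule sum.swap)
  also have "\<dots> \<le> (\<Sum>i<d. 1)"
    by (intro sum_mono orthonormal_coordinate_sq_sum_le[OF assms]) auto
  finally show ?thesis by simp
qed

lemma bform_outer:
  assumes "\<And>i j. i < n1 \<Longrightarrow> j < n2 \<Longrightarrow> A i j = (\<Sum>k<r. s k * u k i * v k j)"
  shows "bform n1 n2 x A y = (\<Sum>k<r. s k * (\<Sum>i<n1. u k i * x i) * (\<Sum>j<n2. v k j * y j))"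
proof -
  have "bform n1 n2 x A y = (\<Sum>i<n1. \<Sum>j<n2. \<Sum>k<r. s k * (u k i * x i) * (v k j * y j))"
    unfolding bform_def using assms
    by (intro sum.cong refl) (simp add: sum_distrib_left sum_distrib_right mult_ac)
  also have "\<dots> = (\<Sum>i<n1. \<Sum>k<r. \<Sum>j<n2. s k * (u k i * x i) * (v k j * y j))"
    by (intro sum.cong refl sum.swap)
  also have "\<dots> = (\<Sum>k<r. \<Sum>i<n1. \<Sum>j<n2. s k * (u k i * x i) * (v k j * y j))"
    by (rule sum.swap)
  also have "\<dots> = (\<Sum>k<r. s k * (\<Sum>i<n1. u k i * x i) * (\<Sum>j<n2. v k j * y j))"
    by (simp add: sum_distrib_left sum_distrib_right mult_ac)
  finally show ?thesis .
qed

text \<open>Duality of nuclear and spectral norm, tested on the partial isometry sum_l a_l b_l^T: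
  \<open>\<sigma> k\<close> gets the weight sum_l <a_l, u_k> <b_l, v_k>, which is at most 1 by
  Cauchy-Schwarz and Bessel. It makes the nuclear norm well defined and later bounds that of a
  competitor from below.\<close>

lemma svd_pairing_le:
  assumes X: "is_svd n1 n2 X r \<sigma> u v" and a: "orthonormal_family n1 s a" and b: "orthonormal_family n2 s b"
  shows "(\<Sum>l<s. bform n1 n2 (a l) X (b l)) \<le> (\<Sum>k<r. \<sigma> k)"
proof -
  let ?p = "\<lambda>k l. \<Sum>i<n1. a l i * u k i" and ?q = "\<lambda>k l. \<Sum>j<n2. b l j * v k j"
  have "(\<Sum>l<s. bform n1 n2 (a l) X (b l)) = (\<Sum>l<s. \<Sum>k<r. \<sigma> k * (?p k l * ?q k l))"
    using X by (intro sum.cong refl, subst bform_outer[where A = X and r = r and s = \<sigma> and u = u and v = v]) (auto simp: is_svd_def mult_ac)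
  also have "\<dots> = (\<Sum>k<r. \<sigma> k * (\<Sum>l<s. ?p k l * ?q k l))"
    by (subst sum.swap) (simp add: sum_distrib_left)
  also have "\<dots> \<le> (\<Sum>k<r. \<sigma> k)"
  proof (rule sum_mono)
    fix k assume "k \<in> {..<r}"
    then have k: "k < r" "\<sigma> k > 0" using X by (auto simp: is_svd_def)
    have p: "(\<Sum>l<s. (?p k l)\<^sup>2) \<le> 1" and q: "(\<Sum>l<s. (?q k l)\<^sup>2) \<le> 1"
      using bessel[OF a, of "u k"] bessel[OF b, of "v k"] X k
        orthonormal_norm[of n1 r u k] orthonormal_norm[of n2 r v k] by (auto simp: is_svd_def)
    have "(\<Sum>l<s. ?p k l * ?q k l)\<^sup>2 \<le> (\<Sum>l<s. (?p k l)\<^sup>2) * (\<Sum>l<s. (?q k l)\<^sup>2)"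
      by (rule Cauchy_Schwarz_ineq_sum)
    also have "\<dots> \<le> 1 * 1" by (intro mult_mono p q) (auto simp: sum_nonneg)
    finally have "(\<Sum>l<s. ?p k l * ?q k l) \<le> 1"
      using power2_le_imp_le[of "\<Sum>l<s. ?p k l * ?q k l" 1] by simp
    then show "\<sigma> k * (\<Sum>l<s. ?p k l * ?q k l) \<le> \<sigma> k" using k by simp
  qed
  finally show ?thesis .
qed

lemma svd_pairing_eq:
  assumes X: "is_svd n1 n2 X r \<sigma> u v"
  shows "k < r \<Longrightarrow> bform n1 n2 (u k) X (v k) = \<sigma> k"
proof -
  assume k: "k < r"
  have "bform n1 n2 (u k) X (v k) = (\<Sum>l<r. \<sigma> l * (\<Sum>i<n1. u l i * u k i) * (\<Sum>j<n2. v l j * v k j))"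
    by (rule bform_outer) (use X in \<open>auto simp: is_svd_def\<close>)
  also have "\<dots> = (\<Sum>l<r. if l = k then \<sigma> l else 0)"
    using X k by (intro sum.cong) (auto simp: is_svd_def orthonormal_family_def)
  finally show ?thesis using k by simp
qed

text \<open>Each of two decompositions serves as test family for the other, so their sums agree and
  the definite description has a unique value.\<close>

lemma nuclear_norm_eq:
  assumes "is_svd n1 n2 X r \<sigma> u v"
  shows "nuclear_norm n1 n2 X = (\<Sum>k<r. \<sigma> k)"
  unfolding nuclear_norm_def
proof (rule the_equality)
  show "\<exists>r' \<sigma>' u v. is_svd n1 n2 X r' \<sigma>' u v \<and> sum \<sigma> {..<r} = sum \<sigma>' {..<r'}" using assms by blast
next
  fix t assume "\<exists>r \<sigma> u v. is_svd n1 n2 X r \<sigma> u v \<and> t = sum \<sigma> {..<r}"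
  then obtain r' \<sigma>' u' v' where X': "is_svd n1 n2 X r' \<sigma>' u' v'" "t = sum \<sigma>' {..<r'}" by blast
  have "sum \<sigma>' {..<r'} \<le> sum \<sigma> {..<r}"
    using svd_pairing_le[OF assms, of r' u' v'] svd_pairing_eq[OF X'(1)] X'(1) by (simp add: is_svd_def)
  moreover have "sum \<sigma> {..<r} \<le> sum \<sigma>' {..<r'}"
    using svd_pairing_le[OF X'(1), of r u v] svd_pairing_eq[OF assms] assms by (simp add: is_svd_def)
  ultimately show "t = sum \<sigma> {..<r}" using X' by simp
qed

section \<open>Existence of the singular value decomposition\<close>

lemma compact_cube: "compact {y :: nat \<Rightarrow> real. (\<forall>j<n. \<bar>y j\<bar> \<le> 1) \<and> (\<forall>j\<ge>n. y j = 0)}"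
proof -
  \<comment> \<open>Vectors are functions on all of nat; freezing the coordinates from n on at 0
    makes the cube a product of compact sets, so Tychonoff's theorem applies.\<close>
  define S where "S j = (if j < n then {-1..1} else {0 :: real})" for j
  have "{y :: nat \<Rightarrow> real. (\<forall>j<n. \<bar>y j\<bar> \<le> 1) \<and> (\<forall>j\<ge>n. y j = 0)} = PiE UNIV S"
    by (auto simp: S_def PiE_def Pi_def abs_le_iff not_less split: if_splits)
  moreover have "compactin (product_topology (\<lambda>i. euclidean) UNIV) (PiE UNIV S)"
    by (subst compactin_PiE) (auto simp: S_def)
  ultimately show ?thesis by (simp add: euclidean_product_topology)
qed

text \<open>First-order optimality: for small t of the sign of a the linear term wins unless a = 0.
  The choice t = a / (\<bar>c\<bar> + 1) is small enough for every c.\<close>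

lemma quadratic_bound_imp_zero:
  fixes a c :: real
  assumes "\<And>t. 2 * t * a \<le> t\<^sup>2 * c"
  shows "a = 0"
proof (rule ccontr)
  assume "a \<noteq> 0"
  define t where "t = a / (\<bar>c\<bar> + 1)"
  have d: "\<bar>c\<bar> + 1 > 0" by simp
  have "2 * t * a = 2 * a\<^sup>2 / (\<bar>c\<bar> + 1)" by (simp add: t_def power2_eq_square)
  moreover have "t\<^sup>2 * c \<le> t\<^sup>2 * (\<bar>c\<bar> + 1)" by (intro mult_left_mono) auto
  moreover have "t\<^sup>2 * (\<bar>c\<bar> + 1) = a\<^sup>2 / (\<bar>c\<bar> + 1)" using d by (simp add: t_def power2_eq_square)
  ultimately have "2 * a\<^sup>2 / (\<bar>c\<bar> + 1) \<le> a\<^sup>2 / (\<bar>c\<bar> + 1)" using assms[of t] by simp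
  then have "2 * a\<^sup>2 \<le> a\<^sup>2" using d by (simp add: divide_le_cancel)
  then show False using \<open>a \<noteq> 0\<close> by simp
qed

text \<open>y maximises |E z|^2 on the unit sphere; stationarity gives E^T E y = L y, and x = E y /
  sqrt L completes the pair.\<close>

lemma top_singular_pair:
  fixes E :: "nat \<Rightarrow> nat \<Rightarrow> real"
  assumes nz: "i0 < n1" "j0 < n2" "E i0 j0 \<noteq> 0"
  obtains s x y where "s > 0" "(\<Sum>i<n1. (x i)\<^sup>2) = 1" "(\<Sum>j<n2. (y j)\<^sup>2) = 1"
    "\<And>i. i < n1 \<Longrightarrow> (\<Sum>j<n2. E i j * y j) = s * x i"
    "\<And>j. j < n2 \<Longrightarrow> (\<Sum>i<n1. x i * E i j) = s * y j"
proof -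
  define f where "f z = (\<Sum>i<n1. (\<Sum>j<n2. E i j * z j)\<^sup>2)" for z :: "nat \<Rightarrow> real"
  define S where "S = {y :: nat \<Rightarrow> real. (\<forall>j<n2. \<bar>y j\<bar> \<le> 1) \<and> (\<forall>j\<ge>n2. y j = 0)} \<inter> {y. (\<Sum>j<n2. (y j)\<^sup>2) = 1}"
  have cont: "continuous_on UNIV (\<lambda>y :: nat \<Rightarrow> real. y j)" for j by simp
  have "closed {y :: nat \<Rightarrow> real. (\<Sum>j<n2. (y j)\<^sup>2) = 1}"
    by (intro closed_Collect_eq continuous_intros cont)
  then have compact: "compact S" unfolding S_def by (intro compact_Int_closed compact_cube)
  have delta: "(\<Sum>j<n2. h j * (if j = l then 1 else 0)) = h l" if "l < n2" for h :: "nat \<Rightarrow> real" and l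
    using that by (simp add: if_distrib[of "\<lambda>x. _ * x"] cong: if_cong)
  have delta2: "(\<Sum>j<n2. (if j = l then 1 else 0 :: real)\<^sup>2) = 1" if "l < n2" for l
    using that by (simp add: if_distrib[of "\<lambda>x. x ^ 2"] cong: if_cong)
  have e0: "(\<lambda>j. if j = j0 then 1 else 0) \<in> S" using nz delta2[of j0] by (auto simp: S_def)
  have "continuous_on S f" unfolding f_def
    by (intro continuous_intros continuous_on_subset[OF cont]) auto
  then obtain y where y: "y \<in> S" "\<And>z. z \<in> S \<Longrightarrow> f z \<le> f y"
    using continuous_attains_sup[OF compact] e0 by blast
  define L where "L = f y"
  have "f (\<lambda>j. if j = j0 then 1 else 0) = (\<Sum>i<n1. (E i j0)\<^sup>2)" using nz by (simp add: f_def delta)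
  moreover have "(E i0 j0)\<^sup>2 \<le> (\<Sum>i<n1. (E i j0)\<^sup>2)" using nz by (intro member_le_sum) auto
  ultimately have L: "L > 0" using y(2)[OF e0] nz(3) unfolding L_def
    by (smt (verit) zero_less_power2)
  have ny: "(\<Sum>j<n2. (y j)\<^sup>2) = 1" using y by (simp add: S_def)
  \<comment> \<open>Homogeneity extends maximality from the sphere to all z, so that
    \<open>crit\<close> may use the unconstrained perturbations y + t z.\<close>
  have bound: "f z \<le> L * (\<Sum>j<n2. (z j)\<^sup>2)" for z
  proof (cases "(\<Sum>j<n2. (z j)\<^sup>2) = 0")
    case True
    then have "\<forall>j<n2. z j = 0" by (simp add: sum_nonneg_eq_0_iff)
    then show ?thesis using True by (simp add: f_def)
  next
    case False
    define q where "q = sqrt (\<Sum>j<n2. (z j)\<^sup>2)"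
    have q: "q > 0" "q\<^sup>2 = (\<Sum>j<n2. (z j)\<^sup>2)" using False by (auto simp: q_def sum_nonneg less_le)
    define z' where "z' j = (if j < n2 then z j / q else 0)" for j
    have n1: "(\<Sum>j<n2. (z' j)\<^sup>2) = 1"
      using q False by (simp add: z'_def power_divide sum_divide_distrib[symmetric])
    have "\<bar>z' j\<bar> \<le> 1" if "j < n2" for j
    proof -
      have "(z' j)\<^sup>2 \<le> (\<Sum>j<n2. (z' j)\<^sup>2)" using that by (intro member_le_sum) auto
      then show ?thesis using n1 by (simp add: abs_le_square_iff[of _ 1, simplified])
    qed
    then have "z' \<in> S" using n1 by (auto simp: S_def z'_def)
    then have "f z' \<le> L" using y by (simp add: L_def)
    moreover have "f z' = f z / q\<^sup>2"
      by (simp add: f_def z'_def sum_divide_distrib[symmetric] power_divide)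
    ultimately have "f z / q\<^sup>2 \<le> L" by simp
    moreover have "q\<^sup>2 > 0" using q(1) by (rule zero_less_power)
    ultimately show ?thesis unfolding q(2)[symmetric] by (simp add: divide_le_eq)
  qed
  have crit: "(\<Sum>i<n1. (\<Sum>j<n2. E i j * y j) * (\<Sum>j<n2. E i j * z j)) = L * (\<Sum>j<n2. y j * z j)" for z
  proof -
    let ?B = "\<Sum>i<n1. (\<Sum>j<n2. E i j * y j) * (\<Sum>j<n2. E i j * z j)"
    have "2 * t * (?B - L * (\<Sum>j<n2. y j * z j)) \<le> t\<^sup>2 * (L * (\<Sum>j<n2. (z j)\<^sup>2) - f z)" for t
    proof -
      have sq: "(a + t * b)\<^sup>2 = a\<^sup>2 + 2 * t * (a * b) + t\<^sup>2 * b\<^sup>2" for a b :: real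
        by (simp add: power2_eq_square algebra_simps)
      have sumsq: "(\<Sum>i<n. (a i + t * b i)\<^sup>2)
          = (\<Sum>i<n. (a i)\<^sup>2) + 2 * t * (\<Sum>i<n. a i * b i) + t\<^sup>2 * (\<Sum>i<n. (b i)\<^sup>2)"
        for a b :: "nat \<Rightarrow> real" and n
        unfolding sq sum.distrib sum_distrib_left ..
      have lin: "(\<Sum>j<n2. E i j * (y j + t * z j)) = (\<Sum>j<n2. E i j * y j) + t * (\<Sum>j<n2. E i j * z j)" for i
        unfolding sum_distrib_left sum.distrib[symmetric] by (intro sum.cong refl) (simp add: algebra_simps)
      have "f (\<lambda>j. y j + t * z j) = L + 2 * t * ?B + t\<^sup>2 * f z"
        unfolding L_def f_def lin by (rule sumsq)
      moreover have "(\<Sum>j<n2. (y j + t * z j)\<^sup>2) = 1 + 2 * t * (\<Sum>j<n2. y j * z j) + t\<^sup>2 * (\<Sum>j<n2. (z j)\<^sup>2)"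
        using sumsq[of y z n2] by (simp only: ny)
      ultimately show ?thesis using bound[of "\<lambda>j. y j + t * z j"] by (simp add: algebra_simps)
    qed
    then have "?B - L * (\<Sum>j<n2. y j * z j) = 0" by (rule quadratic_bound_imp_zero)
    then show ?thesis by simp
  qed
  define x where "x i = (\<Sum>j<n2. E i j * y j) / sqrt L" for i
  show ?thesis
  proof (rule that[of "sqrt L" x y])
    show "sqrt L > 0" using L by simp
    show "(\<Sum>i<n1. (x i)\<^sup>2) = 1"
      using L by (simp add: x_def power_divide sum_divide_distrib[symmetric]) (simp add: L_def f_def)
    show "(\<Sum>j<n2. E i j * y j) = sqrt L * x i" for i using L by (simp add: x_def)
    show "(\<Sum>i<n1. x i * E i j) = sqrt L * y j" if "j < n2" for j
    proof -
      have "(\<Sum>i<n1. (\<Sum>j<n2. E i j * y j) * E i j) = L * y j"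
        using crit[of "\<lambda>l. if l = j then 1 else 0"] that by (simp add: delta)
      then have "(\<Sum>i<n1. x i * E i j) = L * y j / sqrt L"
        by (simp add: x_def sum_divide_distrib[symmetric])
      also have "\<dots> = sqrt L * y j" using L by (simp add: field_simps real_div_sqrt power2_eq_square[symmetric])
      finally show ?thesis .
    qed
  qed (fact ny)
qed

lemma orthonormal_family_append:
  assumes u: "orthonormal_family d r u" and a: "orthonormal_family d s a"
    and perp: "\<And>k l. k < r \<Longrightarrow> l < s \<Longrightarrow> (\<Sum>i<d. u k i * a l i) = 0"
  shows "orthonormal_family d (r + s) (\<lambda>k. if k < r then u k else a (k - r))"
proof -
  have "(\<Sum>i<d. a l i * u k i) = 0" if "k < r" "l < s" for k l
    using perp[OF that] by (simp add: mult.commute)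
  then show ?thesis using u a perp unfolding orthonormal_family_def by auto
qed

text \<open>A longest family of orthonormal singular pairs exists because its length is at most
  \<open>n1\<close>. Its residual \<open>E\<close> is zero, since a top singular pair of
  \<open>E\<close> would extend the family.\<close>

lemma svd_exists: "\<exists>r \<sigma> u v. is_svd n1 n2 X r \<sigma> u v"
proof -
  define P where "P r \<sigma> u v \<longleftrightarrow> (\<forall>k<r. \<sigma> k > 0) \<and> orthonormal_family n1 r u \<and> orthonormal_family n2 r v \<and>
     (\<forall>k<r. (\<forall>i<n1. (\<Sum>j<n2. X i j * v k j) = \<sigma> k * u k i) \<and> (\<forall>j<n2. (\<Sum>i<n1. u k i * X i j) = \<sigma> k * v k j))"
    for r and \<sigma> :: "nat \<Rightarrow> real" and u v
  define Q where "Q r \<longleftrightarrow> (\<exists>\<sigma> u v. P r \<sigma> u v)" for r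
  have Q0: "Q 0" by (auto simp: Q_def P_def orthonormal_family_def)
  have Qle: "\<And>r. Q r \<Longrightarrow> r \<le> n1" using orthonormal_card_le by (auto simp: Q_def P_def)
  define r where "r = Greatest Q"
  have r: "Q r" "\<And>r'. Q r' \<Longrightarrow> r' \<le> r"
    unfolding r_def using GreatestI_nat[of Q 0 n1, OF Q0 Qle] Greatest_le_nat[of Q _ n1, OF _ Qle] by blast+
  from r(1) obtain \<sigma> u v where P: "P r \<sigma> u v" unfolding Q_def by blast
  have ou: "orthonormal_family n1 r u" and ov: "orthonormal_family n2 r v" using P by (auto simp: P_def)
  define E where "E i j = X i j - (\<Sum>k<r. \<sigma> k * u k i * v k j)" for i j
  have "E i j = 0" if "i < n1" "j < n2" for i j
  proof (rule ccontr)
    assume nz: "E i j \<noteq> 0"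
    obtain s x y where s: "s > 0" and nx: "(\<Sum>i<n1. (x i)\<^sup>2) = 1" and ny: "(\<Sum>j<n2. (y j)\<^sup>2) = 1"
      and Ey: "\<And>i. i < n1 \<Longrightarrow> (\<Sum>j<n2. E i j * y j) = s * x i"
      and Ex: "\<And>j. j < n2 \<Longrightarrow> (\<Sum>i<n1. x i * E i j) = s * y j"
      by (rule top_singular_pair[where E = E, OF \<open>i < n1\<close> \<open>j < n2\<close> nz]) (rule that; assumption)
    have Eapp: "(\<Sum>j<n2. E i j * z j) = (\<Sum>j<n2. X i j * z j) - (\<Sum>k<r. \<sigma> k * u k i * (\<Sum>j<n2. v k j * z j))" for i z
    proof -
      have "(\<Sum>j<n2. (\<Sum>k<r. \<sigma> k * u k i * v k j) * z j) = (\<Sum>k<r. \<sigma> k * u k i * (\<Sum>j<n2. v k j * z j))"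
        unfolding sum_distrib_left sum_distrib_right mult.assoc by (rule sum.swap)
      then show ?thesis by (simp add: E_def left_diff_distrib sum_subtractf)
    qed
    have Eapp': "(\<Sum>i<n1. z i * E i j) = (\<Sum>i<n1. z i * X i j) - (\<Sum>k<r. \<sigma> k * v k j * (\<Sum>i<n1. u k i * z i))" for j z
    proof -
      have "(\<Sum>i<n1. z i * (\<Sum>k<r. \<sigma> k * u k i * v k j)) = (\<Sum>k<r. \<sigma> k * v k j * (\<Sum>i<n1. u k i * z i))"
        unfolding sum_distrib_left by (subst sum.swap) (simp add: mult_ac)
      then show ?thesis by (simp add: E_def right_diff_distrib sum_subtractf)
    qed
    \<comment> \<open>\<open>E\<close> annihilates the old singular vectors on both sides; its own
      singular vectors are therefore orthogonal to them and are singular vectors of \<open>X\<close>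
      too.\<close>
    have Ev: "(\<Sum>j<n2. E i j * v k j) = 0" if "i < n1" "k < r" for i k
    proof -
      have "(\<Sum>l<r. \<sigma> l * u l i * (\<Sum>j<n2. v l j * v k j)) = (\<Sum>l<r. if l = k then \<sigma> l * u l i else 0)"
        using ov that by (intro sum.cong) (auto simp: orthonormal_family_def)
      then show ?thesis using P that by (simp add: Eapp P_def)
    qed
    have Eu: "(\<Sum>i<n1. u k i * E i j) = 0" if "j < n2" "k < r" for j k
    proof -
      have "(\<Sum>l<r. \<sigma> l * v l j * (\<Sum>i<n1. u l i * u k i)) = (\<Sum>l<r. if l = k then \<sigma> l * v l j else 0)"
        using ou that by (intro sum.cong) (auto simp: orthonormal_family_def)
      then show ?thesis using P that by (simp add: Eapp' P_def)
    qed
    have vy: "(\<Sum>j<n2. v k j * y j) = 0" if "k < r" for k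
    proof -
      have "s * (\<Sum>j<n2. v k j * y j) = (\<Sum>j<n2. v k j * (\<Sum>i<n1. x i * E i j))"
        unfolding sum_distrib_left[of s] by (intro sum.cong refl) (simp add: Ex)
      also have "\<dots> = (\<Sum>i<n1. x i * (\<Sum>j<n2. E i j * v k j))"
        unfolding sum_distrib_left by (subst sum.swap) (simp add: mult_ac)
      also have "\<dots> = 0" using that by (simp add: Ev)
      finally show ?thesis using s by simp
    qed
    have ux: "(\<Sum>i<n1. u k i * x i) = 0" if "k < r" for k
    proof -
      have "s * (\<Sum>i<n1. u k i * x i) = (\<Sum>i<n1. u k i * (\<Sum>j<n2. E i j * y j))"
        unfolding sum_distrib_left[of s] by (intro sum.cong refl) (simp add: Ey)
      also have "\<dots> = (\<Sum>j<n2. y j * (\<Sum>i<n1. u k i * E i j))"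
        unfolding sum_distrib_left by (subst sum.swap) (simp add: mult_ac)
      also have "\<dots> = 0" using that by (simp add: Eu)
      finally show ?thesis using s by simp
    qed
    have Xy: "(\<Sum>j<n2. X i j * y j) = s * x i" if "i < n1" for i
      using Eapp[of i y] Ey[OF that] vy by simp
    have Xx: "(\<Sum>i<n1. x i * X i j) = s * y j" if "j < n2" for j
      using Eapp'[of x j] Ex[OF that] ux by simp
    have "orthonormal_family n1 (r + 1) (\<lambda>k. if k < r then u k else x)"
      using orthonormal_family_append[OF ou, of 1 "\<lambda>_. x"] nx ux
      by (simp add: orthonormal_family_def power2_eq_square)
    moreover have "orthonormal_family n2 (r + 1) (\<lambda>k. if k < r then v k else y)"
      using orthonormal_family_append[OF ov, of 1 "\<lambda>_. y"] ny vy
      by (simp add: orthonormal_family_def power2_eq_square)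
    ultimately have "P (r + 1) (\<lambda>k. if k < r then \<sigma> k else s) (\<lambda>k. if k < r then u k else x) (\<lambda>k. if k < r then v k else y)"
      using P s Xy Xx by (auto simp: P_def)
    then have "Q (r + 1)" unfolding Q_def by blast
    then have "r + 1 \<le> r" by (rule r(2))
    then show False by simp
  qed
  then have "is_svd n1 n2 X r \<sigma> u v" using P by (auto simp: is_svd_def P_def E_def)
  then show ?thesis by blast
qed

section \<open>Sampling operators and orthogonal projections\<close>

text \<open>Variances of independent draws add up; in the induction the offset b holds the deviation
  of the draws already made.\<close>

lemma iid_variance:
  assumes I: "finite I" "I \<noteq> {}"
  shows "iid_avg I N (\<lambda>xs. (cdev I g xs)\<^sup>2) \<le> real N * ((\<Sum>x\<in>I. (g x)\<^sup>2) / real (card I))"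
proof -
  define m where "m = (\<Sum>x\<in>I. g x) / real (card I)"
  define V where "V = (\<Sum>x\<in>I. (g x)\<^sup>2) / real (card I)"
  have c: "real (card I) > 0" using I by (simp add: card_gt_0_iff)
  have one: "(\<Sum>x\<in>I. (b + (g x - m))\<^sup>2) / real (card I) \<le> b\<^sup>2 + V" for b
  proof -
    have "(\<Sum>x\<in>I. (b + (g x - m))\<^sup>2) = (\<Sum>x\<in>I. (b - m)\<^sup>2 + 2 * (b - m) * g x + (g x)\<^sup>2)"
      by (intro sum.cong refl) (simp add: power2_eq_square algebra_simps)
    also have "\<dots> = real (card I) * (b - m)\<^sup>2 + 2 * (b - m) * (\<Sum>x\<in>I. g x) + (\<Sum>x\<in>I. (g x)\<^sup>2)"
      by (simp add: sum.distrib sum_distrib_left)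
    finally have "(\<Sum>x\<in>I. (b + (g x - m))\<^sup>2) / real (card I) = (b - m)\<^sup>2 + 2 * (b - m) * m + V"
      using c by (simp add: add_divide_distrib m_def V_def)
    also have "\<dots> = b\<^sup>2 - m\<^sup>2 + V" by (simp add: power2_eq_square algebra_simps)
    finally show ?thesis by simp
  qed
  have "iid_avg I N (\<lambda>xs. (b + cdev I g xs)\<^sup>2) \<le> b\<^sup>2 + real N * V" for b
  proof (induction N arbitrary: b)
    case 0
    then show ?case by (simp add: cdev_def)
  next
    case (Suc N)
    have "iid_avg I (Suc N) (\<lambda>xs. (b + cdev I g xs)\<^sup>2)
      = (\<Sum>x\<in>I. iid_avg I N (\<lambda>xs. ((b + (g x - m)) + cdev I g xs)\<^sup>2)) / real (card I)"
      by (simp add: cdev_def m_def algebra_simps add_divide_distrib)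
    also have "\<dots> \<le> (\<Sum>x\<in>I. (b + (g x - m))\<^sup>2 + real N * V) / real (card I)"
      by (intro divide_right_mono sum_mono Suc) auto
    also have "\<dots> = (\<Sum>x\<in>I. (b + (g x - m))\<^sup>2) / real (card I) + real N * V"
      using c by (simp add: sum.distrib add_divide_distrib)
    finally show ?case using one[of b] by (simp add: algebra_simps)
  qed
  from this[of 0] show ?thesis by (simp add: V_def)
qed

text \<open>An orthogonal projection in coordinates, given by a symmetric idempotent kernel. In the
  application \<open>I\<close> is the set of matrix positions and the range is the tangent
  space.\<close>

locale projection_kernel =
  fixes I :: "'a set" and K :: "'a \<Rightarrow> 'a \<Rightarrow> real"
  assumes finite: "finite I" and nonempty: "I \<noteq> {}"
    and K_sym: "K x y = K y x"
    and K_idem: "x \<in> I \<Longrightarrow> z \<in> I \<Longrightarrow> (\<Sum>y\<in>I. K x y * K y z) = K x z"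
begin

definition proj :: "('a \<Rightarrow> real) \<Rightarrow> 'a \<Rightarrow> real" where
  "proj Z x = (\<Sum>y\<in>I. K x y * Z y)"

definition nrm :: "('a \<Rightarrow> real) \<Rightarrow> real" where
  "nrm Z = L2_set Z I"

text \<open>Draws count with multiplicity, and the factor makes the operator unbiased: its average
  over the draws is the identity.\<close>

definition samp :: "'a list \<Rightarrow> ('a \<Rightarrow> real) \<Rightarrow> 'a \<Rightarrow> real" where
  "samp xs Z x = real (card I) / real (length xs) * (real (count_list xs x) * Z x)"

definition step :: "'a list \<Rightarrow> ('a \<Rightarrow> real) \<Rightarrow> 'a \<Rightarrow> real" where
  "step xs Z x = proj Z x - proj (samp xs (proj Z)) x"

text \<open>Each round consumes the next \<open>N\<close> draws, so the factors of the product are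
  independent.\<close>

primrec steps :: "nat \<Rightarrow> nat \<Rightarrow> 'a list \<Rightarrow> ('a \<Rightarrow> real) \<Rightarrow> 'a \<Rightarrow> real" where
  "steps N 0 xs Z = Z"
| "steps N (Suc L) xs Z = steps N L (drop N xs) (step (take N xs) Z)"

lemma card_pos: "real (card I) > 0"
  using finite nonempty by (simp add: card_gt_0_iff)

lemma proj_self_adjoint: "(\<Sum>x\<in>I. proj A x * B x) = (\<Sum>x\<in>I. A x * proj B x)"
proof -
  have "(\<Sum>x\<in>I. proj A x * B x) = (\<Sum>y\<in>I. \<Sum>x\<in>I. K x y * A y * B x)"
    unfolding proj_def sum_distrib_right by (rule sum.swap)
  then show ?thesis by (simp add: proj_def sum_distrib_left K_sym mult_ac)
qed

lemma proj_cong: "(\<And>x. x \<in> I \<Longrightarrow> A x = B x) \<Longrightarrow> proj A = proj B"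
  by (auto simp: proj_def fun_eq_iff intro!: sum.cong)

lemma proj_proj: "x \<in> I \<Longrightarrow> proj (proj A) x = proj A x"
proof -
  assume x: "x \<in> I"
  have "proj (proj A) x = (\<Sum>z\<in>I. \<Sum>y\<in>I. K x y * K y z * A z)"
    unfolding proj_def sum_distrib_left mult.assoc by (rule sum.swap)
  also have "\<dots> = proj A x"
    using x by (simp add: sum_distrib_right[symmetric] K_idem proj_def)
  finally show ?thesis .
qed

lemma proj_add: "proj (\<lambda>x. A x + B x) x = proj A x + proj B x"
  by (simp add: proj_def distrib_left sum.distrib)

lemma proj_diff: "proj (\<lambda>x. A x - B x) x = proj A x - proj B x"
  by (simp add: proj_def right_diff_distrib sum_subtractf)

lemma proj_sum: "proj (\<lambda>x. \<Sum>e\<in>E. c e * A e x) x = (\<Sum>e\<in>E. c e * proj (A e) x)"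
  unfolding proj_def sum_distrib_left by (subst sum.swap) (simp add: mult_ac)

lemma nrm_nonneg: "0 \<le> nrm Z" by (simp add: nrm_def)

lemma nrm_sq: "(nrm Z)\<^sup>2 = (\<Sum>x\<in>I. (Z x)\<^sup>2)"
  by (simp add: nrm_def L2_set_def sum_nonneg)

lemma nrm_cong: "(\<And>x. x \<in> I \<Longrightarrow> A x = B x) \<Longrightarrow> nrm A = nrm B"
  by (simp add: nrm_def L2_set_def)

lemma nrm_add_le: "nrm (\<lambda>x. A x + B x) \<le> nrm A + nrm B"
  unfolding nrm_def by (rule L2_set_triangle_ineq)

lemma nrm_minus: "nrm (\<lambda>x. - A x) = nrm A"
  by (simp add: nrm_def L2_set_def)

lemma nrm_diff_le: "nrm (\<lambda>x. A x - B x) \<le> nrm A + nrm B"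
  using nrm_add_le[of A "\<lambda>x. - B x"] by (simp add: nrm_minus)

lemma inner_le_nrm: "(\<Sum>x\<in>I. A x * B x) \<le> nrm A * nrm B"
proof -
  have "(\<Sum>x\<in>I. A x * B x) \<le> (\<Sum>x\<in>I. \<bar>A x\<bar> * \<bar>B x\<bar>)"
    by (intro sum_mono) (simp add: abs_mult[symmetric])
  also have "\<dots> \<le> nrm A * nrm B" unfolding nrm_def by (rule L2_set_mult_ineq)
  finally show ?thesis .
qed

lemma nrm_proj_le: "nrm (proj Z) \<le> nrm Z"
proof -
  have "(\<Sum>x\<in>I. (Z x - proj Z x)\<^sup>2) = (\<Sum>x\<in>I. (Z x)\<^sup>2) - 2 * (\<Sum>x\<in>I. Z x * proj Z x) + (\<Sum>x\<in>I. (proj Z x)\<^sup>2)"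
    by (simp add: power2_diff sum.distrib sum_subtractf sum_distrib_left mult.assoc)
  also have "(\<Sum>x\<in>I. Z x * proj Z x) = (\<Sum>x\<in>I. (proj Z x)\<^sup>2)"
    using proj_self_adjoint[of Z "proj Z"] by (simp add: proj_proj power2_eq_square)
  finally have "(nrm (proj Z))\<^sup>2 \<le> (nrm Z)\<^sup>2"
    using sum_nonneg[of I "\<lambda>x. (Z x - proj Z x)\<^sup>2"] by (simp add: nrm_sq)
  then show ?thesis by (rule power2_le_imp_le) (rule nrm_nonneg)
qed

lemma K_row_sq: "x \<in> I \<Longrightarrow> (\<Sum>y\<in>I. (K x y)\<^sup>2) = K x x"
  using K_idem[of x x] by (simp add: power2_eq_square K_sym)

lemma K_diag_nonneg: "x \<in> I \<Longrightarrow> 0 \<le> K x x"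
  unfolding K_row_sq[symmetric] by (simp add: sum_nonneg)

lemma K_sq_le: "x \<in> I \<Longrightarrow> y \<in> I \<Longrightarrow> (K x y)\<^sup>2 \<le> K x x * K y y"
proof -
  assume xy: "x \<in> I" "y \<in> I"
  have "(\<Sum>z\<in>I. (K z y)\<^sup>2) = (\<Sum>z\<in>I. (K y z)\<^sup>2)"
    by (intro sum.cong refl arg_cong[where f = "\<lambda>t. t\<^sup>2"] K_sym)
  then show ?thesis
    using Cauchy_Schwarz_ineq_sum[of "K x" "\<lambda>z. K z y" I] xy by (simp only: K_idem K_row_sq)
qed

lemma samp_cong: "(\<And>x. x \<in> I \<Longrightarrow> A x = B x) \<Longrightarrow> x \<in> I \<Longrightarrow> samp xs A x = samp xs B x"
  by (simp add: samp_def)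

lemma samp_add: "samp xs (\<lambda>x. A x + B x) x = samp xs A x + samp xs B x"
  by (simp add: samp_def algebra_simps)

lemma samp_eq_sum_list:
  "samp xs Z x = real (card I) / real (length xs) * sum_list (map (\<lambda>y. Z y * of_bool (y = x)) xs)"
  by (induction xs) (auto simp: samp_def algebra_simps add_divide_distrib)

lemma proj_samp:
  assumes "set xs \<subseteq> I"
  shows "proj (samp xs Z) x = real (card I) / real (length xs) * sum_list (map (\<lambda>y. K x y * Z y) xs)"
proof -
  have "proj (samp xs Z) x = real (card I) / real (length xs) * (\<Sum>y\<in>I. of_nat (count_list xs y) * (K x y * Z y))"
    unfolding proj_def samp_def sum_distrib_left by (intro sum.cong) auto
  also have "(\<Sum>y\<in>I. of_nat (count_list xs y) * (K x y * Z y)) = (\<Sum>y\<in>set xs. of_nat (count_list xs y) * (K x y * Z y))"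
    using assms finite by (intro sum.mono_neutral_right) (auto simp: count_list_0_iff)
  also have "\<dots> = sum_list (map (\<lambda>y. K x y * Z y) xs)"
  proof (induction xs)
    case (Cons a xs)
    have "(\<Sum>y\<in>set (a # xs). real (count_list (a # xs) y) * (K x y * Z y))
      = (\<Sum>y\<in>insert a (set xs). of_bool (y = a) * (K x y * Z y) + real (count_list xs y) * (K x y * Z y))"
      by (intro sum.cong) (auto simp: algebra_simps)
    also have "\<dots> = (\<Sum>y\<in>insert a (set xs). if y = a then K x y * Z y else 0) + (\<Sum>y\<in>insert a (set xs). real (count_list xs y) * (K x y * Z y))"
      unfolding sum.distrib by (intro arg_cong2[of _ _ _ _ "(+)"] sum.cong) auto
    also have "(\<Sum>y\<in>insert a (set xs). real (count_list xs y) * (K x y * Z y)) = (\<Sum>y\<in>set xs. real (count_list xs y) * (K x y * Z y))"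
      by (intro sum.mono_neutral_right) (auto simp: count_list_0_iff)
    finally show ?case using Cons by simp
  qed auto
  finally show ?thesis .
qed

lemma nrm_samp_le:
  assumes "xs \<noteq> []"
  shows "nrm (samp xs Z) \<le> real (card I) * nrm Z"
proof -
  have "\<bar>samp xs Z x\<bar> \<le> real (card I) * \<bar>Z x\<bar>" for x
  proof -
    have "real (count_list xs x) / real (length xs) \<le> 1"
      using assms count_le_length[of xs x] by (simp add: divide_le_eq)
    then have "real (card I) * (real (count_list xs x) / real (length xs)) * \<bar>Z x\<bar> \<le> real (card I) * 1 * \<bar>Z x\<bar>"
      by (intro mult_right_mono mult_left_mono) auto
    then show ?thesis by (simp add: samp_def abs_mult)
  qed
  then have "(samp xs Z x)\<^sup>2 \<le> (real (card I) * Z x)\<^sup>2" for x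
    by (simp add: abs_le_square_iff[symmetric] abs_mult)
  then have "(nrm (samp xs Z))\<^sup>2 \<le> (real (card I) * nrm Z)\<^sup>2"
    unfolding power_mult_distrib nrm_sq sum_distrib_left by (intro sum_mono) (simp add: power_mult_distrib)
  then show ?thesis by (rule power2_le_imp_le) (simp add: nrm_nonneg)
qed

text \<open>Sampling is unbiased and \<open>proj\<close> idempotent, so a step is nothing but a
  centred fluctuation. This opens it to the variance and moment bounds.\<close>

lemma step_eq_cdev:
  assumes "set xs \<subseteq> I" "xs \<noteq> []" "x \<in> I"
  shows "step xs Z x = - (cdev I (\<lambda>y. real (card I) * (K x y * proj Z y)) xs / real (length xs))"
proof -
  have "(\<Sum>y\<in>I. real (card I) * (K x y * proj Z y)) / real (card I) = proj Z x"
    using card_pos proj_proj[OF assms(3), of Z] by (simp add: sum_distrib_left[symmetric] proj_def)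
  moreover have "sum_list (map (\<lambda>y. real (card I) * (K x y * proj Z y)) xs) = real (card I) * sum_list (map (\<lambda>y. K x y * proj Z y) xs)"
    by (simp add: sum_list_const_mult)
  ultimately show ?thesis
    using assms by (simp add: step_def proj_samp[OF assms(1)] cdev_def field_simps)
qed

text \<open>Variances are computed coordinate by coordinate. Summing the squared kernel over x first
  leaves its diagonal, which \<open>\<kappa>\<close> bounds.\<close>

lemma iid_avg_step_sq_le:
  assumes diag: "\<And>x. x \<in> I \<Longrightarrow> K x x \<le> \<kappa>" and N: "N > 0"
  shows "iid_avg I N (\<lambda>xs. (nrm (step xs Z))\<^sup>2) \<le> real (card I) * \<kappa> / real N * (nrm Z)\<^sup>2"
proof -
  let ?g = "\<lambda>x y. real (card I) * (K x y * proj Z y)"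
  have "iid_avg I N (\<lambda>xs. (nrm (step xs Z))\<^sup>2) = iid_avg I N (\<lambda>xs. \<Sum>x\<in>I. (cdev I (?g x) xs)\<^sup>2 / (real N)\<^sup>2)"
    unfolding nrm_sq using N by (intro iid_avg_cong sum.cong refl) (auto simp: step_eq_cdev power_divide)
  also have "\<dots> = (\<Sum>x\<in>I. iid_avg I N (\<lambda>xs. (cdev I (?g x) xs)\<^sup>2) / (real N)\<^sup>2)"
    by (simp add: iid_avg_sum iid_avg_divide)
  also have "\<dots> \<le> (\<Sum>x\<in>I. real N * ((\<Sum>y\<in>I. (?g x y)\<^sup>2) / real (card I)) / (real N)\<^sup>2)"
    by (intro sum_mono divide_right_mono iid_variance finite nonempty) auto
  also have "\<dots> = real (card I) / real N * (\<Sum>x\<in>I. \<Sum>y\<in>I. (K x y)\<^sup>2 * (proj Z y)\<^sup>2)"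
  proof -
    have sq: "(\<Sum>y\<in>I. (?g x y)\<^sup>2) = (real (card I))\<^sup>2 * (\<Sum>y\<in>I. (K x y)\<^sup>2 * (proj Z y)\<^sup>2)" for x
      by (simp add: power_mult_distrib sum_distrib_left)
    have "real N * ((real (card I))\<^sup>2 * S / real (card I)) / (real N)\<^sup>2 = real (card I) / real N * S" for S
      using card_pos N by (simp add: field_simps power2_eq_square)
    then show ?thesis by (subst sum_distrib_left) (simp only: sq)
  qed
  also have "(\<Sum>x\<in>I. \<Sum>y\<in>I. (K x y)\<^sup>2 * (proj Z y)\<^sup>2) = (\<Sum>y\<in>I. \<Sum>x\<in>I. (K x y)\<^sup>2 * (proj Z y)\<^sup>2)"
    by (rule sum.swap)
  also have "\<dots> = (\<Sum>y\<in>I. K y y * (proj Z y)\<^sup>2)"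
    using K_row_sq by (simp add: sum_distrib_right[symmetric] K_sym)
  also have "real (card I) / real N * (\<Sum>y\<in>I. K y y * (proj Z y)\<^sup>2) \<le> real (card I) / real N * (\<kappa> * (nrm Z)\<^sup>2)"
  proof (rule mult_left_mono)
    obtain x0 where "x0 \<in> I" using nonempty by auto
    then have \<kappa>: "\<kappa> \<ge> 0" using K_diag_nonneg[of x0] diag[of x0] by linarith
    have "(\<Sum>y\<in>I. K y y * (proj Z y)\<^sup>2) \<le> (\<Sum>y\<in>I. \<kappa> * (proj Z y)\<^sup>2)"
      by (intro sum_mono mult_right_mono diag) auto
    also have "\<dots> = \<kappa> * (nrm (proj Z))\<^sup>2" by (simp add: nrm_sq sum_distrib_left)
    also have "\<dots> \<le> \<kappa> * (nrm Z)\<^sup>2"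
      by (intro mult_left_mono power_mono nrm_proj_le nrm_nonneg \<kappa>)
    finally show "(\<Sum>y\<in>I. K y y * (proj Z y)\<^sup>2) \<le> \<kappa> * (nrm Z)\<^sup>2" .
  qed auto
  finally show ?thesis by simp
qed

lemma iid_avg_steps_sq_le:
  assumes diag: "\<And>x. x \<in> I \<Longrightarrow> K x x \<le> \<kappa>" and N: "N > 0" and q: "real (card I) * \<kappa> / real N \<le> q"
  shows "iid_avg I (L * N) (\<lambda>xs. (nrm (steps N L xs Z))\<^sup>2) \<le> q ^ L * (nrm Z)\<^sup>2"
proof (induction L arbitrary: Z)
  case (Suc L)
  obtain x0 where "x0 \<in> I" using nonempty by auto
  then have "0 \<le> real (card I) * \<kappa> / real N" using K_diag_nonneg[of x0] diag[of x0] by auto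
  then have q0: "q \<ge> 0" using q by linarith
  have "iid_avg I (Suc L * N) (\<lambda>xs. (nrm (steps N (Suc L) xs Z))\<^sup>2)
    = iid_avg I N (\<lambda>xs. iid_avg I (L * N) (\<lambda>ys. (nrm (steps N L ys (step xs Z)))\<^sup>2))"
    unfolding mult_Suc iid_avg_append by (intro iid_avg_cong) simp
  also have "\<dots> \<le> iid_avg I N (\<lambda>xs. q ^ L * (nrm (step xs Z))\<^sup>2)"
    by (intro iid_avg_mono Suc)
  also have "\<dots> = q ^ L * iid_avg I N (\<lambda>xs. (nrm (step xs Z))\<^sup>2)" by (rule iid_avg_cmult)
  also have "\<dots> \<le> q ^ L * (q * (nrm Z)\<^sup>2)"
    using q0 by (intro mult_left_mono order_trans[OF iid_avg_step_sq_le[OF diag N]] mult_right_mono q) auto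
  finally show ?case by (simp add: mult_ac)
qed simp

lemma step_lin: "step xs (\<lambda>x. \<Sum>e\<in>E. c e * A e x) = (\<lambda>x. \<Sum>e\<in>E. c e * step xs (A e) x)"
proof
  fix x
  have p: "proj (\<lambda>x. \<Sum>e\<in>E. c e * A e x) = (\<lambda>x. \<Sum>e\<in>E. c e * proj (A e) x)"
    by (rule ext) (rule proj_sum)
  have s: "samp xs (\<lambda>x. \<Sum>e\<in>E. c e * B e x) = (\<lambda>x. \<Sum>e\<in>E. c e * samp xs (B e) x)" for B
    by (simp add: fun_eq_iff samp_def sum_distrib_left mult_ac)
  show "step xs (\<lambda>x. \<Sum>e\<in>E. c e * A e x) x = (\<Sum>e\<in>E. c e * step xs (A e) x)"
    unfolding step_def p s proj_sum by (simp add: right_diff_distrib sum_subtractf)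
qed

lemma steps_lin: "steps N L xs (\<lambda>x. \<Sum>e\<in>E. c e * A e x) = (\<lambda>x. \<Sum>e\<in>E. c e * steps N L xs (A e) x)"
  by (induction L arbitrary: xs A) (simp_all add: step_lin)

lemma step_cong: "(\<And>x. x \<in> I \<Longrightarrow> A x = B x) \<Longrightarrow> step xs A = step xs B"
proof -
  assume "\<And>x. x \<in> I \<Longrightarrow> A x = B x"
  then have "proj A = proj B" by (rule proj_cong)
  then show ?thesis by (intro ext) (simp only: step_def)
qed

lemma steps_cong: "(\<And>x. x \<in> I \<Longrightarrow> A x = B x) \<Longrightarrow> x \<in> I \<Longrightarrow> steps N L xs A x = steps N L xs B x"
proof (cases L)
  case (Suc k)
  moreover assume "\<And>x. x \<in> I \<Longrightarrow> A x = B x"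
  then have "step ys A = step ys B" for ys by (rule step_cong)
  ultimately show ?thesis by simp
qed simp

text \<open>The operator norm is at most the Hilbert-Schmidt norm. The latter involves only fixed
  unit vectors, so its average is accessible.\<close>

lemma nrm_steps_le:
  "(nrm (steps N L xs Z))\<^sup>2 \<le> (\<Sum>e\<in>I. (nrm (steps N L xs (\<lambda>x. of_bool (x = e))))\<^sup>2) * (nrm Z)\<^sup>2"
proof -
  let ?S = "\<lambda>e. steps N L xs (\<lambda>x. of_bool (x = e))"
  have e: "Z x = (\<Sum>e\<in>I. Z e * of_bool (x = e))" if "x \<in> I" for x
    using that finite by (simp add: of_bool_def if_distrib[of "\<lambda>x. _ * x"] cong: if_cong)
  have "steps N L xs Z x = (\<Sum>e\<in>I. Z e * ?S e x)" if "x \<in> I" for x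
    using steps_cong[of Z "\<lambda>x. \<Sum>e\<in>I. Z e * of_bool (x = e)" x N L xs, OF e that]
    by (simp only: steps_lin)
  then have "(nrm (steps N L xs Z))\<^sup>2 = (\<Sum>x\<in>I. (\<Sum>e\<in>I. Z e * ?S e x)\<^sup>2)"
    by (simp add: nrm_sq)
  also have "\<dots> \<le> (\<Sum>x\<in>I. (\<Sum>e\<in>I. (Z e)\<^sup>2) * (\<Sum>e\<in>I. (?S e x)\<^sup>2))"
    by (intro sum_mono Cauchy_Schwarz_ineq_sum)
  also have "\<dots> = (nrm Z)\<^sup>2 * (\<Sum>e\<in>I. (nrm (?S e))\<^sup>2)"
    unfolding nrm_sq sum_distrib_left[symmetric] by (subst sum.swap) simp
  finally show ?thesis by (simp add: mult.commute)
qed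

definition contracting :: "nat \<Rightarrow> nat \<Rightarrow> 'a list \<Rightarrow> bool" where
  "contracting N L xs \<longleftrightarrow> (\<forall>Z. nrm (steps N L xs Z) \<le> nrm Z / 2)"

text \<open>Each unit vector contributes at most q^L to the expected squared Hilbert-Schmidt norm;
  the factor 4 scales the target norm 1/2 to the threshold 1 of Markov's inequality.\<close>

lemma iid_avg_contracting_ge:
  assumes diag: "\<And>x. x \<in> I \<Longrightarrow> K x x \<le> \<kappa>" and N: "N > 0" and q: "real (card I) * \<kappa> / real N \<le> q"
  shows "iid_avg I (L * N) (\<lambda>xs. of_bool (contracting N L xs)) \<ge> 1 - 4 * q ^ L * real (card I)"
proof (rule iid_avg_markov[OF finite nonempty])
  let ?F = "\<lambda>xs. 4 * (\<Sum>e\<in>I. (nrm (steps N L xs (\<lambda>x. of_bool (x = e))))\<^sup>2)"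
  show "0 \<le> ?F xs" for xs by (simp add: sum_nonneg)
  show "contracting N L xs" if "?F xs < 1" for xs
    unfolding contracting_def
  proof
    fix Z
    have "(nrm (steps N L xs Z))\<^sup>2 \<le> 1 / 4 * (nrm Z)\<^sup>2"
      using that by (intro order_trans[OF nrm_steps_le] mult_right_mono) auto
    then have "(nrm (steps N L xs Z))\<^sup>2 \<le> (nrm Z / 2)\<^sup>2" by (simp add: power_divide)
    then show "nrm (steps N L xs Z) \<le> nrm Z / 2" by (rule power2_le_imp_le) (simp add: nrm_nonneg)
  qed
  have "iid_avg I (L * N) ?F \<le> 4 * (\<Sum>e\<in>I. q ^ L * (nrm (\<lambda>x. of_bool (x = e)))\<^sup>2)"
    unfolding iid_avg_cmult iid_avg_sum by (intro mult_left_mono sum_mono iid_avg_steps_sq_le[OF diag N q]) auto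
  also have "\<dots> = 4 * (\<Sum>e\<in>I. q ^ L)"
  proof -
    have "(nrm (\<lambda>x. of_bool (x = e)))\<^sup>2 = 1" if "e \<in> I" for e
      using that finite by (simp add: nrm_sq of_bool_def if_distrib[of "\<lambda>x. x ^ 2"] cong: if_cong)
    then show ?thesis by simp
  qed
  finally show "iid_avg I (L * N) ?F \<le> 4 * q ^ L * real (card I)" by (simp add: mult_ac)
qed

lemma nrm_step_le:
  assumes "xs \<noteq> []"
  shows "nrm (step xs E) \<le> (1 + real (card I)) * nrm E"
proof -
  have "nrm (step xs E) \<le> nrm (proj E) + nrm (proj (samp xs (proj E)))"
    unfolding step_def by (rule nrm_diff_le)
  also have "\<dots> \<le> nrm E + real (card I) * nrm E"
    by (intro add_mono nrm_proj_le order_trans[OF nrm_proj_le] order_trans[OF nrm_samp_le[OF assms]] mult_left_mono) auto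
  finally show ?thesis by (simp add: algebra_simps)
qed

text \<open>At drawn positions A = - B, so a step fixes A up to the projected sampling of B. Adding
  \<open>nrm B\<close> to the error makes the loss of each round a single factor.\<close>

lemma steps_error:
  assumes N: "N > 0" "length xs = L * N" and fixp: "\<And>x. x \<in> I \<Longrightarrow> proj A x = A x"
    and zero: "\<And>x. x \<in> set xs \<Longrightarrow> A x + B x = 0"
  shows "nrm (\<lambda>x. steps N L xs A' x - A x) + nrm B \<le> (1 + real (card I)) ^ L * (nrm (\<lambda>x. A' x - A x) + nrm B)"
  using N(2) zero
proof (induction L arbitrary: xs A')
  case (Suc L)
  let ?c = "real (card I)" and ?ys = "take N xs"
  have ys: "?ys \<noteq> []" using N Suc.prems by auto
  have "samp ?ys (proj A) x = - samp ?ys B x" if "x \<in> I" for x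
  proof (cases "x \<in> set ?ys")
    case True
    then have "x \<in> set xs" by (rule in_set_takeD)
    then have "A x = - B x" using Suc.prems(2)[of x] by linarith
    then show ?thesis using fixp[OF that] by (simp add: samp_def)
  qed (simp add: samp_def count_list_0_iff)
  then have "proj (samp ?ys (proj A)) = proj (\<lambda>x. - samp ?ys B x)" by (rule proj_cong)
  then have eq: "step ?ys A x - A x = proj (samp ?ys B) x" if "x \<in> I" for x
    using fixp[OF that] proj_diff[of "\<lambda>x. 0" "samp ?ys B" x] by (simp add: step_def proj_def sum_negf)
  have lin: "step ?ys A' x = step ?ys (\<lambda>x. A' x - A x) x + step ?ys A x" for x
  proof -
    have p: "proj A' = (\<lambda>x. proj (\<lambda>x. A' x - A x) x + proj A x)" by (simp add: fun_eq_iff proj_diff)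
    have "samp ?ys (proj A') = (\<lambda>x. samp ?ys (proj (\<lambda>x. A' x - A x)) x + samp ?ys (proj A) x)"
      unfolding samp_add[symmetric] by (simp only: p)
    then show ?thesis by (simp add: step_def proj_add proj_diff)
  qed
  have "nrm (\<lambda>x. step ?ys A' x - A x) = nrm (\<lambda>x. step ?ys (\<lambda>x. A' x - A x) x + proj (samp ?ys B) x)"
    using eq lin by (intro nrm_cong) (simp add: algebra_simps)
  also have "\<dots> \<le> (1 + ?c) * nrm (\<lambda>x. A' x - A x) + ?c * nrm B"
    by (intro order_trans[OF nrm_add_le] add_mono nrm_step_le[OF ys] order_trans[OF nrm_proj_le] nrm_samp_le[OF ys])
  finally have one: "nrm (\<lambda>x. step ?ys A' x - A x) + nrm B \<le> (1 + ?c) * (nrm (\<lambda>x. A' x - A x) + nrm B)"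
    by (simp add: algebra_simps)
  have "nrm (\<lambda>x. steps N (Suc L) xs A' x - A x) + nrm B \<le> (1 + ?c) ^ L * (nrm (\<lambda>x. step ?ys A' x - A x) + nrm B)"
    using Suc.IH[of "drop N xs" "step ?ys A'"] Suc.prems in_set_dropD[of _ N xs] by simp
  also have "\<dots> \<le> (1 + ?c) ^ L * ((1 + ?c) * (nrm (\<lambda>x. A' x - A x) + nrm B))"
    by (intro mult_left_mono one) auto
  finally show ?case by (simp add: mult_ac)
qed simp

text \<open>By \<open>steps_error\<close> with A = P Z and B = Z - P Z the steps nearly fix P Z, and
  yet they halve it. The crude power of \<open>card I\<close> is tolerable because the golfing
  residual can be made smaller still.\<close>

lemma contracting_imp_injective:
  assumes con: "contracting N L xs" and N: "N > 0" "length xs = L * N"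
    and zero: "\<And>x. x \<in> set xs \<Longrightarrow> Z x = 0"
  shows "nrm (proj Z) \<le> 2 * (1 + real (card I)) ^ L * nrm (\<lambda>x. Z x - proj Z x)"
proof -
  let ?A = "proj Z" and ?B = "\<lambda>x. Z x - proj Z x"
  have "nrm ?A \<le> nrm (steps N L xs ?A) + nrm (\<lambda>x. steps N L xs ?A x - ?A x)"
    using nrm_diff_le[of "steps N L xs ?A" "\<lambda>x. steps N L xs ?A x - ?A x"] by simp
  moreover have "nrm (steps N L xs ?A) \<le> nrm ?A / 2" using con by (simp add: contracting_def)
  moreover have "nrm (\<lambda>x. steps N L xs ?A x - ?A x) + nrm ?B \<le> (1 + real (card I)) ^ L * (nrm (\<lambda>x. ?A x - ?A x) + nrm ?B)"
    by (rule steps_error[OF N]) (use zero proj_proj in auto)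
  moreover have "nrm (\<lambda>x. ?A x - ?A x) = 0" by (simp add: nrm_def L2_set_def)
  ultimately show ?thesis using nrm_nonneg[of ?B] by simp
qed

text \<open>Restricted to \<open>S\<close>, a step is a centred sum of vectors, to which
  \<open>iid_moment_vector\<close> applies. \<open>S\<close> will be a row, a column or a single
  position.\<close>

lemma iid_avg_slice_moment:
  assumes S: "S \<subseteq> I" and W: "\<And>x. x \<in> I \<Longrightarrow> proj W x = W x" and N: "N > 0" and p: "p = Suc s"
    and B: "\<And>y. y \<in> I \<Longrightarrow> (W y)\<^sup>2 * (\<Sum>x\<in>S. (K x y)\<^sup>2) \<le> B"
    and mean: "(\<Sum>y\<in>I. (W y)\<^sup>2 * (\<Sum>x\<in>S. (K x y)\<^sup>2)) \<le> mb"
  shows "iid_avg I N (\<lambda>xs. (\<Sum>x\<in>S. (step xs W x)\<^sup>2) ^ p)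
    \<le> (real (card S) + 1) * (16 * real p * (4 * (real (card I) / real N) * mb + real p * (real (card I) / real N)\<^sup>2 * B)) ^ p"
proof -
  let ?f = "\<lambda>y x. real (card I) * (K x y * W y)" and ?c = "real (card I)"
  have f: "(\<Sum>x\<in>S. (?f y x)\<^sup>2) = ?c\<^sup>2 * ((W y)\<^sup>2 * (\<Sum>x\<in>S. (K x y)\<^sup>2))" for y
    by (simp add: power_mult_distrib sum_distrib_left mult_ac)
  have "iid_avg I N (\<lambda>xs. (\<Sum>x\<in>S. (step xs W x)\<^sup>2) ^ p)
     = iid_avg I N (\<lambda>xs. (1 / (real N)\<^sup>2) ^ p * (\<Sum>x\<in>S. (cdev I (\<lambda>y. ?f y x) xs)\<^sup>2) ^ p)"
  proof (rule iid_avg_cong)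
    fix xs assume xs: "set xs \<subseteq> I" "length xs = N"
    have "step xs W x = - (cdev I (\<lambda>y. ?f y x) xs / real N)" if "x \<in> S" for x
    proof -
      have "(\<Sum>y\<in>I. real (card I) * (K x y * proj W y)) = (\<Sum>y\<in>I. ?f y x)" by (simp add: W)
      moreover have "map (\<lambda>y. real (card I) * (K x y * proj W y)) xs = map (\<lambda>y. ?f y x) xs"
        using xs W by auto
      ultimately have "cdev I (\<lambda>y. real (card I) * (K x y * proj W y)) xs = cdev I (\<lambda>y. ?f y x) xs"
        by (simp only: cdev_def)
      then show ?thesis using step_eq_cdev[OF xs(1), of x W] that S xs N by auto
    qed
    then have "(\<Sum>x\<in>S. (step xs W x)\<^sup>2) = 1 / (real N)\<^sup>2 * (\<Sum>x\<in>S. (cdev I (\<lambda>y. ?f y x) xs)\<^sup>2)"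
      by (simp add: power_divide sum_divide_distrib)
    then show "(\<Sum>x\<in>S. (step xs W x)\<^sup>2) ^ p = (1 / (real N)\<^sup>2) ^ p * (\<Sum>x\<in>S. (cdev I (\<lambda>y. ?f y x) xs)\<^sup>2) ^ p"
      by (simp only: power_mult_distrib)
  qed
  also have "\<dots> \<le> (1 / (real N)\<^sup>2) ^ p * ((real (card S) + 1) * (16 * real p * (4 * real N * (?c * mb) + real p * (?c\<^sup>2 * B))) ^ p)"
    unfolding iid_avg_cmult
  proof (rule mult_left_mono)
    show "iid_avg I N (\<lambda>xs. (\<Sum>x\<in>S. (cdev I (\<lambda>y. ?f y x) xs)\<^sup>2) ^ p)
      \<le> (real (card S) + 1) * (16 * real p * (4 * real N * (?c * mb) + real p * (?c\<^sup>2 * B))) ^ p"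
    proof (rule iid_moment_vector[OF finite nonempty _ _ _ p])
      show "finite S" using S finite by (rule finite_subset)
      show "(\<Sum>x\<in>S. (?f y x)\<^sup>2) \<le> ?c\<^sup>2 * B" if "y \<in> I" for y
        unfolding f using B[OF that] by (rule mult_left_mono) simp
      have "(\<Sum>y\<in>I. \<Sum>x\<in>S. (?f y x)\<^sup>2) / ?c = ?c * (\<Sum>y\<in>I. (W y)\<^sup>2 * (\<Sum>x\<in>S. (K x y)\<^sup>2))"
        unfolding f sum_distrib_left[symmetric] using card_pos by (simp add: power2_eq_square)
      then show "(\<Sum>y\<in>I. \<Sum>x\<in>S. (?f y x)\<^sup>2) / ?c \<le> ?c * mb"
        using mult_left_mono[OF mean, of ?c] by simp
    qed
  qed simp
  also have "\<dots> = (real (card S) + 1) * (1 / (real N)\<^sup>2 * (16 * real p * (4 * real N * (?c * mb) + real p * (?c\<^sup>2 * B)))) ^ p"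
    by (simp only: power_mult_distrib mult.left_commute)
  also have "1 / (real N)\<^sup>2 * (16 * real p * (4 * real N * (?c * mb) + real p * (?c\<^sup>2 * B)))
     = 16 * real p * (4 * (?c / real N) * mb + real p * (?c / real N)\<^sup>2 * B)"
    using N by (simp add: field_simps power2_eq_square)
  finally show ?thesis .
qed

end

section \<open>The tangent space\<close>

text \<open>The kernel of the orthogonal projection P_U onto the span of the family; its diagonal
  value at a is |P_U e_a|^2.\<close>

definition gram :: "nat \<Rightarrow> (nat \<Rightarrow> nat \<Rightarrow> real) \<Rightarrow> nat \<Rightarrow> nat \<Rightarrow> real" where
  "gram r u a i = (\<Sum>k<r. u k a * u k i)"

definition gperp :: "nat \<Rightarrow> (nat \<Rightarrow> nat \<Rightarrow> real) \<Rightarrow> nat \<Rightarrow> nat \<Rightarrow> real" where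
  "gperp r u a i = of_bool (a = i) - gram r u a i"

text \<open>The kernel of the projection \<open>Z \<mapsto> P\<^sub>U Z + (1 - P\<^sub>U) Z P\<^sub>V\<close> onto the tangent space.\<close>

definition tker :: "nat \<Rightarrow> (nat \<Rightarrow> nat \<Rightarrow> real) \<Rightarrow> (nat \<Rightarrow> nat \<Rightarrow> real) \<Rightarrow> nat \<times> nat \<Rightarrow> nat \<times> nat \<Rightarrow> real" where
  "tker r u v x y = gram r u (fst x) (fst y) * of_bool (snd x = snd y)
     + gperp r u (fst x) (fst y) * gram r v (snd x) (snd y)"

lemma gram_sym: "gram r u a i = gram r u i a"
  by (simp add: gram_def mult.commute)

lemma gperp_sym: "gperp r u a i = gperp r u i a"
  unfolding gperp_def gram_sym[of r u a i] eq_commute[of a i] ..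

lemma gram_diag: "gram r u a a = (\<Sum>k<r. (u k a)\<^sup>2)"
  by (simp add: gram_def power2_eq_square)

lemma sum_delta_left: fixes d :: nat shows "a < d \<Longrightarrow> (\<Sum>i<d. of_bool (a = i) * h i) = (h a :: real)"
  by (simp add: of_bool_def if_distrib[of "\<lambda>x. x * _"] cong: if_cong)

lemma sum_delta_right: fixes d :: nat shows "a < d \<Longrightarrow> (\<Sum>i<d. h i * of_bool (i = a)) = (h a :: real)"
  by (simp add: of_bool_def if_distrib[of "\<lambda>x. _ * x"] cong: if_cong)

lemma gram_apply: "(\<Sum>i<d. gram r u a i * x i) = (\<Sum>k<r. u k a * (\<Sum>i<d. u k i * x i))"
  unfolding gram_def sum_distrib_left sum_distrib_right by (subst sum.swap) (simp add: mult_ac)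

lemma gram_apply_basis:
  assumes "orthonormal_family d r u" "k < r"
  shows "(\<Sum>i<d. gram r u a i * u k i) = u k a"
proof -
  have "(\<Sum>l<r. u l a * (\<Sum>i<d. u l i * u k i)) = (\<Sum>l<r. u l a * of_bool (l = k))"
    using assms by (intro sum.cong) (auto simp: orthonormal_family_def)
  then show ?thesis using assms by (simp add: gram_apply sum_delta_right)
qed

lemma gram_gram:
  assumes "orthonormal_family d r u"
  shows "(\<Sum>i<d. gram r u a i * gram r u i c) = gram r u a c"
proof -
  have "(\<Sum>i<d. gram r u a i * gram r u i c) = (\<Sum>k<r. (\<Sum>i<d. gram r u a i * u k i) * u k c)"
    unfolding gram_def[of r u _ c] sum_distrib_left sum_distrib_right mult.assoc by (rule sum.swap)
  then show ?thesis by (simp add: gram_apply_basis[OF assms] gram_def[of r u a c])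
qed

lemma gram_gperp:
  assumes "orthonormal_family d r u" "a < d" "c < d"
  shows "(\<Sum>i<d. gram r u a i * gperp r u i c) = 0" "(\<Sum>i<d. gperp r u a i * gram r u i c) = 0"
    "(\<Sum>i<d. gperp r u a i * gperp r u i c) = gperp r u a c"
proof -
  show 1: "(\<Sum>i<d. gram r u a i * gperp r u i c) = 0"
    using assms by (simp add: gperp_def right_diff_distrib sum_subtractf sum_delta_right gram_gram)
  show "(\<Sum>i<d. gperp r u a i * gram r u i c) = 0"
    using assms by (simp add: gperp_def left_diff_distrib sum_subtractf sum_delta_left gram_gram)
  have "(\<Sum>i<d. gperp r u a i * gperp r u i c) = (\<Sum>i<d. of_bool (a = i) * gperp r u i c) - (\<Sum>i<d. gram r u a i * gperp r u i c)"
    unfolding gperp_def[of r u a] left_diff_distrib sum_subtractf ..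
  then show "(\<Sum>i<d. gperp r u a i * gperp r u i c) = gperp r u a c"
    using assms by (simp add: 1 sum_delta_left)
qed

lemma gram_diag_le_1: "orthonormal_family d r u \<Longrightarrow> a < d \<Longrightarrow> gram r u a a \<le> 1"
  unfolding gram_diag by (rule orthonormal_coordinate_sq_sum_le)

lemma gram_diag_nonneg: "0 \<le> gram r u a a"
  unfolding gram_diag by (simp add: sum_nonneg)

lemma gram_sq_le: "(gram r u a i)\<^sup>2 \<le> gram r u a a * gram r u i i"
  unfolding gram_diag unfolding gram_def by (rule Cauchy_Schwarz_ineq_sum)

lemma sum_tensor: "(\<Sum>y\<in>A \<times> B. f (fst y) * g (snd y)) = (\<Sum>i\<in>A. f i) * (\<Sum>j\<in>B. (g j :: real))"
  by (simp add: sum_product sum.cartesian_product case_prod_beta)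

lemma tker_sym: "tker r u v x y = tker r u v y x"
  unfolding tker_def gram_sym[of r u "fst x" "fst y"] gperp_sym[of r u "fst x" "fst y"]
    gram_sym[of r v "snd x" "snd y"] eq_commute[of "snd x" "snd y"] ..

text \<open>The same projection with the complement in the second factor, the form in which sums
  along a row decouple.\<close>

lemma tker_alt: "tker r u v x y = gram r u (fst x) (fst y) * gperp r v (snd x) (snd y)
    + of_bool (fst x = fst y) * gram r v (snd x) (snd y)"
  by (simp add: tker_def gperp_def algebra_simps)

text \<open>Transposition exchanges the roles of \<open>u\<close> and \<open>v\<close>, so column
  estimates follow from row estimates.\<close>

lemma tker_swap: "tker r u v (a, b) (i, j) = tker r v u (b, a) (j, i)"
  by (simp add: tker_alt[of r v u] tker_def) (simp add: gperp_def algebra_simps)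

locale orthonormal_pair =
  fixes n1 n2 r :: nat and u v :: "nat \<Rightarrow> nat \<Rightarrow> real"
  assumes ou: "orthonormal_family n1 r u" and ov: "orthonormal_family n2 r v"
    and n1_pos: "n1 > 0" and n2_pos: "n2 > 0"
begin

sublocale projection_kernel "{..<n1} \<times> {..<n2}" "tker r u v"
proof
  show "{..<n1} \<times> {..<n2} \<noteq> {}" using n1_pos n2_pos by auto
  show "tker r u v x y = tker r u v y x" for x y by (rule tker_sym)
  fix x z assume x: "x \<in> {..<n1} \<times> {..<n2}" and z: "z \<in> {..<n1} \<times> {..<n2}"
  obtain a b c d where e: "x = (a, b)" "z = (c, d)" by (meson surj_pair)
  have l: "a < n1" "b < n2" "c < n1" "d < n2" using x z e by auto
  let ?P = "gram r u" and ?R = "gperp r u" and ?Q = "gram r v" and ?D = "\<lambda>i j. of_bool (i = j) :: real"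
  \<comment> \<open>P \<otimes> 1 + (1 - P) \<otimes> Q is idempotent: the sums over positions
    factor, and the mixed products contain P (1 - P) = 0.\<close>
  have "(\<Sum>y\<in>{..<n1} \<times> {..<n2}. tker r u v x y * tker r u v y z)
    = (\<Sum>y\<in>{..<n1} \<times> {..<n2}. (?P a (fst y) * ?P (fst y) c) * (?D b (snd y) * ?D (snd y) d)
       + (?P a (fst y) * ?R (fst y) c) * (?D b (snd y) * ?Q (snd y) d)
       + (?R a (fst y) * ?P (fst y) c) * (?Q b (snd y) * ?D (snd y) d)
       + (?R a (fst y) * ?R (fst y) c) * (?Q b (snd y) * ?Q (snd y) d))"
    unfolding tker_def e by (intro sum.cong refl) (simp add: algebra_simps)
  also have "\<dots> = ?P a c * ?D b d + ?R a c * ?Q b d"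
    unfolding sum.distrib sum_tensor[of "\<lambda>i. ?P a i * ?P i c" "\<lambda>j. ?D b j * ?D j d"]
      sum_tensor[of "\<lambda>i. ?P a i * ?R i c" "\<lambda>j. ?D b j * ?Q j d"]
      sum_tensor[of "\<lambda>i. ?R a i * ?P i c" "\<lambda>j. ?Q b j * ?D j d"]
      sum_tensor[of "\<lambda>i. ?R a i * ?R i c" "\<lambda>j. ?Q b j * ?Q j d"]
    using l by (simp add: gram_gram[OF ou] gram_gram[OF ov] gram_gperp[OF ou] sum_delta_left)
  also have "\<dots> = tker r u v x z" by (simp add: tker_def e)
  finally show "(\<Sum>y\<in>{..<n1} \<times> {..<n2}. tker r u v x y * tker r u v y z) = tker r u v x z" .
qed simp

lemma tker_diag_le:
  "tker r u v (a, b) (a, b) \<le> gram r u a a + gram r v b b"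
proof -
  have "0 \<le> gram r u a a * gram r v b b" by (intro mult_nonneg_nonneg gram_diag_nonneg)
  then show ?thesis by (simp add: tker_def gperp_def left_diff_distrib)
qed

text \<open>In the form \<open>tker_alt\<close> the mixed term vanishes after summation over b,
  because (1 - P_V) P_V = 0.\<close>

lemma tker_row_sq_le:
  assumes "j < n2"
  shows "(\<Sum>b<n2. (tker r u v (a, b) (i, j))\<^sup>2) \<le> (gram r u a i)\<^sup>2 + of_bool (a = i) * gram r v j j"
proof -
  let ?P = "gram r u a i" and ?D = "of_bool (a = i) :: real"
  have e: "(?P * x + ?D * y)\<^sup>2 = ?P\<^sup>2 * (x * x) + (2 * ?P * ?D) * (x * y) + ?D * (y * y)" for x y
    by (simp add: power2_eq_square algebra_simps)
  have "(\<Sum>b<n2. (tker r u v (a, b) (i, j))\<^sup>2)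
    = ?P\<^sup>2 * (\<Sum>b<n2. gperp r v b j * gperp r v b j) + (2 * ?P * ?D) * (\<Sum>b<n2. gperp r v b j * gram r v b j)
      + ?D * (\<Sum>b<n2. gram r v b j * gram r v b j)"
    unfolding tker_alt fst_conv snd_conv e sum.distrib sum_distrib_left[symmetric] ..
  also have "\<dots> = ?P\<^sup>2 * gperp r v j j + ?D * gram r v j j"
  proof -
    have "(\<Sum>b<n2. gperp r v b j * f b j) = (\<Sum>b<n2. gperp r v j b * f b j)"
      "(\<Sum>b<n2. gram r v b j * f b j) = (\<Sum>b<n2. gram r v j b * f b j)" for f :: "nat \<Rightarrow> nat \<Rightarrow> real"
      by (intro sum.cong refl arg_cong2[where f = "(*)"] gperp_sym gram_sym)+
    then show ?thesis using gram_gperp(2,3)[OF ov assms assms] gram_gram[OF ov, of j j] by simp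
  qed
  also have "\<dots> \<le> ?P\<^sup>2 * 1 + ?D * gram r v j j"
    using gram_diag_nonneg[of r v j] by (intro add_mono mult_left_mono) (auto simp: gperp_def)
  finally show ?thesis by simp
qed

lemma swapped: "orthonormal_pair n2 n1 r v u"
  by unfold_locales (use ou ov n1_pos n2_pos in auto)

lemma tker_col_sq_le:
  assumes "i < n1"
  shows "(\<Sum>a<n1. (tker r u v (a, b) (i, j))\<^sup>2) \<le> (gram r v b j)\<^sup>2 + of_bool (b = j) * gram r u i i"
  using orthonormal_pair.tker_row_sq_le[OF swapped assms, of b j] by (simp add: tker_swap[of r u v])

text \<open>\<open>W\<close> is tangent and as spread out as the sign matrix U V^T scaled by
  \<open>\<tau>\<close>. The row and column bounds control variances, the entry bound the largest
  summand.\<close>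

definition tame :: "real \<Rightarrow> real \<Rightarrow> (nat \<times> nat \<Rightarrow> real) \<Rightarrow> bool" where
  "tame \<nu> \<tau> W \<longleftrightarrow> (\<forall>x\<in>{..<n1} \<times> {..<n2}. proj W x = W x) \<and>
     (\<forall>a<n1. (\<Sum>b<n2. (W (a, b))\<^sup>2) \<le> \<tau>\<^sup>2 * \<nu> / real n1) \<and>
     (\<forall>b<n2. (\<Sum>a<n1. (W (a, b))\<^sup>2) \<le> \<tau>\<^sup>2 * \<nu> / real n2) \<and>
     (\<forall>x\<in>{..<n1} \<times> {..<n2}. (W x)\<^sup>2 \<le> \<tau>\<^sup>2 * \<nu>\<^sup>2 / (real n1 * real n2))"

end

section \<open>Moments of one golfing step\<close>

text \<open>\<open>A\<close> and \<open>B\<close> are the two dimensions. All coefficients are at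
  most 2 \<epsilon> or 4 \<epsilon>, by (A + B) \<nu> / N \<le> 2 \<epsilon> and \<epsilon>^2 \<le>
  \<epsilon>. This brings the bases of the row, entry and spectral moments to one constant; columns
  exchange A and B.\<close>

lemma moment_constants:
  fixes A B N m \<nu> \<tau> :: real
  assumes pos: "A > 0" "B > 0" "N > 0" "\<nu> \<ge> 0" and m: "A \<le> m" "B \<le> m" and p: "p \<ge> 0"
  defines "\<epsilon> \<equiv> m * \<nu> / N"
  assumes \<epsilon>: "\<epsilon> \<le> 1"
  shows "16 * p * (4 * (A * B / N) * (\<tau>\<^sup>2 * \<nu> / A * (\<nu> / A + \<nu> / B)) + p * (A * B / N)\<^sup>2 * (\<tau>\<^sup>2 * \<nu>\<^sup>2 / (A * B) * (\<nu> / A + \<nu> / B)))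
      \<le> 16 * p * (8 + 4 * p) * \<epsilon> * (\<tau>\<^sup>2 * \<nu> / A)" (is ?row)
    and "16 * p * (4 * (A * B / N) * (\<tau>\<^sup>2 * \<nu>\<^sup>2 / (A * B) * (\<nu> / A + \<nu> / B)) + p * (A * B / N)\<^sup>2 * (\<tau>\<^sup>2 * \<nu>\<^sup>2 / (A * B) * (\<nu> / A + \<nu> / B)\<^sup>2))
      \<le> 16 * p * (8 + 4 * p) * \<epsilon> * (\<tau>\<^sup>2 * \<nu>\<^sup>2 / (A * B))" (is ?entry)
    and "8 * p * (4 * N * (m * \<nu> * \<tau>\<^sup>2) + p * ((A * B)\<^sup>2 * (\<tau>\<^sup>2 * \<nu>\<^sup>2 / (A * B)))) / N\<^sup>2
      \<le> 16 * p * (8 + 4 * p) * \<epsilon> * \<tau>\<^sup>2" (is ?spectral)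
proof -
  have \<epsilon>0: "\<epsilon> \<ge> 0" using pos m by (simp add: \<epsilon>_def)
  have \<epsilon>2: "\<epsilon>\<^sup>2 \<le> \<epsilon>" using \<epsilon> \<epsilon>0 by (simp add: power2_eq_square mult_left_le)
  have s: "(A + B) * \<nu> / N \<le> 2 * \<epsilon>"
  proof -
    have "(A + B) * \<nu> \<le> (2 * m) * \<nu>" using m pos by (intro mult_right_mono) auto
    then show ?thesis using pos by (simp add: \<epsilon>_def divide_right_mono)
  qed
  have s0: "0 \<le> (A + B) * \<nu> / N" using pos by simp
  have s2: "((A + B) * \<nu> / N)\<^sup>2 \<le> 4 * \<epsilon>"
    using power_mono[OF s s0, of 2] \<epsilon>2 by (simp add: power_mult_distrib)
  have a: "A * (A + B) * \<nu>\<^sup>2 / N\<^sup>2 \<le> 4 * \<epsilon>"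
  proof -
    have "A * (A + B) * \<nu>\<^sup>2 / N\<^sup>2 \<le> (A + B) * (A + B) * \<nu>\<^sup>2 / N\<^sup>2"
      using pos by (intro divide_right_mono mult_right_mono) auto
    then show ?thesis using s2 by (simp add: power_mult_distrib power_divide power2_eq_square[of "A + B"])
  qed
  have ab: "A * B * \<nu>\<^sup>2 / N\<^sup>2 \<le> 4 * \<epsilon>"
  proof -
    have "A * B * \<nu>\<^sup>2 / N\<^sup>2 \<le> A * (A + B) * \<nu>\<^sup>2 / N\<^sup>2"
      using pos by (intro divide_right_mono mult_right_mono mult_left_mono) auto
    then show ?thesis using a by simp
  qed
  have main: "16 * p * (4 * (x * t) + p * (y * t)) \<le> 16 * p * (8 + 4 * p) * \<epsilon> * t"
    if "x \<le> 2 * \<epsilon>" "y \<le> 4 * \<epsilon>" "t \<ge> 0" for x y t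
  proof -
    have "x * t \<le> (2 * \<epsilon>) * t" "y * t \<le> (4 * \<epsilon>) * t" using that by (auto intro: mult_right_mono)
    then have "4 * (x * t) + p * (y * t) \<le> 4 * ((2 * \<epsilon>) * t) + p * ((4 * \<epsilon>) * t)"
      using p by (intro add_mono mult_left_mono) auto
    then have "16 * p * (4 * (x * t) + p * (y * t)) \<le> 16 * p * (4 * ((2 * \<epsilon>) * t) + p * ((4 * \<epsilon>) * t))"
      using p by (intro mult_left_mono) auto
    then show ?thesis by (simp add: algebra_simps)
  qed
  have r1: "(A * B / N) * (\<tau>\<^sup>2 * \<nu> / A * (\<nu> / A + \<nu> / B)) = ((A + B) * \<nu> / N) * (\<tau>\<^sup>2 * \<nu> / A)"
    using pos by (simp add: field_simps power2_eq_square)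
  have r2: "(A * B / N)\<^sup>2 * (\<tau>\<^sup>2 * \<nu>\<^sup>2 / (A * B) * (\<nu> / A + \<nu> / B)) = (A * (A + B) * \<nu>\<^sup>2 / N\<^sup>2) * (\<tau>\<^sup>2 * \<nu> / A)"
    using pos by (simp add: field_simps power2_eq_square)
  show ?row
    using main[OF s a, of "\<tau>\<^sup>2 * \<nu> / A"] pos r1 r2 by (simp only: mult.assoc) simp
  have e1: "(A * B / N) * (T * (\<nu> / A + \<nu> / B)) = ((A + B) * \<nu> / N) * T" for T
    using pos by (simp add: field_simps power2_eq_square)
  have e2: "(A * B / N)\<^sup>2 * (T * (\<nu> / A + \<nu> / B)\<^sup>2) = ((A + B) * \<nu> / N)\<^sup>2 * T" for T
  proof -
    have q: "A * B / N * (\<nu> / A + \<nu> / B) = (A + B) * \<nu> / N" using pos by (simp add: field_simps)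
    have "(A * B / N)\<^sup>2 * (\<nu> / A + \<nu> / B)\<^sup>2 = ((A + B) * \<nu> / N)\<^sup>2"
      by (simp only: power_mult_distrib[symmetric] q)
    then show ?thesis by (simp add: mult.left_commute mult.commute)
  qed
  show ?entry
    using main[OF s s2, of "\<tau>\<^sup>2 * \<nu>\<^sup>2 / (A * B)"] pos e1 e2 by (simp only: mult.assoc) simp
  have "8 * p * (4 * N * (m * \<nu> * \<tau>\<^sup>2) + p * ((A * B)\<^sup>2 * (\<tau>\<^sup>2 * \<nu>\<^sup>2 / (A * B)))) / N\<^sup>2
     = 8 * p * (4 * (\<epsilon> * \<tau>\<^sup>2) + p * ((A * B * \<nu>\<^sup>2 / N\<^sup>2) * \<tau>\<^sup>2))"
    using pos by (simp add: \<epsilon>_def field_simps power2_eq_square)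
  also have "\<dots> \<le> 16 * p * (4 * (\<epsilon> * \<tau>\<^sup>2) + p * ((A * B * \<nu>\<^sup>2 / N\<^sup>2) * \<tau>\<^sup>2))"
    using p pos \<epsilon>0 by (intro mult_right_mono) auto
  also have "\<dots> \<le> 16 * p * (8 + 4 * p) * \<epsilon> * \<tau>\<^sup>2"
    using \<epsilon>0 ab by (intro main) auto
  finally show ?spectral .
qed

text \<open>Coherence enters through \<open>\<nu>\<close>, which will be \<mu>0 * r.\<close>

locale coherent_pair = orthonormal_pair +
  fixes \<nu> :: real
  assumes gu: "\<And>a. a < n1 \<Longrightarrow> gram r u a a \<le> \<nu> / real n1"
    and gv: "\<And>b. b < n2 \<Longrightarrow> gram r v b b \<le> \<nu> / real n2"
    and \<nu>_pos: "\<nu> > 0"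
begin

abbreviation "Idx \<equiv> {..<n1} \<times> {..<n2}"
abbreviation "m \<equiv> real (max n1 n2)"

definition mom_const :: "nat \<Rightarrow> real" where
  "mom_const p = 16 * real p * (8 + 4 * real p)"

lemma tker_diag: "x \<in> Idx \<Longrightarrow> tker r u v x x \<le> \<nu> / real n1 + \<nu> / real n2"
  using tker_diag_le[of "fst x" "snd x"] gu[of "fst x"] gv[of "snd x"] by auto

lemma card_Idx: "real (card Idx) = real n1 * real n2"
  by simp

lemma tame_entry: "tame \<nu> \<tau> W \<Longrightarrow> y \<in> Idx \<Longrightarrow> (W y)\<^sup>2 \<le> \<tau>\<^sup>2 * \<nu>\<^sup>2 / (real n1 * real n2)"
  by (simp only: tame_def)

lemma tame_proj: "tame \<nu> \<tau> W \<Longrightarrow> x \<in> Idx \<Longrightarrow> proj W x = W x"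
  by (simp only: tame_def)

text \<open>In the mean, row i of \<open>W\<close> is weighted by the squared entry (a, i) of P_U,
  apart from an extra term at i = a. These weights sum to |P_U e_a|^2, so the row norms of
  \<open>W\<close> govern the rows after the step.\<close>

lemma row_moment:
  assumes W: "tame \<nu> \<tau> W" and a: "a < n1" and N: "N > 0" and p: "p = Suc s"
    and \<epsilon>: "m * \<nu> / real N \<le> 1"
  shows "iid_avg Idx N (\<lambda>xs. (\<Sum>b<n2. (step xs W (a, b))\<^sup>2) ^ p)
    \<le> (real n2 + 1) * (mom_const p * (m * \<nu> / real N) * (\<tau>\<^sup>2 * \<nu> / real n1)) ^ p"
proof -
  let ?S = "{a} \<times> {..<n2}" and ?A = "real n1" and ?B = "real n2"
  have S: "(\<Sum>x\<in>?S. f x) = (\<Sum>b<n2. f (a, b))" for f :: "nat \<times> nat \<Rightarrow> real"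
    using sum.cartesian_product[of "\<lambda>a b. f (a, b)" "{..<n2}" "{a}"] by (simp add: case_prod_beta')
  have "iid_avg Idx N (\<lambda>xs. (\<Sum>x\<in>?S. (step xs W x)\<^sup>2) ^ p)
    \<le> (real (card ?S) + 1) * (16 * real p * (4 * (real (card Idx) / real N) * (\<tau>\<^sup>2 * \<nu> / ?A * (\<nu> / ?A + \<nu> / ?B))
      + real p * (real (card Idx) / real N)\<^sup>2 * (\<tau>\<^sup>2 * \<nu>\<^sup>2 / (?A * ?B) * (\<nu> / ?A + \<nu> / ?B)))) ^ p"
  proof (rule iid_avg_slice_moment[OF _ _ N p])
    show "?S \<subseteq> Idx" using a by auto
    show "proj W x = W x" if "x \<in> Idx" for x by (rule tame_proj[OF W that])
    have K: "(\<Sum>x\<in>?S. (tker r u v x (i, j))\<^sup>2) \<le> (gram r u a i)\<^sup>2 + of_bool (a = i) * (\<nu> / ?B)" if "j < n2" for i j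
      unfolding S using tker_row_sq_le[OF that, of a i] gv[OF that] by (auto split: if_splits)
    show "(W y)\<^sup>2 * (\<Sum>x\<in>?S. (tker r u v x y)\<^sup>2) \<le> \<tau>\<^sup>2 * \<nu>\<^sup>2 / (?A * ?B) * (\<nu> / ?A + \<nu> / ?B)" if yI: "y \<in> Idx" for y
    proof (rule mult_mono[OF tame_entry[OF W yI]])
      obtain i j where y: "y = (i, j)" "i < n1" "j < n2" using yI by auto
      have "(gram r u a i)\<^sup>2 \<le> gram r u a a * gram r u i i" by (rule gram_sq_le)
      \<comment> \<open>One of the two diagonal values is only bounded by 1, since the target is
        linear in \<open>\<nu>\<close>.\<close>
      also have "\<dots> \<le> 1 * (\<nu> / ?A)"
        using gram_diag_le_1[OF ou a] gu[OF y(2)] gram_diag_nonneg by (intro mult_mono) auto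
      finally have "(gram r u a i)\<^sup>2 \<le> \<nu> / ?A" by simp
      moreover have "of_bool (a = i) * (\<nu> / ?B) \<le> \<nu> / ?B" using \<nu>_pos by simp
      ultimately show "(\<Sum>x\<in>?S. (tker r u v x y)\<^sup>2) \<le> \<nu> / ?A + \<nu> / ?B"
        using K[OF y(3), of i] y by simp
    qed (auto simp: sum_nonneg)
    have "(\<Sum>y\<in>Idx. (W y)\<^sup>2 * (\<Sum>x\<in>?S. (tker r u v x y)\<^sup>2))
      \<le> (\<Sum>i<n1. \<Sum>j<n2. (W (i, j))\<^sup>2 * ((gram r u a i)\<^sup>2 + of_bool (a = i) * (\<nu> / ?B)))"
      unfolding sum.cartesian_product
    proof (rule sum_mono)
      fix y assume "y \<in> Idx"
      then obtain i j where y: "y = (i, j)" and il: "i < n1" and jl: "j < n2" by auto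
      show "(W y)\<^sup>2 * (\<Sum>x\<in>?S. (tker r u v x y)\<^sup>2)
          \<le> (case y of (i, j) \<Rightarrow> (W (i, j))\<^sup>2 * ((gram r u a i)\<^sup>2 + of_bool (a = i) * (\<nu> / ?B)))"
        unfolding y prod.case by (rule mult_left_mono[OF K[OF jl, of i]]) simp
    qed
    also have "\<dots> = (\<Sum>i<n1. ((gram r u a i)\<^sup>2 + of_bool (a = i) * (\<nu> / ?B)) * (\<Sum>j<n2. (W (i, j))\<^sup>2))"
      unfolding sum_distrib_left by (intro sum.cong refl mult.commute)
    also have "\<dots> \<le> (\<Sum>i<n1. ((gram r u a i)\<^sup>2 + of_bool (a = i) * (\<nu> / ?B)) * (\<tau>\<^sup>2 * \<nu> / ?A))"
      using W \<nu>_pos by (intro sum_mono mult_left_mono) (auto simp: tame_def)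
    also have "\<dots> = (\<tau>\<^sup>2 * \<nu> / ?A) * ((\<Sum>i<n1. gram r u a i * gram r u i a) + (\<Sum>i<n1. of_bool (a = i) * (\<nu> / ?B)))"
    proof -
      have sq: "(gram r u a i)\<^sup>2 = gram r u a i * gram r u i a" for i
        by (simp only: power2_eq_square gram_sym[of r u i a])
      show ?thesis unfolding sq sum_distrib_right[symmetric] sum.distrib by (rule mult.commute)
    qed
    also have "\<dots> = (\<tau>\<^sup>2 * \<nu> / ?A) * (gram r u a a + \<nu> / ?B)"
      using a by (simp only: gram_gram[OF ou] sum_delta_left)
    also have "\<dots> \<le> (\<tau>\<^sup>2 * \<nu> / ?A) * (\<nu> / ?A + \<nu> / ?B)"
      using gu[OF a] \<nu>_pos by (intro mult_left_mono) auto
    finally show "(\<Sum>y\<in>Idx. (W y)\<^sup>2 * (\<Sum>x\<in>?S. (tker r u v x y)\<^sup>2)) \<le> \<tau>\<^sup>2 * \<nu> / ?A * (\<nu> / ?A + \<nu> / ?B)" .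
  qed
  also have "\<dots> \<le> (real (card ?S) + 1) * (mom_const p * (m * \<nu> / real N) * (\<tau>\<^sup>2 * \<nu> / ?A)) ^ p"
    unfolding mom_const_def card_Idx
    using n1_pos n2_pos N \<nu>_pos \<epsilon>
    by (intro mult_left_mono power_mono moment_constants(1)) auto
  finally show ?thesis unfolding S by simp
qed

text \<open>The transpose of \<open>row_moment\<close>, with the dimensions exchanged in
  \<open>moment_constants\<close>.\<close>

lemma col_moment:
  assumes W: "tame \<nu> \<tau> W" and b: "b < n2" and N: "N > 0" and p: "p = Suc s"
    and \<epsilon>: "m * \<nu> / real N \<le> 1"
  shows "iid_avg Idx N (\<lambda>xs. (\<Sum>a<n1. (step xs W (a, b))\<^sup>2) ^ p)
    \<le> (real n1 + 1) * (mom_const p * (m * \<nu> / real N) * (\<tau>\<^sup>2 * \<nu> / real n2)) ^ p"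
proof -
  let ?S = "{..<n1} \<times> {b}" and ?A = "real n1" and ?B = "real n2"
  have S: "(\<Sum>x\<in>?S. f x) = (\<Sum>a<n1. f (a, b))" for f :: "nat \<times> nat \<Rightarrow> real"
    using sum.cartesian_product[of "\<lambda>a b. f (a, b)" "{b}" "{..<n1}"] by (simp add: case_prod_beta')
  have "iid_avg Idx N (\<lambda>xs. (\<Sum>x\<in>?S. (step xs W x)\<^sup>2) ^ p)
    \<le> (real (card ?S) + 1) * (16 * real p * (4 * (real (card Idx) / real N) * (\<tau>\<^sup>2 * \<nu> / ?B * (\<nu> / ?B + \<nu> / ?A))
      + real p * (real (card Idx) / real N)\<^sup>2 * (\<tau>\<^sup>2 * \<nu>\<^sup>2 / (?B * ?A) * (\<nu> / ?B + \<nu> / ?A)))) ^ p"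
  proof (rule iid_avg_slice_moment[OF _ _ N p])
    show "?S \<subseteq> Idx" using b by auto
    show "proj W x = W x" if "x \<in> Idx" for x by (rule tame_proj[OF W that])
    have K: "(\<Sum>x\<in>?S. (tker r u v x (i, j))\<^sup>2) \<le> (gram r v b j)\<^sup>2 + of_bool (b = j) * (\<nu> / ?A)" if "i < n1" for i j
      unfolding S using tker_col_sq_le[OF that, of b j] gu[OF that] by (auto split: if_splits)
    show "(W y)\<^sup>2 * (\<Sum>x\<in>?S. (tker r u v x y)\<^sup>2) \<le> \<tau>\<^sup>2 * \<nu>\<^sup>2 / (?B * ?A) * (\<nu> / ?B + \<nu> / ?A)" if yI: "y \<in> Idx" for y
    proof (rule mult_mono[OF tame_entry[OF W yI, unfolded mult.commute[of ?A ?B]]])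
      obtain i j where y: "y = (i, j)" "i < n1" "j < n2" using yI by auto
      have "(gram r v b j)\<^sup>2 \<le> gram r v b b * gram r v j j" by (rule gram_sq_le)
      also have "\<dots> \<le> 1 * (\<nu> / ?B)"
        using gram_diag_le_1[OF ov b] gv[OF y(3)] gram_diag_nonneg by (intro mult_mono) auto
      finally have "(gram r v b j)\<^sup>2 \<le> \<nu> / ?B" by simp
      moreover have "of_bool (b = j) * (\<nu> / ?A) \<le> \<nu> / ?A" using \<nu>_pos by simp
      ultimately show "(\<Sum>x\<in>?S. (tker r u v x y)\<^sup>2) \<le> \<nu> / ?B + \<nu> / ?A"
        using K[OF y(2), of j] y by simp
    qed (auto simp: sum_nonneg)
    have "(\<Sum>y\<in>Idx. (W y)\<^sup>2 * (\<Sum>x\<in>?S. (tker r u v x y)\<^sup>2))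
      \<le> (\<Sum>i<n1. \<Sum>j<n2. (W (i, j))\<^sup>2 * ((gram r v b j)\<^sup>2 + of_bool (b = j) * (\<nu> / ?A)))"
      unfolding sum.cartesian_product
    proof (rule sum_mono)
      fix y assume "y \<in> Idx"
      then obtain i j where y: "y = (i, j)" and il: "i < n1" and jl: "j < n2" by auto
      show "(W y)\<^sup>2 * (\<Sum>x\<in>?S. (tker r u v x y)\<^sup>2)
          \<le> (case y of (i, j) \<Rightarrow> (W (i, j))\<^sup>2 * ((gram r v b j)\<^sup>2 + of_bool (b = j) * (\<nu> / ?A)))"
        unfolding y prod.case by (rule mult_left_mono[OF K[OF il, of j]]) simp
    qed
    also have "\<dots> = (\<Sum>j<n2. \<Sum>i<n1. (W (i, j))\<^sup>2 * ((gram r v b j)\<^sup>2 + of_bool (b = j) * (\<nu> / ?A)))"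
      by (rule sum.swap)
    also have "\<dots> = (\<Sum>j<n2. ((gram r v b j)\<^sup>2 + of_bool (b = j) * (\<nu> / ?A)) * (\<Sum>i<n1. (W (i, j))\<^sup>2))"
      unfolding sum_distrib_left by (intro sum.cong refl mult.commute)
    also have "\<dots> \<le> (\<Sum>j<n2. ((gram r v b j)\<^sup>2 + of_bool (b = j) * (\<nu> / ?A)) * (\<tau>\<^sup>2 * \<nu> / ?B))"
      using W \<nu>_pos by (intro sum_mono mult_left_mono) (auto simp: tame_def)
    also have "\<dots> = (\<tau>\<^sup>2 * \<nu> / ?B) * ((\<Sum>j<n2. gram r v b j * gram r v j b) + (\<Sum>j<n2. of_bool (b = j) * (\<nu> / ?A)))"
    proof -
      have sq: "(gram r v b j)\<^sup>2 = gram r v b j * gram r v j b" for j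
        by (simp only: power2_eq_square gram_sym[of r v j b])
      show ?thesis unfolding sq sum_distrib_right[symmetric] sum.distrib by (rule mult.commute)
    qed
    also have "\<dots> = (\<tau>\<^sup>2 * \<nu> / ?B) * (gram r v b b + \<nu> / ?A)"
      using b by (simp only: gram_gram[OF ov] sum_delta_left)
    also have "\<dots> \<le> (\<tau>\<^sup>2 * \<nu> / ?B) * (\<nu> / ?B + \<nu> / ?A)"
      using gv[OF b] \<nu>_pos by (intro mult_left_mono) auto
    finally show "(\<Sum>y\<in>Idx. (W y)\<^sup>2 * (\<Sum>x\<in>?S. (tker r u v x y)\<^sup>2)) \<le> \<tau>\<^sup>2 * \<nu> / ?B * (\<nu> / ?B + \<nu> / ?A)" .
  qed
  also have "\<dots> \<le> (real (card ?S) + 1) * (mom_const p * (m * \<nu> / real N) * (\<tau>\<^sup>2 * \<nu> / ?B)) ^ p"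
    unfolding mom_const_def card_Idx mult.commute[of ?A ?B]
    using n1_pos n2_pos N \<nu>_pos \<epsilon>
    by (intro mult_left_mono power_mono moment_constants(1)) auto
  finally show ?thesis unfolding S by simp
qed

text \<open>The squared kernel row at x sums to its diagonal value, and each of its entries is
  bounded by diagonal values; with the entry bound on \<open>W\<close> this gives both mean and
  maximum.\<close>

lemma entry_moment:
  assumes W: "tame \<nu> \<tau> W" and x: "x \<in> Idx" and N: "N > 0" and p: "p = Suc s"
    and \<epsilon>: "m * \<nu> / real N \<le> 1"
  shows "iid_avg Idx N (\<lambda>xs. ((step xs W x)\<^sup>2) ^ p)
    \<le> 2 * (mom_const p * (m * \<nu> / real N) * (\<tau>\<^sup>2 * \<nu>\<^sup>2 / (real n1 * real n2))) ^ p"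
proof -
  let ?A = "real n1" and ?B = "real n2"
  let ?k = "\<nu> / ?A + \<nu> / ?B" and ?t = "\<tau>\<^sup>2 * \<nu>\<^sup>2 / (real n1 * real n2)"
  have k0: "?k \<ge> 0" using \<nu>_pos by simp
  have "iid_avg Idx N (\<lambda>xs. (\<Sum>x\<in>{x}. (step xs W x)\<^sup>2) ^ p)
    \<le> (real (card {x}) + 1) * (16 * real p * (4 * (real (card Idx) / real N) * (?t * ?k)
      + real p * (real (card Idx) / real N)\<^sup>2 * (?t * ?k\<^sup>2))) ^ p"
  proof (rule iid_avg_slice_moment[OF _ _ N p])
    show "{x} \<subseteq> Idx" using x by auto
    show "proj W x = W x" if "x \<in> Idx" for x by (rule tame_proj[OF W that])
    show "(W y)\<^sup>2 * (\<Sum>x\<in>{x}. (tker r u v x y)\<^sup>2) \<le> ?t * ?k\<^sup>2" if y: "y \<in> Idx" for y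
    proof -
      have "(tker r u v x y)\<^sup>2 \<le> tker r u v x x * tker r u v y y" by (rule K_sq_le[OF x y])
      also have "\<dots> \<le> ?k * ?k"
        by (intro mult_mono tker_diag x y K_diag_nonneg k0)
      finally have "(tker r u v x y)\<^sup>2 \<le> ?k\<^sup>2" by (simp only: power2_eq_square)
      then have "(W y)\<^sup>2 * (tker r u v x y)\<^sup>2 \<le> ?t * ?k\<^sup>2"
        by (intro mult_mono tame_entry[OF W y]) auto
      then show ?thesis by simp
    qed
    have "(\<Sum>y\<in>Idx. (W y)\<^sup>2 * (\<Sum>x\<in>{x}. (tker r u v x y)\<^sup>2)) \<le> (\<Sum>y\<in>Idx. ?t * (tker r u v x y)\<^sup>2)"
    proof (rule sum_mono)
      fix y assume "y \<in> Idx"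
      from mult_right_mono[OF tame_entry[OF W this], of "(tker r u v x y)\<^sup>2"]
      show "(W y)\<^sup>2 * (\<Sum>x\<in>{x}. (tker r u v x y)\<^sup>2) \<le> ?t * (tker r u v x y)\<^sup>2" by simp
    qed
    also have "\<dots> = ?t * tker r u v x x" by (simp only: sum_distrib_left[symmetric] K_row_sq[OF x])
    also have "\<dots> \<le> ?t * ?k" by (intro mult_left_mono tker_diag x) auto
    finally show "(\<Sum>y\<in>Idx. (W y)\<^sup>2 * (\<Sum>x\<in>{x}. (tker r u v x y)\<^sup>2)) \<le> ?t * ?k" .
  qed
  also have "\<dots> \<le> (real (card {x}) + 1) * (mom_const p * (m * \<nu> / real N) * ?t) ^ p"
    unfolding mom_const_def card_Idx
    using n1_pos n2_pos N \<nu>_pos \<epsilon>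
    by (intro mult_left_mono power_mono moment_constants(2)) auto
  finally show ?thesis by simp
qed

text \<open>The error of sampling \<open>W\<close> is a centred sum of single-entry matrices divided
  by N, the setting of \<open>iid_moment_spectral\<close>. Row and column norms of \<open>W\<close>
  enter as the variance.\<close>

lemma spectral_moment:
  assumes W: "tame \<nu> \<tau> W" and N: "N > 0" and p: "p = Suc s"
    and \<epsilon>: "m * \<nu> / real N \<le> 1"
  obtains T where "\<And>xs. 0 \<le> T xs"
    "iid_avg Idx N T \<le> (real n1 + real n2) * (mom_const p * (m * \<nu> / real N) * \<tau>\<^sup>2) ^ p"
    "\<And>xs y. set xs \<subseteq> Idx \<Longrightarrow> length xs = N \<Longrightarrow>
       (\<Sum>i<n1. (\<Sum>j<n2. (samp xs W (i, j) - W (i, j)) * y j)\<^sup>2) ^ p \<le> T xs * (\<Sum>j<n2. (y j)\<^sup>2) ^ p"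
proof -
  let ?A = "real n1" and ?B = "real n2" and ?t = "\<tau>\<^sup>2 * \<nu>\<^sup>2 / (real n1 * real n2)"
  let ?c = "\<lambda>y. real (card Idx) * W y"
  have c0: "real (card Idx) > 0" by (rule card_pos)
  obtain T where T: "\<And>xs. 0 \<le> T xs"
    "iid_avg Idx N T \<le> real (card {..<n1} + card {..<n2}) * (8 * real p * (4 * real N * (m * \<nu> * \<tau>\<^sup>2)
        + real p * ((real (card Idx))\<^sup>2 * ?t))) ^ p"
    "\<And>xs y. (\<Sum>i<n1. (\<Sum>j<n2. cdev Idx (\<lambda>x. ?c x * of_bool (x = (i, j))) xs * y j)\<^sup>2) ^ p
        \<le> T xs * (\<Sum>j<n2. (y j)\<^sup>2) ^ p"
  proof (rule iid_moment_spectral[of "{..<n1}" "{..<n2}" ?c "(real (card Idx))\<^sup>2 * ?t" "m * \<nu> * \<tau>\<^sup>2" p s N])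
    show "{..<n1} \<noteq> {}" "{..<n2} \<noteq> {}" using n1_pos n2_pos by auto
    show "(?c x)\<^sup>2 \<le> (real (card Idx))\<^sup>2 * ?t" if "x \<in> Idx" for x
      unfolding power_mult_distrib by (intro mult_left_mono tame_entry[OF W that]) auto
    show "(\<Sum>j<n2. (?c (i, j))\<^sup>2) / real (card Idx) \<le> m * \<nu> * \<tau>\<^sup>2" if "i \<in> {..<n1}" for i
    proof -
      have "(\<Sum>j<n2. (?c (i, j))\<^sup>2) / real (card Idx) = real (card Idx) * (\<Sum>j<n2. (W (i, j))\<^sup>2)"
        using c0 by (simp only: power_mult_distrib sum_distrib_left[symmetric]) (simp add: power2_eq_square)
      also have "\<dots> \<le> real (card Idx) * (\<tau>\<^sup>2 * \<nu> / ?A)"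
        using W that by (intro mult_left_mono) (auto simp: tame_def)
      also have "\<dots> = ?B * (\<nu> * \<tau>\<^sup>2)" using n1_pos by simp
      also have "\<dots> \<le> m * (\<nu> * \<tau>\<^sup>2)" using \<nu>_pos by (intro mult_right_mono) auto
      finally show ?thesis by simp
    qed
    show "(\<Sum>i<n1. (?c (i, j))\<^sup>2) / real (card Idx) \<le> m * \<nu> * \<tau>\<^sup>2" if "j \<in> {..<n2}" for j
    proof -
      have "(\<Sum>i<n1. (?c (i, j))\<^sup>2) / real (card Idx) = real (card Idx) * (\<Sum>i<n1. (W (i, j))\<^sup>2)"
        using c0 by (simp only: power_mult_distrib sum_distrib_left[symmetric]) (simp add: power2_eq_square)
      also have "\<dots> \<le> real (card Idx) * (\<tau>\<^sup>2 * \<nu> / ?B)"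
        using W that by (intro mult_left_mono) (auto simp: tame_def)
      also have "\<dots> = ?A * (\<nu> * \<tau>\<^sup>2)" using n2_pos by simp
      also have "\<dots> \<le> m * (\<nu> * \<tau>\<^sup>2)" using \<nu>_pos by (intro mult_right_mono) auto
      finally show ?thesis by simp
    qed
  qed (use p in auto)
  show ?thesis
  proof (rule that[of "\<lambda>xs. (1 / (real N)\<^sup>2) ^ p * T xs"])
    show "0 \<le> (1 / (real N)\<^sup>2) ^ p * T xs" for xs using T(1) by simp
    have "iid_avg Idx N (\<lambda>xs. (1 / (real N)\<^sup>2) ^ p * T xs)
      \<le> (1 / (real N)\<^sup>2) ^ p * (real (card {..<n1} + card {..<n2}) * (8 * real p * (4 * real N * (m * \<nu> * \<tau>\<^sup>2)
        + real p * ((real (card Idx))\<^sup>2 * ?t))) ^ p)"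
      unfolding iid_avg_cmult by (rule mult_left_mono[OF T(2)]) simp
    also have "\<dots> = (?A + ?B) * (8 * real p * (4 * real N * (m * \<nu> * \<tau>\<^sup>2) + real p * ((?A * ?B)\<^sup>2 * ?t)) / (real N)\<^sup>2) ^ p"
      unfolding card_Idx by (simp add: power_divide)
    also have "\<dots> \<le> (?A + ?B) * (mom_const p * (m * \<nu> / real N) * \<tau>\<^sup>2) ^ p"
      unfolding mom_const_def using n1_pos n2_pos N \<nu>_pos \<epsilon>
      by (intro mult_left_mono power_mono moment_constants(3)) auto
    finally show "iid_avg Idx N (\<lambda>xs. (1 / (real N)\<^sup>2) ^ p * T xs) \<le> (?A + ?B) * (mom_const p * (m * \<nu> / real N) * \<tau>\<^sup>2) ^ p" .
    show "(\<Sum>i<n1. (\<Sum>j<n2. (samp xs W (i, j) - W (i, j)) * y j)\<^sup>2) ^ p \<le> (1 / (real N)\<^sup>2) ^ p * T xs * (\<Sum>j<n2. (y j)\<^sup>2) ^ p"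
      if xs: "set xs \<subseteq> Idx" "length xs = N" for xs y
    proof -
      have dev: "samp xs W x - W x = cdev Idx (\<lambda>y. ?c y * of_bool (y = x)) xs / real N" if "x \<in> Idx" for x
      proof -
        have s1: "(\<Sum>y\<in>Idx. ?c y * of_bool (y = x)) = ?c x"
          using that by (simp add: of_bool_def if_distrib[of "\<lambda>z. _ * z"] cong: if_cong)
        have m1: "(\<Sum>y\<in>Idx. ?c y * of_bool (y = x)) / real (card Idx) = W x"
          unfolding s1 by (rule nonzero_mult_div_cancel_left) (use c0 in linarith)
        have "sum_list (map (\<lambda>y. ?c y * of_bool (y = x)) xs) = real (card Idx) * sum_list (map (\<lambda>y. W y * of_bool (y = x)) xs)"
          by (simp only: mult.assoc sum_list_const_mult)
        then show ?thesis
          unfolding cdev_def m1 samp_eq_sum_list xs(2) using N by (simp only: diff_divide_distrib) simp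
      qed
      have "(\<Sum>j<n2. (samp xs W (i, j) - W (i, j)) * y j)
          = (\<Sum>j<n2. cdev Idx (\<lambda>x. ?c x * of_bool (x = (i, j))) xs * y j) / real N" if "i < n1" for i
        unfolding sum_divide_distrib using that by (intro sum.cong refl) (subst dev, auto)
      then have "(\<Sum>i<n1. (\<Sum>j<n2. (samp xs W (i, j) - W (i, j)) * y j)\<^sup>2)
        = 1 / (real N)\<^sup>2 * (\<Sum>i<n1. (\<Sum>j<n2. cdev Idx (\<lambda>x. ?c x * of_bool (x = (i, j))) xs * y j)\<^sup>2)"
        unfolding sum_distrib_left by (intro sum.cong refl) (simp only: power_divide lessThan_iff, simp)
      then have "(\<Sum>i<n1. (\<Sum>j<n2. (samp xs W (i, j) - W (i, j)) * y j)\<^sup>2) ^ p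
        = (1 / (real N)\<^sup>2) ^ p * (\<Sum>i<n1. (\<Sum>j<n2. cdev Idx (\<lambda>x. ?c x * of_bool (x = (i, j))) xs * y j)\<^sup>2) ^ p"
        by (simp only: power_mult_distrib)
      also have "\<dots> \<le> (1 / (real N)\<^sup>2) ^ p * (T xs * (\<Sum>j<n2. (y j)\<^sup>2) ^ p)"
        by (intro mult_left_mono T(3)) auto
      finally show ?thesis by (simp only: mult.assoc)
    qed
  qed
qed

end

section \<open>Golfing\<close>

context coherent_pair
begin

definition good_step :: "real \<Rightarrow> real \<Rightarrow> (nat \<times> nat) list \<Rightarrow> (nat \<times> nat \<Rightarrow> real) \<Rightarrow> bool" where
  "good_step \<delta> \<tau> xs W \<longleftrightarrow> tame \<nu> (\<delta> * \<tau>) (step xs W) \<and>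
     (\<forall>y. (\<Sum>i<n1. (\<Sum>j<n2. (samp xs W (i, j) - W (i, j)) * y j)\<^sup>2) \<le> (\<delta> * \<tau>)\<^sup>2 * (\<Sum>j<n2. (y j)\<^sup>2))"

text \<open>All bounds are tested at once: each quantity is raised to the power p, divided by its
  allowed value and summed, so that an expected sum of at most 1/2 suffices.\<close>

lemma good_step_prob:
  assumes W: "tame \<nu> \<tau> W" and \<tau>: "\<tau> > 0" and \<delta>: "\<delta> > 0" and N: "N > 0" and p: "p = Suc s"
    and \<epsilon>: "m * \<nu> / real N \<le> 1"
    and small: "8 * m\<^sup>2 * (mom_const p * (m * \<nu> / real N) / \<delta>\<^sup>2) ^ p \<le> 1 / 2"
  shows "iid_avg Idx N (\<lambda>xs. of_bool (good_step \<delta> \<tau> xs W)) \<ge> 1 / 2"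
proof -
  let ?A = "real n1" and ?B = "real n2"
  define z where "z = mom_const p * (m * \<nu> / real N)"
  define \<eta> where "\<eta> = (z / \<delta>\<^sup>2) ^ p"
  define tr where "tr = \<tau>\<^sup>2 * \<nu> / ?A"
  define tc where "tc = \<tau>\<^sup>2 * \<nu> / ?B"
  define te where "te = \<tau>\<^sup>2 * \<nu>\<^sup>2 / (?A * ?B)"
  have pos: "tr > 0" "tc > 0" "te > 0" using \<tau> \<nu>_pos n1_pos n2_pos by (auto simp: tr_def tc_def te_def)
  have \<eta>0: "\<eta> \<ge> 0" using \<nu>_pos by (simp add: \<eta>_def z_def mom_const_def)
  obtain T where T: "\<And>xs. 0 \<le> T xs" "iid_avg Idx N T \<le> (?A + ?B) * (z * \<tau>\<^sup>2) ^ p"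
    "\<And>xs y. set xs \<subseteq> Idx \<Longrightarrow> length xs = N \<Longrightarrow>
       (\<Sum>i<n1. (\<Sum>j<n2. (samp xs W (i, j) - W (i, j)) * y j)\<^sup>2) ^ p \<le> T xs * (\<Sum>j<n2. (y j)\<^sup>2) ^ p"
    by (rule spectral_moment[OF W N p \<epsilon>, folded z_def]) (rule that; assumption)
  define F1 where "F1 xs = (\<Sum>a<n1. (\<Sum>b<n2. (step xs W (a, b))\<^sup>2) ^ p / (\<delta>\<^sup>2 * tr) ^ p)" for xs
  define F2 where "F2 xs = (\<Sum>b<n2. (\<Sum>a<n1. (step xs W (a, b))\<^sup>2) ^ p / (\<delta>\<^sup>2 * tc) ^ p)" for xs
  define F3 where "F3 xs = (\<Sum>x\<in>Idx. ((step xs W x)\<^sup>2) ^ p / (\<delta>\<^sup>2 * te) ^ p)" for xs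
  define F4 where "F4 xs = T xs / (\<delta>\<^sup>2 * \<tau>\<^sup>2) ^ p" for xs
  have nonneg: "F1 xs \<ge> 0" "F2 xs \<ge> 0" "F3 xs \<ge> 0" "F4 xs \<ge> 0" for xs
    using pos T(1) by (auto simp: F1_def F2_def F3_def F4_def intro!: sum_nonneg divide_nonneg_nonneg zero_le_power[of _ p])
  have ratio: "(z * t) ^ p / (\<delta>\<^sup>2 * t) ^ p = \<eta>" if "t > 0" for t
    using that by (simp add: \<eta>_def power_divide[symmetric])
  have E1: "iid_avg Idx N F1 \<le> ?A * ((?B + 1) * \<eta>)"
  proof -
    have "iid_avg Idx N F1 = (\<Sum>a<n1. iid_avg Idx N (\<lambda>xs. (\<Sum>b<n2. (step xs W (a, b))\<^sup>2) ^ p) / (\<delta>\<^sup>2 * tr) ^ p)"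
      unfolding F1_def iid_avg_sum iid_avg_divide ..
    also have "\<dots> \<le> (\<Sum>a<n1. (?B + 1) * (z * tr) ^ p / (\<delta>\<^sup>2 * tr) ^ p)"
      using \<nu>_pos unfolding z_def tr_def
      by (intro sum_mono divide_right_mono row_moment[OF W _ N p \<epsilon>]) (auto intro!: zero_le_power[of _ p])
    also have "\<dots> = ?A * ((?B + 1) * \<eta>)"
      unfolding times_divide_eq_right[symmetric] ratio[OF pos(1)] by simp
    finally show ?thesis .
  qed
  have E2: "iid_avg Idx N F2 \<le> ?B * ((?A + 1) * \<eta>)"
  proof -
    have "iid_avg Idx N F2 = (\<Sum>b<n2. iid_avg Idx N (\<lambda>xs. (\<Sum>a<n1. (step xs W (a, b))\<^sup>2) ^ p) / (\<delta>\<^sup>2 * tc) ^ p)"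
      unfolding F2_def iid_avg_sum iid_avg_divide ..
    also have "\<dots> \<le> (\<Sum>b<n2. (?A + 1) * (z * tc) ^ p / (\<delta>\<^sup>2 * tc) ^ p)"
      using \<nu>_pos unfolding z_def tc_def
      by (intro sum_mono divide_right_mono col_moment[OF W _ N p \<epsilon>]) (auto intro!: zero_le_power[of _ p])
    also have "\<dots> = ?B * ((?A + 1) * \<eta>)"
      unfolding times_divide_eq_right[symmetric] ratio[OF pos(2)] by simp
    finally show ?thesis .
  qed
  have E3: "iid_avg Idx N F3 \<le> ?A * ?B * (2 * \<eta>)"
  proof -
    have "iid_avg Idx N F3 = (\<Sum>x\<in>Idx. iid_avg Idx N (\<lambda>xs. ((step xs W x)\<^sup>2) ^ p) / (\<delta>\<^sup>2 * te) ^ p)"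
      unfolding F3_def iid_avg_sum iid_avg_divide ..
    also have "\<dots> \<le> (\<Sum>x\<in>Idx. 2 * (z * te) ^ p / (\<delta>\<^sup>2 * te) ^ p)"
      using \<nu>_pos unfolding z_def te_def
      by (intro sum_mono divide_right_mono entry_moment[OF W _ N p \<epsilon>]) (auto intro!: zero_le_power[of _ p])
    also have "\<dots> = ?A * ?B * (2 * \<eta>)"
      unfolding times_divide_eq_right[symmetric] ratio[OF pos(3)] by simp
    finally show ?thesis .
  qed
  have E4: "iid_avg Idx N F4 \<le> (?A + ?B) * \<eta>"
  proof -
    have "iid_avg Idx N F4 \<le> (?A + ?B) * (z * \<tau>\<^sup>2) ^ p / (\<delta>\<^sup>2 * \<tau>\<^sup>2) ^ p"
      unfolding F4_def iid_avg_divide by (intro divide_right_mono T(2)) simp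
    also have "\<dots> = (?A + ?B) * \<eta>"
      unfolding times_divide_eq_right[symmetric] using \<tau> by (subst ratio) auto
    finally show ?thesis .
  qed
  have AB: "1 \<le> ?A" "1 \<le> ?B" "?A \<le> m" "?B \<le> m" using n1_pos n2_pos by auto
  \<comment> \<open>The dimension factors add up to 4 n1 n2 + 2 n1 + 2 n2 \<le> 8 m^2.\<close>
  have "iid_avg Idx N (\<lambda>xs. F1 xs + F2 xs + F3 xs + F4 xs) \<le> 8 * m\<^sup>2 * \<eta>"
  proof -
    have ab: "?A * ?B \<le> m\<^sup>2" "?A \<le> m\<^sup>2" "?B \<le> m\<^sup>2"
      using AB mult_mono[of ?A m ?B m] mult_mono[of ?A m 1 m] mult_mono[of ?B m 1 m]
      by (auto simp: power2_eq_square)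
    have "iid_avg Idx N (\<lambda>xs. F1 xs + F2 xs + F3 xs + F4 xs)
      \<le> ?A * ((?B + 1) * \<eta>) + ?B * ((?A + 1) * \<eta>) + ?A * ?B * (2 * \<eta>) + (?A + ?B) * \<eta>"
      unfolding iid_avg_add using E1 E2 E3 E4 by linarith
    also have "\<dots> = (4 * (?A * ?B) + 2 * ?A + 2 * ?B) * \<eta>" by (simp add: algebra_simps)
    also have "\<dots> \<le> (8 * m\<^sup>2) * \<eta>" using ab by (intro mult_right_mono \<eta>0) linarith
    finally show ?thesis .
  qed
  also have "\<dots> \<le> 1 / 2" using small by (simp only: \<eta>_def z_def)
  finally have avg: "iid_avg Idx N (\<lambda>xs. F1 xs + F2 xs + F3 xs + F4 xs) \<le> 1 / 2" .
  have "1 - 1 / 2 \<le> iid_avg Idx N (\<lambda>xs. of_bool (good_step \<delta> \<tau> xs W))"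
  proof (rule iid_avg_markov[OF finite nonempty _ _ avg])
    show "0 \<le> F1 xs + F2 xs + F3 xs + F4 xs" for xs using nonneg by simp
    fix xs assume xs: "set xs \<subseteq> Idx" "length xs = N" and less: "F1 xs + F2 xs + F3 xs + F4 xs < 1"
    have le: "q \<le> t" if "q ^ p / t ^ p < 1" "t > 0" for q t :: real
    proof -
      have "q ^ p < t ^ p" using that by simp
      then have "q < t" by (rule power_less_imp_less_base) (use that in simp)
      then show ?thesis by simp
    qed
    have row: "(\<Sum>b<n2. (step xs W (a, b))\<^sup>2) \<le> \<delta>\<^sup>2 * tr" if "a < n1" for a
    proof (rule le)
      have "(\<Sum>b<n2. (step xs W (a, b))\<^sup>2) ^ p / (\<delta>\<^sup>2 * tr) ^ p \<le> F1 xs"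
        unfolding F1_def using that pos
        by (intro member_le_sum[of a "{..<n1}" "\<lambda>a. (\<Sum>b<n2. (step xs W (a, b))\<^sup>2) ^ p / (\<delta>\<^sup>2 * tr) ^ p"])
          (auto intro!: divide_nonneg_nonneg sum_nonneg zero_le_power[of _ p])
      then show "(\<Sum>b<n2. (step xs W (a, b))\<^sup>2) ^ p / (\<delta>\<^sup>2 * tr) ^ p < 1" using less nonneg[of xs] by linarith
    qed (use \<delta> pos in auto)
    have col: "(\<Sum>a<n1. (step xs W (a, b))\<^sup>2) \<le> \<delta>\<^sup>2 * tc" if "b < n2" for b
    proof (rule le)
      have "(\<Sum>a<n1. (step xs W (a, b))\<^sup>2) ^ p / (\<delta>\<^sup>2 * tc) ^ p \<le> F2 xs"
        unfolding F2_def using that pos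
        by (intro member_le_sum[of b "{..<n2}" "\<lambda>b. (\<Sum>a<n1. (step xs W (a, b))\<^sup>2) ^ p / (\<delta>\<^sup>2 * tc) ^ p"])
          (auto intro!: divide_nonneg_nonneg sum_nonneg zero_le_power[of _ p])
      then show "(\<Sum>a<n1. (step xs W (a, b))\<^sup>2) ^ p / (\<delta>\<^sup>2 * tc) ^ p < 1" using less nonneg[of xs] by linarith
    qed (use \<delta> pos in auto)
    have entry: "(step xs W x)\<^sup>2 \<le> \<delta>\<^sup>2 * te" if "x \<in> Idx" for x
    proof (rule le)
      have "((step xs W x)\<^sup>2) ^ p / (\<delta>\<^sup>2 * te) ^ p \<le> F3 xs"
        unfolding F3_def using that pos finite
        by (intro member_le_sum[of x Idx "\<lambda>x. ((step xs W x)\<^sup>2) ^ p / (\<delta>\<^sup>2 * te) ^ p"])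
          (auto intro!: divide_nonneg_nonneg zero_le_power[of _ p])
      then show "((step xs W x)\<^sup>2) ^ p / (\<delta>\<^sup>2 * te) ^ p < 1" using less nonneg[of xs] by linarith
    qed (use \<delta> pos in auto)
    have "proj (step xs W) x = step xs W x" if "x \<in> Idx" for x
    proof -
      have "step xs W = (\<lambda>x. proj (\<lambda>x. W x - samp xs (proj W) x) x)"
        by (simp only: step_def proj_diff fun_eq_iff simp_thms)
      then show ?thesis using proj_proj[OF that] by simp
    qed
    then have "tame \<nu> (\<delta> * \<tau>) (step xs W)"
      unfolding tame_def using row col entry
      by (simp only: power_mult_distrib tr_def tc_def te_def times_divide_eq_right mult.assoc) blast
    moreover have "(\<Sum>i<n1. (\<Sum>j<n2. (samp xs W (i, j) - W (i, j)) * y j)\<^sup>2) \<le> (\<delta> * \<tau>)\<^sup>2 * (\<Sum>j<n2. (y j)\<^sup>2)" for y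
    proof -
      let ?q = "\<Sum>i<n1. (\<Sum>j<n2. (samp xs W (i, j) - W (i, j)) * y j)\<^sup>2" and ?n = "\<Sum>j<n2. (y j)\<^sup>2"
      have n0: "?n \<ge> 0" by (simp add: sum_nonneg)
      have "F4 xs < 1" using less nonneg[of xs] by linarith
      then have "T xs \<le> (\<delta>\<^sup>2 * \<tau>\<^sup>2) ^ p" using \<tau> \<delta> by (simp add: F4_def divide_less_eq)
      then have "?q ^ p \<le> (\<delta>\<^sup>2 * \<tau>\<^sup>2) ^ p * ?n ^ p"
        using T(3)[OF xs, of y] n0 by (meson mult_right_mono order_trans zero_le_power)
      then have "?q ^ Suc s \<le> ((\<delta> * \<tau>)\<^sup>2 * ?n) ^ Suc s" by (simp only: p power_mult_distrib)
      then show ?thesis by (rule power_le_imp_le_base) (simp add: n0)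
    qed
    ultimately show "good_step \<delta> \<tau> xs W" by (simp add: good_step_def)
  qed
  then show ?thesis by simp
qed

primrec golfing :: "real \<Rightarrow> nat \<Rightarrow> nat \<Rightarrow> real \<Rightarrow> (nat \<times> nat) list \<Rightarrow> (nat \<times> nat \<Rightarrow> real) \<Rightarrow> bool" where
  "golfing \<delta> N 0 \<tau> xs W \<longleftrightarrow> True"
| "golfing \<delta> N (Suc L) \<tau> xs W \<longleftrightarrow> good_step \<delta> \<tau> (take N xs) W \<and>
     golfing \<delta> N L (\<delta> * \<tau>) (drop N xs) (step (take N xs) W)"

text \<open>Given the earlier groups, the current residual is a fixed tame matrix and its group is
  fresh, so each step succeeds with conditional probability at least 1/2.\<close>

lemma golfing_prob:
  assumes W: "tame \<nu> \<tau> W" and \<tau>: "\<tau> > 0" and \<delta>: "\<delta> > 0" and N: "N > 0" and p: "p = Suc s"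
    and \<epsilon>: "m * \<nu> / real N \<le> 1"
    and small: "8 * m\<^sup>2 * (mom_const p * (m * \<nu> / real N) / \<delta>\<^sup>2) ^ p \<le> 1 / 2"
  shows "iid_avg Idx (L * N) (\<lambda>xs. of_bool (golfing \<delta> N L \<tau> xs W)) \<ge> (1 / 2) ^ L"
  using W \<tau>
proof (induction L arbitrary: W \<tau>)
  case (Suc L)
  have "(1 / 2) ^ Suc L \<le> (1 / 2) ^ L * iid_avg Idx N (\<lambda>xs. of_bool (good_step \<delta> \<tau> xs W))"
    using good_step_prob[OF Suc.prems \<delta> N p \<epsilon> small] by (simp add: mult.commute)
  also have "\<dots> = iid_avg Idx N (\<lambda>xs. (1 / 2) ^ L * of_bool (good_step \<delta> \<tau> xs W))"
    by (rule iid_avg_cmult[symmetric])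
  also have "\<dots> \<le> iid_avg Idx N (\<lambda>xs. iid_avg Idx (L * N) (\<lambda>ys. of_bool (golfing \<delta> N (Suc L) \<tau> (xs @ ys) W)))"
  proof (rule iid_avg_mono)
    fix xs assume xs: "set xs \<subseteq> Idx" "length xs = N"
    show "(1 / 2) ^ L * of_bool (good_step \<delta> \<tau> xs W) \<le> iid_avg Idx (L * N) (\<lambda>ys. of_bool (golfing \<delta> N (Suc L) \<tau> (xs @ ys) W))"
    proof (cases "good_step \<delta> \<tau> xs W")
      case True
      then have "tame \<nu> (\<delta> * \<tau>) (step xs W)" by (simp add: good_step_def)
      then show ?thesis using Suc.IH[of "\<delta> * \<tau>" "step xs W"] Suc.prems \<delta> xs True by simp
    next
      case False
      then show ?thesis using xs iid_avg_const[OF finite nonempty, of "L * N" 0] by simp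
    qed
  qed
  also have "\<dots> = iid_avg Idx (Suc L * N) (\<lambda>xs. of_bool (golfing \<delta> N (Suc L) \<tau> xs W))"
    unfolding mult_Suc iid_avg_append ..
  finally show ?case .
qed simp

section \<open>Rank-one matrices, the tangent space and the dual certificate\<close>

lemma proj_tensor:
  assumes "x \<in> Idx"
  shows "proj (\<lambda>y. a (fst y) * b (snd y)) x = (\<Sum>i<n1. gram r u (fst x) i * a i) * b (snd x)
    + (a (fst x) - (\<Sum>i<n1. gram r u (fst x) i * a i)) * (\<Sum>j<n2. gram r v (snd x) j * b j)"
proof -
  have "proj (\<lambda>y. a (fst y) * b (snd y)) x
    = (\<Sum>y\<in>Idx. (gram r u (fst x) (fst y) * a (fst y)) * (of_bool (snd x = snd y) * b (snd y))
        + (gperp r u (fst x) (fst y) * a (fst y)) * (gram r v (snd x) (snd y) * b (snd y)))"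
    unfolding proj_def tker_def by (intro sum.cong refl) (simp add: algebra_simps)
  also have "\<dots> = (\<Sum>i<n1. gram r u (fst x) i * a i) * (\<Sum>j<n2. of_bool (snd x = j) * b j)
      + (\<Sum>i<n1. gperp r u (fst x) i * a i) * (\<Sum>j<n2. gram r v (snd x) j * b j)"
    unfolding sum.distrib sum_tensor[of "\<lambda>i. gram r u (fst x) i * a i" "\<lambda>j. of_bool (snd x = j) * b j"]
      sum_tensor[of "\<lambda>i. gperp r u (fst x) i * a i" "\<lambda>j. gram r v (snd x) j * b j"] ..
  finally show ?thesis
    using assms by (auto simp: gperp_def left_diff_distrib sum_subtractf sum_delta_left)
qed

lemma proj_tensor_left:
  assumes "k < r" "x \<in> Idx"
  shows "proj (\<lambda>y. u k (fst y) * b (snd y)) x = u k (fst x) * b (snd x)"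
  unfolding proj_tensor[OF assms(2)] gram_apply_basis[OF ou assms(1)] by simp

lemma proj_tensor_right:
  assumes "k < r" "x \<in> Idx"
  shows "proj (\<lambda>y. a (fst y) * v k (snd y)) x = a (fst x) * v k (snd x)"
  unfolding proj_tensor[OF assms(2)] gram_apply_basis[OF ov assms(1)] by (simp add: algebra_simps)

text \<open>a b^T with a orthogonal to U and b orthogonal to V projects to 0, and the projection is
  self-adjoint.\<close>

lemma tangent_annihilates_perp:
  assumes W: "\<And>x. x \<in> Idx \<Longrightarrow> proj W x = W x"
    and a: "\<And>k. k < r \<Longrightarrow> (\<Sum>i<n1. u k i * a i) = 0" and b: "\<And>k. k < r \<Longrightarrow> (\<Sum>j<n2. v k j * b j) = 0"
  shows "(\<Sum>x\<in>Idx. a (fst x) * W x * b (snd x)) = 0"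
proof -
  have "proj (\<lambda>x. a (fst x) * b (snd x)) x = 0" if "x \<in> Idx" for x
    unfolding proj_tensor[OF that] using a b by (simp add: gram_apply)
  then have "(\<Sum>x\<in>Idx. W x * proj (\<lambda>x. a (fst x) * b (snd x)) x) = 0" by (auto intro!: sum.neutral)
  then have "(\<Sum>x\<in>Idx. proj W x * (a (fst x) * b (snd x))) = 0" unfolding proj_self_adjoint .
  also have "(\<Sum>x\<in>Idx. proj W x * (a (fst x) * b (snd x))) = (\<Sum>x\<in>Idx. a (fst x) * W x * b (snd x))"
    using W by (intro sum.cong refl) (simp only: mult_ac)
  finally show ?thesis .
qed

lemma bilinear_le:
  fixes A :: "nat \<times> nat \<Rightarrow> real"
  assumes "\<And>y. (\<Sum>i<n1. (\<Sum>j<n2. A (i, j) * y j)\<^sup>2) \<le> \<theta>\<^sup>2 * (\<Sum>j<n2. (y j)\<^sup>2)" "\<theta> \<ge> 0"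
    and a: "(\<Sum>i<n1. (a i)\<^sup>2) = 1" and b: "(\<Sum>j<n2. (b j)\<^sup>2) = 1"
  shows "\<bar>\<Sum>x\<in>Idx. a (fst x) * A x * b (snd x)\<bar> \<le> \<theta>"
proof -
  have "(\<Sum>x\<in>Idx. a (fst x) * A x * b (snd x)) = (\<Sum>i<n1. \<Sum>j<n2. a i * A (i, j) * b j)"
    by (simp add: sum.cartesian_product case_prod_beta')
  also have "\<dots> = (\<Sum>i<n1. a i * (\<Sum>j<n2. A (i, j) * b j))"
    by (simp only: sum_distrib_left mult.assoc)
  finally have "(\<Sum>x\<in>Idx. a (fst x) * A x * b (snd x))\<^sup>2 \<le> (\<Sum>i<n1. (a i)\<^sup>2) * (\<Sum>i<n1. (\<Sum>j<n2. A (i, j) * b j)\<^sup>2)"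
    by (simp only: Cauchy_Schwarz_ineq_sum)
  also have "\<dots> \<le> \<theta>\<^sup>2" using assms(1)[of b] by (simp add: a b)
  finally show ?thesis using assms(2) by (simp add: abs_le_square_iff[symmetric])
qed

text \<open>\<open>Y\<close> is the sum of the sampled residuals R W of all rounds, so W - P Y
  telescopes to the last residual. Against a pair orthogonal to U and V a residual W contributes
  nothing, being tangent; R W may thus be replaced by R W - W, and the bounds \<delta> \<tau>,
  \<delta>^2 \<tau>, ... sum to at most \<tau> / 2.\<close>

lemma golfing_certificate:
  assumes "golfing \<delta> N L \<tau> xs W" "tame \<nu> \<tau> W" "length xs = L * N" "0 \<le> \<tau>" "0 \<le> \<delta>" "\<delta> \<le> 1 / 4"
  shows "\<exists>Y. (\<forall>x. x \<notin> set xs \<longrightarrow> Y x = 0) \<and> tame \<nu> (\<delta> ^ L * \<tau>) (\<lambda>x. W x - proj Y x) \<and>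
    (\<forall>a b. (\<Sum>i<n1. (a i)\<^sup>2) = 1 \<longrightarrow> (\<Sum>j<n2. (b j)\<^sup>2) = 1 \<longrightarrow>
       (\<forall>k<r. (\<Sum>i<n1. u k i * a i) = 0) \<longrightarrow> (\<forall>k<r. (\<Sum>j<n2. v k j * b j) = 0) \<longrightarrow>
       \<bar>\<Sum>x\<in>Idx. a (fst x) * Y x * b (snd x)\<bar> \<le> \<tau> / 2)"
  using assms(1-4)
proof (induction L arbitrary: xs W \<tau>)
  case 0
  then show ?case by (intro exI[of _ "\<lambda>x. 0"]) (simp add: proj_def)
next
  case (Suc L)
  let ?ys = "take N xs" and ?zs = "drop N xs"
  have good: "good_step \<delta> \<tau> ?ys W" and golf: "golfing \<delta> N L (\<delta> * \<tau>) ?zs (step ?ys W)"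
    using Suc.prems(1) by auto
  have tame: "tame \<nu> (\<delta> * \<tau>) (step ?ys W)" using good by (simp add: good_step_def)
  have len: "length ?zs = L * N" using Suc.prems(3) by simp
  have \<delta>\<tau>: "0 \<le> \<delta> * \<tau>" using Suc.prems(4) assms(5) by simp
  obtain Y where Y: "\<forall>x. x \<notin> set ?zs \<longrightarrow> Y x = 0" "tame \<nu> (\<delta> ^ L * (\<delta> * \<tau>)) (\<lambda>x. step ?ys W x - proj Y x)"
    "\<forall>a b. (\<Sum>i<n1. (a i)\<^sup>2) = 1 \<longrightarrow> (\<Sum>j<n2. (b j)\<^sup>2) = 1 \<longrightarrow>
     (\<forall>k<r. (\<Sum>i<n1. u k i * a i) = 0) \<longrightarrow> (\<forall>k<r. (\<Sum>j<n2. v k j * b j) = 0) \<longrightarrow>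
     \<bar>\<Sum>x\<in>Idx. a (fst x) * Y x * b (snd x)\<bar> \<le> \<delta> * \<tau> / 2"
    using Suc.IH[OF golf tame len \<delta>\<tau>] by blast
  have fixW: "proj W x = W x" if "x \<in> Idx" for x by (rule tame_proj[OF Suc.prems(2) that])
  define Y' where "Y' = (\<lambda>x. samp ?ys W x + Y x)"
  show ?case
  proof (intro exI[of _ Y'] conjI allI impI)
    show "Y' x = 0" if "x \<notin> set xs" for x
    proof -
      have "x \<notin> set ?ys" "x \<notin> set ?zs" using that in_set_takeD in_set_dropD by metis+
      moreover from this(2) have "Y x = 0" using Y(1) by blast
      ultimately show ?thesis by (simp add: Y'_def samp_def count_list_0_iff)
    qed
    have "W x - proj Y' x = step ?ys W x - proj Y x" if "x \<in> Idx" for x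
    proof -
      have "proj (samp ?ys (proj W)) = proj (samp ?ys W)"
        using fixW by (intro proj_cong samp_cong) auto
      moreover have "proj Y' x = proj (samp ?ys W) x + proj Y x"
        unfolding Y'_def by (rule proj_add)
      ultimately show ?thesis using fixW[OF that] by (simp add: step_def)
    qed
    then have eq: "\<And>x. x \<in> Idx \<Longrightarrow> W x - proj Y' x = step ?ys W x - proj Y x" .
    have "tame \<nu> t A \<longleftrightarrow> tame \<nu> t B" if "\<And>x. x \<in> Idx \<Longrightarrow> A x = B x" for t A B
      using that proj_cong[of A B] unfolding tame_def by (auto intro!: sum.cong)
    from this[OF eq, where t = "\<delta> ^ Suc L * \<tau>"] Y(2)
    show "tame \<nu> (\<delta> ^ Suc L * \<tau>) (\<lambda>x. W x - proj Y' x)" by (simp add: mult_ac)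
    fix a b assume na: "(\<Sum>i<n1. (a i)\<^sup>2) = 1" and nb: "(\<Sum>j<n2. (b j)\<^sup>2) = 1"
      and pa: "\<forall>k<r. (\<Sum>i<n1. u k i * a i) = 0" and pb: "\<forall>k<r. (\<Sum>j<n2. v k j * b j) = 0"
    let ?f = "\<lambda>A. \<Sum>x\<in>Idx. a (fst x) * A x * b (snd x)"
    have "?f Y' = ?f (\<lambda>x. samp ?ys W x - W x) + ?f W + ?f Y"
      unfolding sum.distrib[symmetric] by (intro sum.cong refl) (simp add: Y'_def algebra_simps)
    moreover have "?f W = 0" using tangent_annihilates_perp[OF fixW] pa pb by blast
    moreover have "\<bar>?f (\<lambda>x. samp ?ys W x - W x)\<bar> \<le> \<delta> * \<tau>"
      by (rule bilinear_le) (use good \<delta>\<tau> na nb in \<open>auto simp: good_step_def\<close>)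
    moreover have "\<bar>?f Y\<bar> \<le> \<delta> * \<tau> / 2" using Y(3) na nb pa pb by blast
    \<comment> \<open>One round gives \<delta> \<tau> + \<delta> \<tau> / 2 \<le> 3 \<tau> /
      8.\<close>
    moreover have "\<delta> * \<tau> \<le> 1 / 4 * \<tau>" using assms(6) Suc.prems(4) by (intro mult_right_mono)
    ultimately show "\<bar>?f Y'\<bar> \<le> \<tau> / 2" using Suc.prems(4) by linarith
  qed
qed

end

section \<open>Uniform random subsets and repeated batches\<close>

lemma exists_permutes_image:
  assumes "finite I" "A \<subseteq> I" "B \<subseteq> I" "card A = card B"
  obtains \<rho> where "\<rho> permutes I" "\<rho> ` A = B"
proof -
  have fin: "finite A" "finite B" using assms finite_subset by auto
  obtain f where f: "bij_betw f A B" using finite_same_card_bij[OF fin assms(4)] by blast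
  have "card (I - A) = card (I - B)" using assms fin by (simp add: card_Diff_subset)
  then obtain g where g: "bij_betw g (I - A) (I - B)"
    using finite_same_card_bij[of "I - A" "I - B"] assms(1) by blast
  define h where "h x = (if x \<in> A then f x else g x)" for x
  have hA: "bij_betw h A B" using f by (simp add: h_def cong: bij_betw_cong)
  have hI: "bij_betw h (I - A) (I - B)"
    using g by (rule bij_betw_cong[THEN iffD1, rotated]) (simp add: h_def)
  have "bij_betw h (A \<union> (I - A)) (B \<union> (I - B))" by (rule bij_betw_combine[OF hA hI]) auto
  then have hh: "bij_betw h I I" using assms by (simp add: Un_absorb1)
  define \<rho> where "\<rho> x = (if x \<in> I then h x else x)" for x
  have "bij_betw \<rho> I I" using hh by (simp add: \<rho>_def cong: bij_betw_cong)
  then have "\<rho> permutes I" by (rule bij_imp_permutes) (simp add: \<rho>_def)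
  moreover have "\<rho> ` A = h ` A" using assms by (intro image_cong) (auto simp: \<rho>_def)
  then have "\<rho> ` A = B" using hA by (simp add: bij_betw_def)
  ultimately show ?thesis by (rule that)
qed

lemma iid_avg_map:
  assumes "bij_betw \<pi> I I"
  shows "iid_avg I n (\<lambda>xs. F (map \<pi> xs)) = iid_avg I n F"
proof (induction n arbitrary: F)
  case (Suc n)
  have "(\<Sum>x\<in>I. iid_avg I n (\<lambda>xs. F (\<pi> x # map \<pi> xs))) = (\<Sum>x\<in>I. iid_avg I n (\<lambda>xs. F (\<pi> x # xs)))"
    by (intro sum.cong refl Suc)
  also have "\<dots> = (\<Sum>x\<in>I. iid_avg I n (\<lambda>xs. F (x # xs)))"
    by (rule sum.reindex_bij_betw[OF assms])
  finally show ?case by simp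
qed simp

text \<open>Apply a uniformly random permutation of \<open>I\<close>. It carries every m-subset to a
  uniform m-subset; the at most m distinct draws extend to an m-subset, and by \<open>mono\<close>
  the extension is only more favourable.\<close>

lemma iid_avg_le_uniform_subset:
  assumes I: "finite I" "I \<noteq> {}" and m: "m \<le> card I"
    and mono: "\<And>A B. A \<subseteq> B \<Longrightarrow> E A \<Longrightarrow> E B"
  shows "iid_avg I m (\<lambda>xs. of_bool (E (set xs)))
    \<le> real (card {A. A \<subseteq> I \<and> card A = m \<and> E A}) / real (card {A. A \<subseteq> I \<and> card A = m})"
proof -
  define Sub where "Sub = {A. A \<subseteq> I \<and> card A = m}"
  define Pm where "Pm = {\<pi>. \<pi> permutes I}"
  \<comment> \<open>The number of permutations carrying \<open>B\<close> to a set with property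
    \<open>E\<close>: monotone in \<open>B\<close> and constant on m-subsets.\<close>
  define s where "s B = (\<Sum>\<pi>\<in>Pm. of_bool (E (\<pi> ` B)) :: real)" for B
  have finSub: "finite Sub" using I by (simp add: Sub_def)
  have finP: "finite Pm" using I by (simp add: Pm_def finite_permutations)
  have "id \<in> Pm" by (simp add: Pm_def permutes_id)
  then have cP: "real (card Pm) > 0" using finP card_gt_0_iff by fastforce
  obtain B0 where B0: "B0 \<in> Sub" using obtain_subset_with_card_n[OF m] by (auto simp: Sub_def)
  then have cS: "real (card Sub) > 0" using finSub card_gt_0_iff by fastforce
  have s_const: "s B = s B0" if B: "B \<in> Sub" for B
  proof -
    obtain \<rho> where \<rho>: "\<rho> permutes I" "\<rho> ` B0 = B"
      using exists_permutes_image[of I B0 B] B B0 I by (auto simp: Sub_def)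
    have "bij_betw (\<lambda>\<pi>. \<pi> \<circ> \<rho>) Pm Pm"
    proof (rule bij_betw_byWitness[where f' = "\<lambda>\<pi>. \<pi> \<circ> inv \<rho>"])
      show "\<forall>\<pi>\<in>Pm. \<pi> \<circ> \<rho> \<circ> inv \<rho> = \<pi>" "\<forall>\<pi>\<in>Pm. \<pi> \<circ> inv \<rho> \<circ> \<rho> = \<pi>"
        using permutes_inv_o[OF \<rho>(1)] by (simp_all add: o_assoc[symmetric])
      show "(\<lambda>\<pi>. \<pi> \<circ> \<rho>) ` Pm \<subseteq> Pm" "(\<lambda>\<pi>. \<pi> \<circ> inv \<rho>) ` Pm \<subseteq> Pm"
        using \<rho>(1) by (auto simp: Pm_def intro: permutes_compose permutes_inv)
    qed
    from sum.reindex_bij_betw[OF this, of "\<lambda>\<pi>. of_bool (E (\<pi> ` B0)) :: real"]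
    moreover have "(\<pi> \<circ> \<rho>) ` B0 = \<pi> ` B" for \<pi> :: "'a \<Rightarrow> 'a" by (simp only: image_comp[symmetric] \<rho>(2))
    ultimately show ?thesis by (simp only: s_def)
  qed
  have "real (card Pm) * iid_avg I m (\<lambda>xs. of_bool (E (set xs)))
      = (\<Sum>\<pi>\<in>Pm. iid_avg I m (\<lambda>xs. of_bool (E (\<pi> ` set xs))))"
  proof -
    have "iid_avg I m (\<lambda>xs. of_bool (E (\<pi> ` set xs))) = iid_avg I m (\<lambda>xs. of_bool (E (set xs)))" if "\<pi> \<in> Pm" for \<pi>
    proof -
      have "bij_betw \<pi> I I" using that by (simp add: Pm_def permutes_imp_bij)
      from iid_avg_map[OF this, of m "\<lambda>xs. of_bool (E (set xs))"] show ?thesis by simp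
    qed
    then show ?thesis by simp
  qed
  also have "\<dots> = iid_avg I m (\<lambda>xs. s (set xs))" by (simp only: s_def iid_avg_sum)
  also have "\<dots> \<le> iid_avg I m (\<lambda>xs. s B0)"
  proof (rule iid_avg_mono)
    fix xs assume xs: "set xs \<subseteq> I" "length xs = m"
    have "card (set xs) \<le> m" using card_length[of xs] xs by simp
    then obtain B where B: "set xs \<subseteq> B" "B \<subseteq> I" "card B = m"
      using exists_subset_between[of "set xs" m I] xs m I by auto
    have "s (set xs) \<le> s B"
      unfolding s_def
    proof (rule sum_mono)
      fix \<pi>
      show "of_bool (E (\<pi> ` set xs)) \<le> (of_bool (E (\<pi> ` B)) :: real)"
        using mono[of "\<pi> ` set xs" "\<pi> ` B"] B(1) by (auto simp: image_mono)
    qed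
    then show "s (set xs) \<le> s B0" using s_const[of B] B by (simp add: Sub_def)
  qed
  also have "\<dots> = s B0" by (rule iid_avg_const[OF I])
  finally have le: "real (card Pm) * iid_avg I m (\<lambda>xs. of_bool (E (set xs))) \<le> s B0" .
  have "real (card Sub) * s B0 = (\<Sum>B\<in>Sub. s B)" by (simp add: s_const)
  also have "\<dots> = (\<Sum>\<pi>\<in>Pm. \<Sum>B\<in>Sub. of_bool (E (\<pi> ` B)))" unfolding s_def by (rule sum.swap)
  also have "\<dots> = (\<Sum>\<pi>\<in>Pm. \<Sum>B\<in>Sub. of_bool (E B))"
  proof (rule sum.cong[OF refl])
    fix \<pi> assume "\<pi> \<in> Pm"
    then have \<pi>: "\<pi> permutes I" by (simp add: Pm_def)
    have sub: "\<pi>' ` B \<in> Sub" if "\<pi>' permutes I" "B \<in> Sub" for \<pi>' B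
      using that permutes_image[OF that(1)] permutes_inj[OF that(1)]
      by (auto simp: Sub_def card_image inj_on_subset)
    have "bij_betw ((`) \<pi>) Sub Sub"
      using sub[OF \<pi>] sub[OF permutes_inv[OF \<pi>]] permutes_inv_o[OF \<pi>]
      by (intro bij_betw_byWitness[where f' = "(`) (inv \<pi>)"]) (auto simp: image_comp)
    then show "(\<Sum>B\<in>Sub. of_bool (E (\<pi> ` B)) :: real) = (\<Sum>B\<in>Sub. of_bool (E B))"
      by (rule sum.reindex_bij_betw)
  qed
  also have "\<dots> = real (card Pm) * real (card {A \<in> Sub. E A})"
    using finSub by (simp add: of_bool_def sum.If_cases Int_def)
  finally have "real (card Sub) * (real (card Pm) * iid_avg I m (\<lambda>xs. of_bool (E (set xs)))) \<le> real (card Pm) * real (card {A \<in> Sub. E A})"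
    using mult_left_mono[OF le, of "real (card Sub)"] cS by simp
  then have "iid_avg I m (\<lambda>xs. of_bool (E (set xs))) * real (card Sub) \<le> real (card {A \<in> Sub. E A})"
    using cP by (simp add: mult_ac)
  then have "iid_avg I m (\<lambda>xs. of_bool (E (set xs))) \<le> real (card {A \<in> Sub. E A}) / real (card Sub)"
    using cS by (simp add: pos_le_divide_eq)
  then show ?thesis by (simp add: Sub_def conj_assoc)
qed

text \<open>The event fails on a union of groups only if it fails on each of the k independent
  groups; the remaining m - k N draws can only help.\<close>

lemma iid_avg_amplify:
  assumes I: "finite I" "I \<noteq> {}" and mono: "\<And>A B. A \<subseteq> B \<Longrightarrow> E A \<Longrightarrow> E B"
    and \<theta>: "\<theta> \<le> iid_avg I N (\<lambda>xs. of_bool (E (set xs)))" "\<theta> \<le> 1" and m: "k * N \<le> m"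
  shows "iid_avg I m (\<lambda>xs. of_bool (E (set xs))) \<ge> 1 - (1 - \<theta>) ^ k"
proof -
  have neg: "iid_avg I n (\<lambda>xs. of_bool (\<not> P xs)) = 1 - iid_avg I n (\<lambda>xs. of_bool (P xs))" for n P
  proof -
    have "iid_avg I n (\<lambda>xs. of_bool (\<not> P xs) + of_bool (P xs)) = iid_avg I n (\<lambda>xs. 1)"
      by (intro iid_avg_cong) auto
    then show ?thesis unfolding iid_avg_add iid_avg_const[OF I] by simp
  qed
  have "iid_avg I (k * N) (\<lambda>xs. of_bool (\<not> E (set xs))) \<le> (1 - \<theta>) ^ k"
  proof (induction k)
    case 0
    then show ?case by simp
  next
    case (Suc k)
    have "iid_avg I (Suc k * N) (\<lambda>xs. of_bool (\<not> E (set xs)))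
      = iid_avg I N (\<lambda>xs. iid_avg I (k * N) (\<lambda>ys. of_bool (\<not> E (set xs \<union> set ys))))"
      unfolding mult_Suc iid_avg_append set_append ..
    also have "\<dots> \<le> iid_avg I N (\<lambda>xs. iid_avg I (k * N) (\<lambda>ys. of_bool (\<not> E (set xs)) * of_bool (\<not> E (set ys))))"
    proof (intro iid_avg_mono)
      fix xs ys
      show "of_bool (\<not> E (set xs \<union> set ys)) \<le> (of_bool (\<not> E (set xs)) * of_bool (\<not> E (set ys)) :: real)"
        using mono[of "set xs" "set xs \<union> set ys"] mono[of "set ys" "set xs \<union> set ys"] by auto
    qed
    also have "\<dots> = iid_avg I N (\<lambda>xs. iid_avg I (k * N) (\<lambda>ys. of_bool (\<not> E (set ys))) * of_bool (\<not> E (set xs)))"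
      by (intro iid_avg_cong, subst iid_avg_cmult) (rule mult.commute)
    also have "\<dots> = iid_avg I (k * N) (\<lambda>ys. of_bool (\<not> E (set ys))) * iid_avg I N (\<lambda>xs. of_bool (\<not> E (set xs)))"
      by (rule iid_avg_cmult)
    also have "\<dots> \<le> (1 - \<theta>) ^ k * (1 - \<theta>)"
    proof (intro mult_mono Suc)
      show "iid_avg I N (\<lambda>xs. of_bool (\<not> E (set xs))) \<le> 1 - \<theta>" using \<theta> by (simp add: neg)
      show "0 \<le> iid_avg I N (\<lambda>xs. of_bool (\<not> E (set xs)))" by (rule iid_avg_nonneg) simp
    qed (use \<theta> in simp)
    finally show ?case by (simp add: mult.commute)
  qed
  then have "1 - (1 - \<theta>) ^ k \<le> iid_avg I (k * N) (\<lambda>xs. of_bool (E (set xs)))" by (simp add: neg)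
  also have "\<dots> = iid_avg I (k * N) (\<lambda>xs. iid_avg I (m - k * N) (\<lambda>ys. of_bool (E (set xs))))"
    by (simp add: iid_avg_const[OF I])
  also have "\<dots> \<le> iid_avg I (k * N) (\<lambda>xs. iid_avg I (m - k * N) (\<lambda>ys. of_bool (E (set (xs @ ys)))))"
  proof (intro iid_avg_mono)
    fix xs ys
    show "of_bool (E (set xs)) \<le> (of_bool (E (set (xs @ ys))) :: real)"
      using mono[of "set xs" "set (xs @ ys)"] by auto
  qed
  also have "\<dots> = iid_avg I (k * N + (m - k * N)) (\<lambda>xs. of_bool (E (set xs)))"
    by (rule iid_avg_append[symmetric])
  also have "k * N + (m - k * N) = m" using m by simp
  finally show ?thesis .
qed

section \<open>From a dual certificate to strict growth of the nuclear norm\<close>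

context coherent_pair
begin

definition sign_matrix :: "nat \<times> nat \<Rightarrow> real" where
  "sign_matrix x = (\<Sum>k<r. u k (fst x) * v k (snd x))"

lemma proj_sign_matrix: "x \<in> Idx \<Longrightarrow> proj sign_matrix x = sign_matrix x"
proof -
  assume x: "x \<in> Idx"
  have "sign_matrix = (\<lambda>x. \<Sum>k<r. 1 * (u k (fst x) * v k (snd x)))" by (simp add: fun_eq_iff sign_matrix_def)
  then have "proj sign_matrix x = (\<Sum>k<r. 1 * proj (\<lambda>x. u k (fst x) * v k (snd x)) x)" by (simp only: proj_sum)
  then show ?thesis using x by (simp add: proj_tensor_left sign_matrix_def)
qed

text \<open>The start of golfing. Row and column norms of U V^T are the norms of P_U e_a and P_V
  e_b, and Cauchy-Schwarz bounds an entry by their product.\<close>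

lemma tame_sign_matrix: "tame \<nu> 1 sign_matrix"
proof -
  have "(\<Sum>b<n2. (sign_matrix (a, b))\<^sup>2) \<le> 1\<^sup>2 * \<nu> / real n1" if "a < n1" for a
    using gu[OF that] orthonormal_combination_norm[OF ov, of "\<lambda>k. u k a"] by (simp add: sign_matrix_def gram_diag)
  moreover have "(\<Sum>a<n1. (sign_matrix (a, b))\<^sup>2) \<le> 1\<^sup>2 * \<nu> / real n2" if "b < n2" for b
    using gv[OF that] orthonormal_combination_norm[OF ou, of "\<lambda>k. v k b"]
    by (simp add: sign_matrix_def gram_diag mult.commute)
  moreover have "(sign_matrix x)\<^sup>2 \<le> 1\<^sup>2 * \<nu>\<^sup>2 / (real n1 * real n2)" if x: "x \<in> Idx" for x
  proof -
    have "(sign_matrix x)\<^sup>2 \<le> gram r u (fst x) (fst x) * gram r v (snd x) (snd x)"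
      unfolding sign_matrix_def gram_diag by (rule Cauchy_Schwarz_ineq_sum)
    also have "\<dots> \<le> (\<nu> / real n1) * (\<nu> / real n2)"
      using x \<nu>_pos by (intro mult_mono gu gv gram_diag_nonneg) auto
    finally show ?thesis by (simp add: power2_eq_square)
  qed
  ultimately show ?thesis unfolding tame_def using proj_sign_matrix by blast
qed

lemma tame_nrm_le:
  assumes "tame \<nu> \<tau> W" "\<tau> \<ge> 0"
  shows "nrm W \<le> \<tau> * sqrt \<nu>"
proof -
  have "(nrm W)\<^sup>2 = (\<Sum>a<n1. \<Sum>b<n2. (W (a, b))\<^sup>2)" by (simp add: nrm_sq sum.cartesian_product case_prod_beta')
  also have "\<dots> \<le> (\<Sum>a<n1. \<tau>\<^sup>2 * \<nu> / real n1)"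
    using assms by (intro sum_mono) (simp add: tame_def)
  also have "\<dots> = (\<tau> * sqrt \<nu>)\<^sup>2" using n1_pos \<nu>_pos by (simp add: power_mult_distrib)
  finally show ?thesis by (rule power2_le_imp_le) (use assms \<nu>_pos in simp)
qed

lemma bform_eq_sum: "bform n1 n2 x A y = (\<Sum>p\<in>Idx. x (fst p) * A (fst p) (snd p) * y (snd p))"
  by (simp add: bform_def sum.cartesian_product case_prod_beta')

text \<open>Let Q be the part of Z orthogonal to the tangent space, with decomposition sum_l t_l a_l
  b_l^T. Its vectors are orthogonal to U and V, so they extend u and v to orthonormal families;
  pairing X with these shows that the nuclear norm grows by at least <U V^T, Z> + sum t. Writing U
  V^T = D + P Y turns <U V^T, Z> into <D, P Z> - <Y, Q>, which costs at most 1/4 + 1/2 of sum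
  t.\<close>

lemma certificate_imp_larger_norm:
  assumes M: "is_svd n1 n2 M r \<sigma> u v"
    and Z: "Z = (\<lambda>p. X (fst p) (snd p) - M (fst p) (snd p))"
    and YZ: "(\<Sum>p\<in>Idx. Y p * Z p) = 0"
    and resid: "nrm (\<lambda>p. sign_matrix p - proj Y p) \<le> e"
    and perp: "\<And>a b. (\<Sum>i<n1. (a i)\<^sup>2) = 1 \<Longrightarrow> (\<Sum>j<n2. (b j)\<^sup>2) = 1 \<Longrightarrow>
       (\<And>k. k < r \<Longrightarrow> (\<Sum>i<n1. u k i * a i) = 0) \<Longrightarrow> (\<And>k. k < r \<Longrightarrow> (\<Sum>j<n2. v k j * b j) = 0) \<Longrightarrow>
       \<bar>\<Sum>x\<in>Idx. a (fst x) * Y x * b (snd x)\<bar> \<le> 1 / 2"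
    and inj: "nrm (proj Z) \<le> K * nrm (\<lambda>p. Z p - proj Z p)"
    and small: "e * K \<le> 1 / 4"
  shows "(\<forall>i<n1. \<forall>j<n2. X i j = M i j) \<or> nuclear_norm n1 n2 X > nuclear_norm n1 n2 M"
proof -
  define Q where "Q p = Z p - proj Z p" for p
  let ?f = "\<lambda>a A b. \<Sum>p\<in>Idx. a (fst p) * A p * b (snd p)"
  have f_bform: "?f a A b = bform n1 n2 a (\<lambda>i j. A (i, j)) b" for a A b by (simp add: bform_eq_sum)
  have nQ: "nrm (\<lambda>p. Z p - proj Z p) = nrm Q" by (simp add: Q_def[abs_def])
  obtain s t a b where svd: "is_svd n1 n2 (\<lambda>i j. Q (i, j)) s t a b" using svd_exists by blast
  have oa: "orthonormal_family n1 s a" and ob: "orthonormal_family n2 s b" and tpos: "\<And>l. l < s \<Longrightarrow> t l > 0"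
    using svd by (auto simp: is_svd_def)
  have f_Q: "?f x Q y = (\<Sum>l<s. t l * (\<Sum>i<n1. a l i * x i) * (\<Sum>j<n2. b l j * y j))" for x y
    unfolding f_bform by (rule bform_outer) (use svd in \<open>auto simp: is_svd_def\<close>)
  have f_inner: "?f x Q y = (\<Sum>p\<in>Idx. Z p * (x (fst p) * y (snd p) - proj (\<lambda>p. x (fst p) * y (snd p)) p))" for x y
  proof -
    have "?f x Q y = (\<Sum>p\<in>Idx. Z p * (x (fst p) * y (snd p))) - (\<Sum>p\<in>Idx. proj Z p * (x (fst p) * y (snd p)))"
      unfolding sum_subtractf[symmetric] by (intro sum.cong refl) (simp add: Q_def algebra_simps)
    then show ?thesis unfolding proj_self_adjoint by (simp add: sum_subtractf right_diff_distrib)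
  qed
  \<comment> \<open>u_k b_l^T is tangent, so its pairing with Q is zero; computed through the
    decomposition, that pairing is t_l <a_l, u_k>.\<close>
  have ua: "(\<Sum>i<n1. u k i * a l i) = 0" if kl: "k < r" "l < s" for k l
  proof -
    have "(\<Sum>j<n2. b l' j * b l j) = of_bool (l' = l)" if "l' < s" for l'
      using ob kl that by (auto simp: orthonormal_family_def)
    then have "?f (u k) Q (b l) = (\<Sum>l'<s. (t l' * (\<Sum>i<n1. a l' i * u k i)) * of_bool (l' = l))"
      unfolding f_Q by (intro sum.cong) auto
    also have "\<dots> = t l * (\<Sum>i<n1. a l i * u k i)" using kl by (simp add: sum_delta_right)
    finally have "t l * (\<Sum>i<n1. a l i * u k i) = 0"
      using kl unfolding f_inner by (simp add: proj_tensor_left)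
    then show ?thesis using tpos[OF kl(2)] by (simp add: mult.commute)
  qed
  have vb: "(\<Sum>j<n2. v k j * b l j) = 0" if kl: "k < r" "l < s" for k l
  proof -
    have "(\<Sum>i<n1. a l' i * a l i) = of_bool (l' = l)" if "l' < s" for l'
      using oa kl that by (auto simp: orthonormal_family_def)
    then have "?f (a l) Q (v k) = (\<Sum>l'<s. (t l' * (\<Sum>j<n2. b l' j * v k j)) * of_bool (l' = l))"
      unfolding f_Q by (intro sum.cong) auto
    also have "\<dots> = t l * (\<Sum>j<n2. b l j * v k j)" using kl by (simp add: sum_delta_right)
    finally have "t l * (\<Sum>j<n2. b l j * v k j) = 0"
      using kl unfolding f_inner by (simp add: proj_tensor_right)
    then show ?thesis using tpos[OF kl(2)] by (simp add: mult.commute)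
  qed
  have fQl: "?f (a l) Q (b l) = t l" if "l < s" for l
    unfolding f_bform using svd_pairing_eq[OF svd that] .
  have fZl: "?f (a l) Z (b l) = t l" if l: "l < s" for l
  proof -
    have "?f (a l) Z (b l) = ?f (a l) Q (b l) + ?f (a l) (proj Z) (b l)"
      unfolding sum.distrib[symmetric] by (intro sum.cong refl) (simp add: Q_def algebra_simps)
    moreover have "?f (a l) (proj Z) (b l) = 0"
      by (rule tangent_annihilates_perp) (use proj_proj ua vb l in auto)
    ultimately show ?thesis using fQl[OF l] by simp
  qed
  obtain r' \<sigma>' u' v' where X: "is_svd n1 n2 X r' \<sigma>' u' v'" using svd_exists by blast
  let ?u = "\<lambda>k. if k < r then u k else a (k - r)" and ?v = "\<lambda>k. if k < r then v k else b (k - r)"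
  have X_split: "bform n1 n2 x X y = bform n1 n2 x M y + ?f x Z y" for x y
    unfolding bform_eq_sum sum.distrib[symmetric] by (intro sum.cong refl) (simp add: Z algebra_simps)
  have M_perp: "bform n1 n2 (a l) M (b l) = 0" if "l < s" for l
  proof -
    have "bform n1 n2 (a l) M (b l) = (\<Sum>k<r. \<sigma> k * (\<Sum>i<n1. u k i * a l i) * (\<Sum>j<n2. v k j * b l j))"
      by (rule bform_outer) (use M in \<open>auto simp: is_svd_def\<close>)
    then show ?thesis using ua that by simp
  qed
  have split_sum: "(\<Sum>k<r + s. h (?u k) (?v k)) = (\<Sum>k<r. h (u k) (v k)) + (\<Sum>l<s. h (a l) (b l))" for h :: "_ \<Rightarrow> _ \<Rightarrow> real"
    by (induction s) auto
  have "(\<Sum>k<r + s. bform n1 n2 (?u k) X (?v k)) \<le> nuclear_norm n1 n2 X"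
    unfolding nuclear_norm_eq[OF X]
    by (rule svd_pairing_le[OF X]) (intro orthonormal_family_append ou ov oa ob ua vb; assumption)+
  also have "(\<Sum>k<r + s. bform n1 n2 (?u k) X (?v k))
     = (\<Sum>k<r. bform n1 n2 (u k) M (v k) + ?f (u k) Z (v k)) + (\<Sum>l<s. t l)"
    unfolding split_sum[of "\<lambda>x y. bform n1 n2 x X y"] unfolding X_split using M_perp fZl by simp
  also have "\<dots> = nuclear_norm n1 n2 M + (\<Sum>p\<in>Idx. sign_matrix p * Z p) + (\<Sum>l<s. t l)"
  proof -
    have "(\<Sum>k<r. ?f (u k) Z (v k)) = (\<Sum>p\<in>Idx. \<Sum>k<r. u k (fst p) * Z p * v k (snd p))" by (rule sum.swap)
    also have "\<dots> = (\<Sum>p\<in>Idx. sign_matrix p * Z p)"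
      unfolding sign_matrix_def sum_distrib_right by (intro sum.cong refl) (simp add: mult_ac)
    finally show ?thesis using svd_pairing_eq[OF M] by (simp add: sum.distrib nuclear_norm_eq[OF M])
  qed
  finally have main: "nuclear_norm n1 n2 M + (\<Sum>p\<in>Idx. sign_matrix p * Z p) + (\<Sum>l<s. t l) \<le> nuclear_norm n1 n2 X" .
  have YQ: "\<bar>\<Sum>p\<in>Idx. Y p * Q p\<bar> \<le> (\<Sum>l<s. t l) / 2"
  proof -
    have "(\<Sum>p\<in>Idx. Y p * Q p) = (\<Sum>p\<in>Idx. \<Sum>l<s. t l * (a l (fst p) * Y p * b l (snd p)))"
    proof (rule sum.cong[OF refl])
      fix p assume "p \<in> Idx"
      then have "Q p = (\<Sum>l<s. t l * a l (fst p) * b l (snd p))" using svd by (cases p) (auto simp: is_svd_def)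
      then show "Y p * Q p = (\<Sum>l<s. t l * (a l (fst p) * Y p * b l (snd p)))"
        by (simp add: sum_distrib_left mult_ac)
    qed
    also have "\<dots> = (\<Sum>l<s. t l * ?f (a l) Y (b l))" by (subst sum.swap) (simp add: sum_distrib_left)
    finally have "\<bar>\<Sum>p\<in>Idx. Y p * Q p\<bar> \<le> (\<Sum>l<s. \<bar>t l * ?f (a l) Y (b l)\<bar>)" by (simp only: sum_abs)
    also have "\<dots> \<le> (\<Sum>l<s. t l * (1 / 2))"
    proof (rule sum_mono)
      fix l assume "l \<in> {..<s}"
      then have l: "l < s" by simp
      have "\<bar>?f (a l) Y (b l)\<bar> \<le> 1 / 2"
        by (rule perp) (use orthonormal_norm[OF oa l] orthonormal_norm[OF ob l] ua vb l in auto)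
      then have "t l * \<bar>?f (a l) Y (b l)\<bar> \<le> t l * (1 / 2)" using tpos[OF l] by (intro mult_left_mono) auto
      then show "\<bar>t l * ?f (a l) Y (b l)\<bar> \<le> t l * (1 / 2)" using tpos[OF l] by (simp add: abs_mult)
    qed
    finally show ?thesis by (simp add: sum_divide_distrib)
  qed
  \<comment> \<open>\<open>inj\<close> measures Q in Frobenius norm, the gain is its nuclear norm;
    the former is the smaller one.\<close>
  have nrmQ: "nrm Q \<le> (\<Sum>l<s. t l)"
  proof -
    have S0: "(\<Sum>l<s. t l) \<ge> 0" using tpos by (intro sum_nonneg) (auto simp: less_imp_le)
    have "(nrm Q)\<^sup>2 = (\<Sum>p\<in>Idx. \<Sum>l<s. t l * (a l (fst p) * Q p * b l (snd p)))"
      unfolding nrm_sq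
    proof (rule sum.cong[OF refl])
      fix p assume "p \<in> Idx"
      then have "Q p = (\<Sum>l<s. t l * a l (fst p) * b l (snd p))" using svd by (cases p) (auto simp: is_svd_def)
      then have "Q p * Q p = (\<Sum>l<s. t l * a l (fst p) * b l (snd p)) * Q p" by simp
      then show "(Q p)\<^sup>2 = (\<Sum>l<s. t l * (a l (fst p) * Q p * b l (snd p)))"
        unfolding power2_eq_square sum_distrib_right by (simp add: mult_ac)
    qed
    also have "\<dots> = (\<Sum>l<s. t l * ?f (a l) Q (b l))" by (subst sum.swap) (simp add: sum_distrib_left)
    also have "\<dots> = (\<Sum>l<s. t l * t l)" using fQl by simp
    also have "\<dots> \<le> (\<Sum>l<s. t l * (\<Sum>l<s. t l))"
      using tpos by (intro sum_mono mult_left_mono member_le_sum) (auto simp: less_imp_le)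
    also have "\<dots> = (\<Sum>l<s. t l)\<^sup>2" by (simp add: sum_distrib_right power2_eq_square)
    finally show ?thesis using S0 by (rule power2_le_imp_le)
  qed
  define D where "D p = sign_matrix p - proj Y p" for p
  have nD: "nrm D \<le> e" using resid by (simp add: D_def[abs_def])
  have projD: "proj D p = D p" if "p \<in> Idx" for p
    using that unfolding D_def[abs_def] proj_diff by (simp add: proj_sign_matrix proj_proj)
  have "(\<Sum>p\<in>Idx. D p * Z p) = (\<Sum>p\<in>Idx. proj D p * Z p)" by (simp only: projD cong: sum.cong)
  also have "\<dots> = (\<Sum>p\<in>Idx. D p * proj Z p)" by (rule proj_self_adjoint)
  finally have DZ: "(\<Sum>p\<in>Idx. D p * Z p) = (\<Sum>p\<in>Idx. D p * proj Z p)" .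
  have "- (\<Sum>p\<in>Idx. D p * proj Z p) = (\<Sum>p\<in>Idx. (- D p) * proj Z p)" by (simp add: sum_negf)
  also have "\<dots> \<le> nrm (\<lambda>p. - D p) * nrm (proj Z)" by (rule inner_le_nrm)
  also have "\<dots> \<le> e * (K * nrm Q)"
    unfolding nrm_minus using nD inj nrm_nonneg order_trans[OF nrm_nonneg nD]
    by (intro mult_mono) (auto simp: nQ)
  also have "\<dots> = (e * K) * nrm Q" by simp
  also have "\<dots> \<le> 1 / 4 * nrm Q" using small nrm_nonneg by (rule mult_right_mono)
  finally have D_bound: "- (1 / 4 * nrm Q) \<le> (\<Sum>p\<in>Idx. D p * Z p)" using DZ by simp
  have "(\<Sum>p\<in>Idx. sign_matrix p * Z p) = (\<Sum>p\<in>Idx. D p * Z p) + (\<Sum>p\<in>Idx. proj Y p * Z p)"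
    unfolding sum.distrib[symmetric] by (intro sum.cong refl) (simp add: D_def algebra_simps)
  moreover have "(\<Sum>p\<in>Idx. proj Y p * Z p) = - (\<Sum>p\<in>Idx. Y p * Q p)"
    unfolding proj_self_adjoint Q_def using YZ by (simp add: right_diff_distrib sum_subtractf)
  ultimately have "nuclear_norm n1 n2 M + (\<Sum>l<s. t l) / 4 \<le> nuclear_norm n1 n2 X"
    using main D_bound YQ nrmQ by linarith
  \<comment> \<open>If Q = 0, injectivity forces P Z = 0 as well and X = M; otherwise sum t > 0
    makes the gain strict.\<close>
  moreover have "\<forall>i<n1. \<forall>j<n2. X i j = M i j" if "s = 0"
  proof -
    have Q0: "nrm Q = 0" using nrmQ nrm_nonneg[of Q] that by simp
    then have P0: "nrm (proj Z) = 0" using inj nrm_nonneg[of "proj Z"] by (simp add: nQ)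
    have zero: "A p = 0" if "nrm A = 0" "p \<in> Idx" for A p
    proof -
      have "(\<Sum>x\<in>Idx. (A x)\<^sup>2) = 0" using that nrm_sq[of A] by simp
      then show ?thesis using that finite by (subst (asm) sum_nonneg_eq_0_iff) auto
    qed
    have "Z p = 0" if "p \<in> Idx" for p using zero[OF Q0 that] zero[OF P0 that] by (simp add: Q_def)
    then show ?thesis by (auto simp: Z)
  qed
  moreover have "(\<Sum>l<s. t l) > 0" if "s \<noteq> 0" using that tpos by (intro sum_pos) auto
  ultimately show ?thesis by (cases "s = 0") (auto intro: less_le_trans[rotated])
qed

end

section \<open>Recovery\<close>

lemma unique_nuclear_minimizer_mono:
  assumes "A \<subseteq> B" "unique_nuclear_minimizer n1 n2 A M"
  shows "unique_nuclear_minimizer n1 n2 B M"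
  using assms unfolding unique_nuclear_minimizer_def mat_agree_on_def by blast

section \<open>Recovery from one batch\<close>

context coherent_pair
begin

text \<open>\<open>xs\<close> gives injectivity and \<open>ys\<close> the certificate.
  \<open>small\<close> weighs the golfing residual \<delta>^L sqrt \<nu> against the injectivity
  constant.\<close>

lemma recovery_of_batches:
  assumes M: "is_svd n1 n2 M r \<sigma> u v"
    and con: "contracting N L0 xs" and lxs: "length xs = L0 * N"
    and golf: "golfing \<delta> N L 1 ys sign_matrix" and lys: "length ys = L * N"
    and N: "N > 0" and \<delta>: "0 \<le> \<delta>" "\<delta> \<le> 1 / 4"
    and small: "(\<delta> ^ L * sqrt \<nu>) * (2 * (1 + real (card Idx)) ^ L0) \<le> 1 / 4"
  shows "unique_nuclear_minimizer n1 n2 (set (xs @ ys)) M"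
  unfolding unique_nuclear_minimizer_def
proof (intro allI impI)
  fix X assume agree: "mat_agree_on (set (xs @ ys)) X M"
  define Z where "Z = (\<lambda>p. X (fst p) (snd p) - M (fst p) (snd p))"
  have Z0: "Z p = 0" if "p \<in> set xs \<union> set ys" for p
    using agree that by (auto simp: Z_def mat_agree_on_def)
  obtain Y where Y: "\<forall>x. x \<notin> set ys \<longrightarrow> Y x = 0" "tame \<nu> (\<delta> ^ L * 1) (\<lambda>x. sign_matrix x - proj Y x)"
    "\<forall>a b. (\<Sum>i<n1. (a i)\<^sup>2) = 1 \<longrightarrow> (\<Sum>j<n2. (b j)\<^sup>2) = 1 \<longrightarrow>
       (\<forall>k<r. (\<Sum>i<n1. u k i * a i) = 0) \<longrightarrow> (\<forall>k<r. (\<Sum>j<n2. v k j * b j) = 0) \<longrightarrow>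
       \<bar>\<Sum>x\<in>Idx. a (fst x) * Y x * b (snd x)\<bar> \<le> 1 / 2"
    using golfing_certificate[OF golf tame_sign_matrix lys zero_le_one \<delta>] by blast
  show "(\<forall>i<n1. \<forall>j<n2. X i j = M i j) \<or> nuclear_norm n1 n2 M < nuclear_norm n1 n2 X"
  proof (rule certificate_imp_larger_norm[OF M Z_def])
    have "Y p * Z p = 0" for p using Y(1)[rule_format, of p] Z0[of p] by (cases "p \<in> set ys") auto
    then show "(\<Sum>p\<in>Idx. Y p * Z p) = 0" by (simp only: sum.neutral_const)
    show "nrm (\<lambda>p. sign_matrix p - proj Y p) \<le> \<delta> ^ L * sqrt \<nu>"
      using tame_nrm_le[OF Y(2)] \<delta> by simp
    show "nrm (proj Z) \<le> 2 * (1 + real (card Idx)) ^ L0 * nrm (\<lambda>p. Z p - proj Z p)"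
      by (rule contracting_imp_injective[OF con N lxs]) (use Z0 in auto)
  qed (use Y(3) small in blast)+
qed

text \<open>Contraction has probability at least 1/2 and golfing, on independent draws, at least
  (1/2)^L.\<close>

lemma recovery_prob_superbatch:
  assumes M: "is_svd n1 n2 M r \<sigma> u v"
    and N: "N > 0" and p: "p = Suc s" and \<delta>: "0 < \<delta>" "\<delta> \<le> 1 / 4"
    and \<epsilon>: "m * \<nu> / real N \<le> 1"
    and small_step: "8 * m\<^sup>2 * (mom_const p * (m * \<nu> / real N) / \<delta>\<^sup>2) ^ p \<le> 1 / 2"
    and small_contr: "4 * (2 * (m * \<nu> / real N)) ^ L0 * real (card Idx) \<le> 1 / 2"
    and small_resid: "(\<delta> ^ L * sqrt \<nu>) * (2 * (1 + real (card Idx)) ^ L0) \<le> 1 / 4"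
  shows "iid_avg Idx ((L0 + L) * N) (\<lambda>xs. of_bool (unique_nuclear_minimizer n1 n2 (set xs) M)) \<ge> (1 / 2) ^ Suc L"
proof -
  have q: "real (card Idx) * (\<nu> / real n1 + \<nu> / real n2) / real N \<le> 2 * (m * \<nu> / real N)"
  proof -
    have "real (card Idx) * (\<nu> / real n1 + \<nu> / real n2) = (real n1 + real n2) * \<nu>"
      unfolding card_Idx using n1_pos n2_pos by (simp add: field_simps)
    also have "\<dots> \<le> (2 * m) * \<nu>" using \<nu>_pos by (intro mult_right_mono) auto
    finally show ?thesis using N by (simp add: divide_right_mono)
  qed
  have "(1 / 2) ^ Suc L \<le> (1 / 2) ^ L * iid_avg Idx (L0 * N) (\<lambda>xs. of_bool (contracting N L0 xs))"
  proof -
    have "1 - 4 * (2 * (m * \<nu> / real N)) ^ L0 * real (card Idx) \<le> iid_avg Idx (L0 * N) (\<lambda>xs. of_bool (contracting N L0 xs))"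
      by (rule iid_avg_contracting_ge[OF tker_diag N q])
    then have "1 / 2 \<le> iid_avg Idx (L0 * N) (\<lambda>xs. of_bool (contracting N L0 xs))" using small_contr by linarith
    then show ?thesis by (simp add: mult.commute)
  qed
  also have "\<dots> = iid_avg Idx (L0 * N) (\<lambda>xs. (1 / 2) ^ L * of_bool (contracting N L0 xs))"
    by (rule iid_avg_cmult[symmetric])
  also have "\<dots> \<le> iid_avg Idx (L0 * N) (\<lambda>xs. iid_avg Idx (L * N) (\<lambda>ys. of_bool (unique_nuclear_minimizer n1 n2 (set (xs @ ys)) M)))"
  proof (rule iid_avg_mono)
    fix xs assume xs: "set xs \<subseteq> Idx" "length xs = L0 * N"
    show "(1 / 2) ^ L * of_bool (contracting N L0 xs) \<le> iid_avg Idx (L * N) (\<lambda>ys. of_bool (unique_nuclear_minimizer n1 n2 (set (xs @ ys)) M))"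
    proof (cases "contracting N L0 xs")
      case True
      have "(1 / 2) ^ L \<le> iid_avg Idx (L * N) (\<lambda>ys. of_bool (golfing \<delta> N L 1 ys sign_matrix))"
        by (rule golfing_prob[OF tame_sign_matrix zero_less_one \<delta>(1) N p \<epsilon> small_step])
      also have "\<dots> \<le> iid_avg Idx (L * N) (\<lambda>ys. of_bool (unique_nuclear_minimizer n1 n2 (set (xs @ ys)) M))"
      proof (rule iid_avg_mono)
        fix ys assume ys: "set ys \<subseteq> Idx" "length ys = L * N"
        show "(of_bool (golfing \<delta> N L 1 ys sign_matrix) :: real) \<le> of_bool (unique_nuclear_minimizer n1 n2 (set (xs @ ys)) M)"
          using recovery_of_batches[OF M True xs(2) _ ys(2) N _ \<delta>(2) small_resid] \<delta>(1)
          by (cases "golfing \<delta> N L 1 ys sign_matrix") auto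
      qed
      finally show ?thesis using True by simp
    next
      case False
      have "0 \<le> iid_avg Idx (L * N) (\<lambda>ys. of_bool (unique_nuclear_minimizer n1 n2 (set (xs @ ys)) M))"
        by (rule iid_avg_nonneg) simp
      then show ?thesis using False by simp
    qed
  qed
  also have "\<dots> = iid_avg Idx ((L0 + L) * N) (\<lambda>xs. of_bool (unique_nuclear_minimizer n1 n2 (set xs) M))"
    unfolding distrib_right iid_avg_append ..
  finally show ?thesis .
qed

text \<open>With \<open>h = n powr (1/20)\<close> all powers of \<open>n\<close> occurring below are integral powers of \<open>h\<close>.
  Ten groups of samples serve for the contraction, which has to beat the dimension \<open>n1 * n2 \<le> h ^ 40\<close>.
  The other 420 groups serve for golfing, whose residual has to beat the factor \<open>2 * (1 + n1 * n2) ^ 10\<close> lost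
  in the injectivity estimate.\<close>

lemma recovery_prob_batch_size:
  assumes M: "is_svd n1 n2 M r \<sigma> u v"
    and h: "h \<ge> 1" "m = h ^ 20" and \<nu>: "1 \<le> \<nu>" "\<nu> \<le> h ^ 20"
    and N: "901120 * \<nu> * h ^ 24 \<le> real N"
  shows "iid_avg Idx (430 * N) (\<lambda>xs. of_bool (unique_nuclear_minimizer n1 n2 (set xs) M)) \<ge> (1 / 2) ^ 421"
proof -
  let ?\<epsilon> = "m * \<nu> / real N" and ?\<delta> = "1 / (4 * h)"
  have Npos: "real N > 0" using N h \<nu> by (smt (verit) mult_pos_pos zero_less_power)
  have \<epsilon>: "?\<epsilon> \<le> 1 / (901120 * h ^ 4)"
  proof -
    have "h ^ 20 * \<nu> * (901120 * h ^ 4) \<le> real N"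
      using N by (simp add: mult_ac power_add[symmetric])
    then show ?thesis using Npos h by (simp add: field_simps)
  qed
  have \<epsilon>0: "0 \<le> ?\<epsilon>" using \<nu>_pos Npos by simp
  have h4: "h ^ 4 \<ge> 1" "h ^ 4 > 0" using h by auto
  have card: "real (card Idx) \<le> h ^ 40"
  proof -
    have "real n1 * real n2 \<le> m * m" by (intro mult_mono) auto
    then show ?thesis unfolding card_Idx h(2) by (simp add: power_add[symmetric])
  qed
  have "(1 / 2) ^ Suc 420 \<le> iid_avg Idx ((10 + 420) * N) (\<lambda>xs. of_bool (unique_nuclear_minimizer n1 n2 (set xs) M))"
  proof (rule recovery_prob_superbatch[OF M, where p = 20 and s = 19 and \<delta> = ?\<delta>])
    show "0 < N" using Npos by simp
    show "0 < ?\<delta>" "?\<delta> \<le> 1 / 4" using h by (auto simp: field_simps)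
    have "1 / (901120 * h ^ 4) \<le> 1" using h4 by (simp add: field_simps)
    then show "?\<epsilon> \<le> 1" using \<epsilon> by linarith
    \<comment> \<open>901120 is 32 times \<open>mom_const 20\<close> = 28160, and 1 / \<delta>^2 =
      16 h^2. The ratio is thus at most 1 / (2 h^2), and the h^40 in its 20th power cancels
      m^2.\<close>
    have "mom_const 20 * ?\<epsilon> / ?\<delta>\<^sup>2 \<le> 28160 * (1 / (901120 * h ^ 4)) / ?\<delta>\<^sup>2"
      using \<epsilon> by (intro divide_right_mono) (auto simp: mom_const_def)
    also have "\<dots> = 1 / 2 / h\<^sup>2"
      using h by (simp add: power_divide power_mult_distrib field_simps power_add[symmetric])
    finally have "(mom_const 20 * ?\<epsilon> / ?\<delta>\<^sup>2) ^ 20 \<le> (1 / 2 / h\<^sup>2) ^ 20"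
      by (intro power_mono divide_nonneg_nonneg mult_nonneg_nonneg \<epsilon>0) (auto simp: mom_const_def)
    also have "\<dots> = (1 / 2) ^ 20 / h ^ 40" by (simp add: power_divide power_mult[symmetric])
    finally have "8 * m\<^sup>2 * (mom_const 20 * ?\<epsilon> / ?\<delta>\<^sup>2) ^ 20 \<le> 8 * m\<^sup>2 * ((1 / 2) ^ 20 / h ^ 40)"
      by (intro mult_left_mono) auto
    also have "\<dots> = 8 * (1 / 2) ^ 20" using h by (simp add: h(2) power_mult[symmetric])
    finally show "8 * m\<^sup>2 * (mom_const 20 * ?\<epsilon> / ?\<delta>\<^sup>2) ^ 20 \<le> 1 / 2" by (simp add: power_one_over)
    have "(2 * ?\<epsilon>) ^ 10 \<le> (1 / 2 / h ^ 4) ^ 10"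
    proof (intro power_mono)
      have "2 * (1 / (901120 * h ^ 4)) \<le> 1 / 2 / h ^ 4" using h4 by (simp add: field_simps)
      then show "2 * ?\<epsilon> \<le> 1 / 2 / h ^ 4" using \<epsilon> by linarith
    qed (use \<epsilon>0 in simp)
    then have "4 * (2 * ?\<epsilon>) ^ 10 * real (card Idx) \<le> 4 * (1 / 2 / h ^ 4) ^ 10 * h ^ 40"
      using card h by (intro mult_mono) auto
    also have "\<dots> = 4 * (1 / 2) ^ 10" using h by (simp add: power_divide power_mult[symmetric])
    finally show "4 * (2 * ?\<epsilon>) ^ 10 * real (card Idx) \<le> 1 / 2" by (simp add: power_one_over)
    have sq: "sqrt \<nu> \<le> h ^ 20"
    proof -
      have "sqrt \<nu> \<le> \<nu>" using \<nu> by (simp add: real_le_lsqrt power2_eq_square)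
      then show ?thesis using \<nu> by linarith
    qed
    have "1 + real (card Idx) \<le> 2 * h ^ 40" using card h one_le_power[of h 40] by linarith
    then have "(1 + real (card Idx)) ^ 10 \<le> (2 * h ^ 40) ^ 10" by (intro power_mono) auto
    \<comment> \<open>sqrt \<nu> contributes h^20 and the injectivity constant h^400; together they
      fix the number 420 of golfing steps.\<close>
    then have "(?\<delta> ^ 420 * sqrt \<nu>) * (2 * (1 + real (card Idx)) ^ 10) \<le> (?\<delta> ^ 420 * h ^ 20) * (2 * (2 * h ^ 40) ^ 10)"
      using sq h \<nu> by (intro mult_mono) auto
    also have "\<dots> = 2 ^ 11 * (1 / 4) ^ 420 * (h ^ 420 / h ^ 420)"
      by (simp add: power_divide power_mult_distrib power_mult[symmetric] power_add[symmetric])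
    also have "\<dots> = 2 ^ 11 * (1 / 4) ^ 420" using h by simp
    also have "\<dots> \<le> 2 ^ 11 * (1 / 4 :: real) ^ 10" by (intro mult_left_mono power_decreasing) auto
    also have "\<dots> \<le> 1 / 4" by (simp add: power_one_over)
    finally show "(?\<delta> ^ 420 * sqrt \<nu>) * (2 * (1 + real (card Idx)) ^ 10) \<le> 1 / 4" .
  qed simp
  then show ?thesis by simp
qed

end

section \<open>From coherence and sample size to repeated batches\<close>

lemma gram_diag_le_coherence:
  assumes r: "r > 0" and d: "d > 0" and c: "coherence d r u \<le> \<mu>" and a: "a < d"
  shows "gram r u a a \<le> \<mu> * real r / real d"
proof -
  let ?S = "(\<lambda>i. \<Sum>k<r. (u k i)\<^sup>2) ` {..<d}"
  have "gram r u a a \<le> Max ?S" unfolding gram_diag using a by (intro Max_ge) auto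
  moreover have "Max ?S \<le> \<mu> * real r / real d"
    using c r d by (simp add: coherence_def field_simps)
  ultimately show ?thesis by linarith
qed

lemma recovery_prob_nonneg: "0 \<le> recovery_prob n1 n2 m M"
  by (simp add: recovery_prob_def)

lemma finite_samples: "finite (samples n1 n2 m)"
  by (rule finite_subset[of _ "Pow ({..<n1} \<times> {..<n2})"]) (auto simp: samples_def)

lemma card_samples_pos:
  assumes "m \<le> n1 * n2"
  shows "card (samples n1 n2 m) > 0"
proof -
  have "m \<le> card ({..<n1} \<times> {..<n2})" using assms by simp
  then obtain \<Omega> where "\<Omega> \<subseteq> {..<n1} \<times> {..<n2}" "card \<Omega> = m" by (rule obtain_subset_with_card_n)
  then have "\<Omega> \<in> samples n1 n2 m" by (simp add: samples_def)
  then show ?thesis using finite_samples card_gt_0_iff by blast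
qed

text \<open>Rank 0 is separate because \<open>coherence\<close> then divides by 0. Here M vanishes,
  and every competitor different from it has a positive singular value.\<close>

lemma recovery_prob_rank_0:
  assumes M: "is_svd n1 n2 M 0 \<sigma> u v" and m: "m \<le> n1 * n2"
  shows "recovery_prob n1 n2 m M = 1"
proof -
  have "unique_nuclear_minimizer n1 n2 \<Omega> M" for \<Omega>
    unfolding unique_nuclear_minimizer_def
  proof (intro allI impI)
    fix X
    obtain r \<sigma>' u' v' where X: "is_svd n1 n2 X r \<sigma>' u' v'" using svd_exists by blast
    show "(\<forall>i<n1. \<forall>j<n2. X i j = M i j) \<or> nuclear_norm n1 n2 M < nuclear_norm n1 n2 X"
    proof (cases "r = 0")
      case True
      then show ?thesis using X M by (simp add: is_svd_def)
    next
      case False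
      then have "(\<Sum>k<r. \<sigma>' k) > 0" using X by (intro sum_pos) (auto simp: is_svd_def)
      then show ?thesis using nuclear_norm_eq[OF M] nuclear_norm_eq[OF X] by simp
    qed
  qed
  then show ?thesis using card_samples_pos[OF m] by (simp add: recovery_prob_def)
qed

lemma recovery_prob_ge_iid:
  assumes "n1 > 0" "n2 > 0" "m \<le> n1 * n2"
  shows "iid_avg ({..<n1} \<times> {..<n2}) m (\<lambda>xs. of_bool (unique_nuclear_minimizer n1 n2 (set xs) M)) \<le> recovery_prob n1 n2 m M"
proof -
  have "{\<Omega> \<in> samples n1 n2 m. unique_nuclear_minimizer n1 n2 \<Omega> M}
    = {A. A \<subseteq> {..<n1} \<times> {..<n2} \<and> card A = m \<and> unique_nuclear_minimizer n1 n2 A M}"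
    by (auto simp: samples_def)
  then show ?thesis
    using iid_avg_le_uniform_subset[of "{..<n1} \<times> {..<n2}" m "\<lambda>A. unique_nuclear_minimizer n1 n2 A M"]
      unique_nuclear_minimizer_mono assms
    unfolding recovery_prob_def samples_def by (auto simp: lessThan_empty_iff)
qed

text \<open>Rounding up at most doubles a group, so a batch takes at most 860 * 901120 * \<nu>
  n^(6/5) draws; 2^421 is the inverse of the lower bound for its success probability.\<close>

definition rate_const :: real where
  "rate_const = 860 * 901120 * 2 ^ 421"

lemma recovery_prob_ge:
  assumes M: "is_svd n1 n2 M r \<sigma> u v" and \<mu>0: "\<mu>0 > 0"
    and coh: "max (coherence n1 r u) (coherence n2 r v) \<le> \<mu>0"
    and \<beta>: "\<beta> > 2" and m: "m \<le> n1 * n2"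
    and n: "n = real (max n1 n2)"
    and size: "real m \<ge> rate_const * \<mu>0 * n powr (6/5) * real r * (\<beta> * ln n)"
  shows "recovery_prob n1 n2 m M \<ge> 1 - 3 * n powr (-\<beta>)"
proof (cases "r = 0")
  case True
  then show ?thesis using recovery_prob_rank_0[of n1 n2 M \<sigma> u v m] M m by simp
next
  case False
  have ou: "orthonormal_family n1 r u" and ov: "orthonormal_family n2 r v" using M by (auto simp: is_svd_def)
  have pos: "n1 > 0" "n2 > 0" using orthonormal_card_le[OF ou] orthonormal_card_le[OF ov] False by auto
  show ?thesis
  proof (cases "n = 1")
    case True
    \<comment> \<open>Here n^(-\<beta>) = 1, and the claimed lower bound is negative.\<close>
    then show ?thesis using recovery_prob_nonneg[of n1 n2 m M] by simp
  next
    case False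
    then have n2: "n \<ge> 2" using pos n by auto
    define \<nu> where "\<nu> = \<mu>0 * real r"
    have gu: "gram r u a a \<le> \<nu> / real n1" if "a < n1" for a
      unfolding \<nu>_def using gram_diag_le_coherence[of r n1 u \<mu>0 a] \<open>r \<noteq> 0\<close> pos coh that by simp
    have gv: "gram r v a a \<le> \<nu> / real n2" if "a < n2" for a
      unfolding \<nu>_def using gram_diag_le_coherence[of r n2 v \<mu>0 a] \<open>r \<noteq> 0\<close> pos coh that by simp
    \<comment> \<open>The diagonal of P_U sums to r, so r \<le> \<nu>.\<close>
    have "\<nu> \<ge> 1"
    proof -
      have "real r = (\<Sum>k<r. \<Sum>a<n1. (u k a)\<^sup>2)" using orthonormal_norm[OF ou] by simp
      also have "\<dots> = (\<Sum>a<n1. gram r u a a)" unfolding gram_diag by (rule sum.swap)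
      also have "\<dots> \<le> (\<Sum>a<n1. \<nu> / real n1)" by (intro sum_mono gu) auto
      finally show ?thesis using pos \<open>r \<noteq> 0\<close> by simp
    qed
    interpret coherent_pair n1 n2 r u v \<nu>
      by unfold_locales (use ou ov pos gu gv \<open>\<nu> \<ge> 1\<close> in auto)
    define h where "h = n powr (1/20)"
    have h1: "h \<ge> 1" using n2 by (simp add: h_def ge_one_powr_ge_zero)
    have hk: "h ^ k = n powr (real k / 20)" for k
      using n2 by (simp add: h_def powr_powr[symmetric] powr_realpow[symmetric] powr_powr)
    have hn: "n = h ^ 20" using n2 by (simp add: hk)
    have h24: "n powr (6/5) = h ^ 24" by (simp add: hk)
    define T where "T = \<nu> * h ^ 24"
    have T1: "T \<ge> 1" unfolding T_def using \<open>\<nu> \<ge> 1\<close> h1 by (metis mult_mono' one_le_power mult_1 zero_le_one)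
    have ln: "ln n \<ge> 1 / 2"
    proof -
      have "ln n \<ge> ln 2" using n2 by simp
      then show ?thesis using ln2_ge_two_thirds by linarith
    qed
    then have B: "\<beta> * ln n \<ge> 1" using \<beta> mult_mono[of 2 \<beta> "1/2" "ln n"] by simp
    have size': "rate_const * T * (\<beta> * ln n) \<le> real m"
      using size unfolding h24 T_def \<nu>_def by (simp add: mult_ac)
    \<comment> \<open>The cap m \<le> n1 n2 on the sample size gives \<nu> h^24 \<le> m \<le> n^2 =
      h^40.\<close>
    have \<nu>h: "\<nu> \<le> h ^ 20"
    proof -
      have "T * 1 \<le> (rate_const * T) * (\<beta> * ln n)"
        using T1 B by (intro mult_mono) (auto simp: rate_const_def)
      also have "\<dots> \<le> real n1 * real n2" using size' m by (metis of_nat_le_iff of_nat_mult order_trans)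
      also have "\<dots> \<le> n * n" unfolding n by (intro mult_mono) auto
      also have "n * n = h ^ 16 * h ^ 24" by (simp add: hn power_add[symmetric])
      finally have "\<nu> * h ^ 24 \<le> h ^ 16 * h ^ 24" by (simp only: T_def mult_1_right)
      then have "\<nu> \<le> h ^ 16" by (rule mult_right_le_imp_le) (use h1 in simp)
      also have "\<dots> \<le> h ^ 20" using h1 by (intro power_increasing) auto
      finally show ?thesis .
    qed
    define N where "N = nat \<lceil>901120 * T\<rceil>"
    have N: "901120 * T \<le> real N" "real N \<le> 2 * 901120 * T"
      using T1 by (auto simp: N_def) linarith+
    let ?U = "\<lambda>xs. of_bool (unique_nuclear_minimizer n1 n2 (set xs) M) :: real"
    let ?\<theta> = "(1 / 2) ^ 421 :: real"
    have batch: "?\<theta> \<le> iid_avg Idx (430 * N) ?U"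
      using recovery_prob_batch_size[OF M h1 _ \<open>\<nu> \<ge> 1\<close> \<nu>h, of N] N(1) hn n by (simp only: T_def mult.assoc)
    define k where "k = m div (430 * N)"
    have Npos: "real (430 * N) > 0" using N T1 by simp
    define b :: real where "b = 2 ^ 421"
    have \<theta>b: "?\<theta> * b = 1" unfolding b_def power_mult_distrib[symmetric] by simp
    \<comment> \<open>The incomplete last batch costs at most \<open>?\<theta>\<close> \<le> 1 in
      the exponent, which becomes the factor e \<le> 3 in the failure probability.\<close>
    have k: "\<beta> * ln n - ?\<theta> \<le> ?\<theta> * real k"
    proof -
      have "real m < (real k + 1) * real (430 * N)"
      proof -
        have "m mod (430 * N) < 430 * N" using Npos by simp
        then have "m < k * (430 * N) + 430 * N"
          unfolding k_def using div_mult_mod_eq[of m "430 * N"] by linarith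
        then have "real m < real (k * (430 * N) + 430 * N)" by (simp only: of_nat_less_iff)
        then show ?thesis by (simp add: algebra_simps)
      qed
      also have "\<dots> \<le> (real k + 1) * (860 * 901120 * T)" using N(2) by (intro mult_left_mono) auto
      finally have "(860 * 901120 * T) * (b * (\<beta> * ln n)) < (860 * 901120 * T) * (real k + 1)"
        using size' by (simp only: rate_const_def b_def mult_ac)
      then have "b * (\<beta> * ln n) < real k + 1" using T1 by (simp only: mult_less_cancel_left_pos)
      then have "?\<theta> * (b * (\<beta> * ln n)) \<le> ?\<theta> * (real k + 1)" by (intro mult_left_mono) auto
      moreover have "?\<theta> * (b * (\<beta> * ln n)) = \<beta> * ln n"
        by (simp only: mult.assoc[symmetric] \<theta>b mult_1_left)
      moreover have "?\<theta> * (real k + 1) = ?\<theta> * real k + ?\<theta>" by (simp only: distrib_left mult_1_right)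
      ultimately show ?thesis by linarith
    qed
    have \<theta>: "0 < ?\<theta>" "?\<theta> \<le> 1" by (auto intro: power_le_one)
    have "(1 - ?\<theta>) ^ k \<le> exp (- ?\<theta>) ^ k"
      using exp_ge_add_one_self[of "- ?\<theta>"] \<theta> by (intro power_mono) auto
    also have "\<dots> = exp (- (?\<theta> * real k))" by (simp add: exp_of_nat_mult[symmetric] mult.commute)
    also have "\<dots> \<le> exp (1 + - (\<beta> * ln n))" using k \<theta>(2) unfolding exp_le_cancel_iff by linarith
    also have "\<dots> = exp 1 * n powr (-\<beta>)" using n2 by (simp add: powr_def exp_add[symmetric])
    also have "\<dots> \<le> 3 * n powr (-\<beta>)" using exp_le by (intro mult_right_mono) auto
    finally have fail: "(1 - ?\<theta>) ^ k \<le> 3 * n powr (-\<beta>)" .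
    have "1 - (1 - ?\<theta>) ^ k \<le> iid_avg Idx m ?U"
      by (rule iid_avg_amplify[OF finite nonempty _ batch \<theta>(2)])
        (auto simp: k_def intro: unique_nuclear_minimizer_mono)
    also have "\<dots> \<le> recovery_prob n1 n2 m M" by (rule recovery_prob_ge_iid[OF pos m])
    finally show ?thesis using fail by linarith
  qed
qed

theorem theorem1p2:
  "\<exists>C c :: real. C > 0 \<and> c > 0 \<and>
    (\<forall>n1 n2 :: nat. \<forall>M r \<sigma> u v. \<forall>\<mu>0 \<mu>1 \<beta> :: real. \<forall>m :: nat.
       is_svd n1 n2 M r \<sigma> u v \<longrightarrow>
       \<mu>0 > 0 \<longrightarrow> \<mu>1 \<ge> 1 \<longrightarrow>
       max (coherence n1 r u) (coherence n2 r v) \<le> \<mu>0 \<longrightarrow>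
       (\<forall>i<n1. \<forall>j<n2. \<bar>\<Sum>k<r. u k i * v k j\<bar> \<le> \<mu>1 * sqrt (real r / (real n1 * real n2))) \<longrightarrow>
       \<beta> > 2 \<longrightarrow> m \<le> n1 * n2 \<longrightarrow>
       (let n = real (max n1 n2) in
         (real m \<ge> C * max (\<mu>1\<^sup>2) (max (\<mu>0 powr (1/2) * \<mu>1) (\<mu>0 * n powr (1/4)))
                     * n * real r * (\<beta> * ln n)
          \<longrightarrow> recovery_prob n1 n2 m M \<ge> 1 - c * n powr (-\<beta>)) \<and>
         (real r \<le> n powr (1/5) / \<mu>0 \<longrightarrow>
          real m \<ge> C * \<mu>0 * n powr (6/5) * real r * (\<beta> * ln n)
          \<longrightarrow> recovery_prob n1 n2 m M \<ge> 1 - c * n powr (-\<beta>))))"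
proof (rule exI[of _ rate_const], rule exI[of _ 3], intro conjI allI impI)
  show "rate_const > 0" "(3 :: real) > 0" by (auto simp: rate_const_def)
  fix n1 n2 m r :: nat and M \<sigma> u v and \<mu>0 \<mu>1 \<beta> :: real
  assume asm: "is_svd n1 n2 M r \<sigma> u v" "\<mu>0 > 0"
    "max (coherence n1 r u) (coherence n2 r v) \<le> \<mu>0" "\<beta> > 2" "m \<le> n1 * n2"
  define n where "n = real (max n1 n2)"
  note main = recovery_prob_ge[OF asm n_def]
  have "recovery_prob n1 n2 m M \<ge> 1 - 3 * n powr (-\<beta>)"
    if size: "real m \<ge> rate_const * max (\<mu>1\<^sup>2) (max (\<mu>0 powr (1/2) * \<mu>1) (\<mu>0 * n powr (1/4))) * n * real r * (\<beta> * ln n)"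
  proof (cases "n \<ge> 1")
    case True
    \<comment> \<open>n^(5/4) \<ge> n^(6/5): the first sample-size condition implies the second, and
      both claims reduce to \<open>recovery_prob_ge\<close>.\<close>
    have "n powr (1/4) * n = n powr (1/4 + 1)" using True by (simp only: powr_add) simp
    also have "\<dots> \<ge> n powr (6/5)" using True by (intro powr_mono) auto
    finally have "\<mu>0 * n powr (6/5) \<le> \<mu>0 * (n powr (1/4) * n)"
      using asm by (intro mult_left_mono) auto
    also have "\<dots> = (\<mu>0 * n powr (1/4)) * n" by (simp only: mult.assoc)
    also have "\<dots> \<le> max (\<mu>1\<^sup>2) (max (\<mu>0 powr (1/2) * \<mu>1) (\<mu>0 * n powr (1/4))) * n"
      using True by (intro mult_right_mono) auto
    finally have "(rate_const * (real r * (\<beta> * ln n))) * (\<mu>0 * n powr (6/5))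
        \<le> (rate_const * (real r * (\<beta> * ln n))) * (max (\<mu>1\<^sup>2) (max (\<mu>0 powr (1/2) * \<mu>1) (\<mu>0 * n powr (1/4))) * n)"
      using True asm by (intro mult_left_mono mult_nonneg_nonneg) (auto simp: rate_const_def)
    then have "rate_const * \<mu>0 * n powr (6/5) * real r * (\<beta> * ln n) \<le> real m"
      using size by (simp add: mult_ac)
    then show ?thesis by (rule main)
  next
    case False
    \<comment> \<open>With both dimensions 0 the required sample size is 0.\<close>
    then have "n = 0" by (auto simp: n_def)
    then show ?thesis using main by simp
  qed
  then show "let n = real (max n1 n2) in
         (real m \<ge> rate_const * max (\<mu>1\<^sup>2) (max (\<mu>0 powr (1/2) * \<mu>1) (\<mu>0 * n powr (1/4)))
                     * n * real r * (\<beta> * ln n)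
          \<longrightarrow> recovery_prob n1 n2 m M \<ge> 1 - 3 * n powr (-\<beta>)) \<and>
         (real r \<le> n powr (1/5) / \<mu>0 \<longrightarrow>
          real m \<ge> rate_const * \<mu>0 * n powr (6/5) * real r * (\<beta> * ln n)
          \<longrightarrow> recovery_prob n1 n2 m M \<ge> 1 - 3 * n powr (-\<beta>))"
    using main unfolding n_def[symmetric] Let_def by blast
qed

end
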